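(* Let $M\subset\mathbb C^{n+1}$ and $M'\subset\mathbb C^{n'+1}$ be connected real-analytic hypersurfaces and $U$ an open neighborhood of $M$ in $\mathbb C^{n+1}$. Assume that $M$ is holomorphically nondegenerate and $$e(M',p')+e_0(M',p')<\sup_{q\in M}e(M,q)\quad\text{for all } p'\in M'.$$ If $H\colon U\to\mathbb C^{n'+1}$ is a holomorphic mapping such that $H(M)\subset M'$, then there is an open subset $V\subset U$ with $M\subset V$ and $H(V)\subset M'$.
   Context: Hypersurface means real hypersurface. For a real-analytic hypersurface $M\subset\mathbb C^{n+1}$ with local defining function $\rho$ near $p\in M$ (real-valued, real-analytic, $d\rho\neq0$), the Levi form of $M$ at $p$ is represented by the hermitian form $\mathcal L(u,v)=\sum_{j,k}\rho_{Z_j\bar Z_k}(p)u_j\bar v_k$ restricted to the $n$-dimensional space $\{u\in\mathbb C^{n+1}:\sum_j\rho_{Z_j}(p)u_j=0\}$. Let $e_+,e_-,e_0$ be the numbers of positive, negative and zero eigenvalues of $\mathcal L$; set $e(M,p):=\min(e_+,e_-)$ and $e_0(M,p):=e_0$ (independent of the choice of $\rho$). A connected real-analytic hypersurface $M\subset \mathbb C^{n+1}$ is holomorphically nondegenerate if there is no point of $M$ at which there is a germ of a nontrivial (not identically zero) holomorphic $(1,0)$-vector field $\sum_j a_j(Z)\,\partial/\partial Z_j$ ($a_j$ holomorphic) tangent to $M$. *)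

theory Defs
  imports "HOL-Analysis.Analysis"
begin

text \<open>The space \<open>\<complex>\<^sup>n\<^sup>+\<^sup>1\<close> is rendered as \<open>complex ^ 'n\<close>, where \<open>'n\<close> is a finite index type with
  \<open>n + 1\<close> elements; \<open>*s\<close> is its complex scalar multiplication.\<close>

subsection \<open>Real-analytic functions and holomorphic maps in several variables\<close>

text \<open>The multi-indices are the functions \<open>Basis \<rightarrow>\<^sub>E UNIV\<close>.  The Euclidean basis of \<open>complex ^ 'n\<close>
  gives the real coordinates \<open>Re z\<^sub>j, Im z\<^sub>j\<close>, and \<open>has_sum\<close> is unconditional (hence absolute)
  convergence of the power series.\<close>

definition real_analytic_on :: "('a::euclidean_space \<Rightarrow> real) \<Rightarrow> 'a set \<Rightarrow> bool"
    (infix "real'_analytic'_on" 50) where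
  "f real_analytic_on S \<longleftrightarrow>
     (\<forall>p\<in>S. \<exists>r>0. \<exists>c :: ('a \<Rightarrow> nat) \<Rightarrow> real. \<forall>x\<in>ball p r.
        ((\<lambda>\<alpha>. c \<alpha> * (\<Prod>b\<in>Basis. ((x - p) \<bullet> b) ^ \<alpha> b)) has_sum f x) (Basis \<rightarrow>\<^sub>E UNIV))"

definition holomorphic_map_on :: "(complex ^ 'n \<Rightarrow> complex ^ 'm) \<Rightarrow> (complex ^ 'n) set \<Rightarrow> bool"
    (infix "holomorphic'_map'_on" 50) where
  "F holomorphic_map_on S \<longleftrightarrow>
     (\<forall>p\<in>S. \<exists>D. (F has_derivative D) (at p) \<and> (\<forall>c v. D (c *s v) = c *s D v))"

subsection \<open>Real-analytic hypersurfaces\<close>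

definition local_defining_function ::
    "(complex ^ 'n) set \<Rightarrow> complex ^ 'n \<Rightarrow> (complex ^ 'n) set \<Rightarrow> (complex ^ 'n \<Rightarrow> real) \<Rightarrow> bool" where
  "local_defining_function M p W \<rho> \<longleftrightarrow>
     open W \<and> p \<in> W \<and> \<rho> real_analytic_on W \<and>
     (\<forall>z\<in>W. frechet_derivative \<rho> (at z) \<noteq> (\<lambda>v. 0)) \<and>
     M \<inter> W = {z \<in> W. \<rho> z = 0}"

definition real_analytic_hypersurface :: "(complex ^ 'n) set \<Rightarrow> bool" where
  "real_analytic_hypersurface M \<longleftrightarrow> (\<forall>p\<in>M. \<exists>W \<rho>. local_defining_function M p W \<rho>)"

subsection \<open>The Levi form\<close>

text \<open>The Wirtinger derivatives \<open>\<partial>/\<partial>Z\<^sub>j = (\<partial>/\<partial>x\<^sub>j - \<i> \<partial>/\<partial>y\<^sub>j) / 2\<close> and their conjugates, for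
  \<open>Z\<^sub>j = x\<^sub>j + \<i> y\<^sub>j\<close>.\<close>

definition dZ :: "'n::finite \<Rightarrow> (complex ^ 'n \<Rightarrow> complex) \<Rightarrow> complex ^ 'n \<Rightarrow> complex" where
  "dZ j f p = (frechet_derivative f (at p) (axis j 1) -
               \<i> * frechet_derivative f (at p) (axis j \<i>)) / 2"

definition dZbar :: "'n::finite \<Rightarrow> (complex ^ 'n \<Rightarrow> complex) \<Rightarrow> complex ^ 'n \<Rightarrow> complex" where
  "dZbar j f p = (frechet_derivative f (at p) (axis j 1) +
                  \<i> * frechet_derivative f (at p) (axis j \<i>)) / 2"

definition levi_form ::
    "(complex ^ 'n \<Rightarrow> real) \<Rightarrow> complex ^ 'n \<Rightarrow> complex ^ 'n \<Rightarrow> complex ^ 'n \<Rightarrow> complex" where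
  "levi_form \<rho> p u v =
     (\<Sum>j\<in>UNIV. \<Sum>k\<in>UNIV. dZbar k (dZ j (\<lambda>z. complex_of_real (\<rho> z))) p * u $ j * cnj (v $ k))"

definition holomorphic_tangent_space :: "(complex ^ 'n \<Rightarrow> real) \<Rightarrow> complex ^ 'n \<Rightarrow> (complex ^ 'n) set" where
  "holomorphic_tangent_space \<rho> p =
     {u. (\<Sum>j\<in>UNIV. dZ j (\<lambda>z. complex_of_real (\<rho> z)) p * u $ j) = 0}"

text \<open>Eigenvalues of the restricted form are taken with respect to the standard hermitian inner
  product of \<open>\<complex>\<^sup>n\<^sup>+\<^sup>1\<close>, that is, they are those of its matrix in a unitary basis of the tangent space.
  They are counted with multiplicity, the complex dimension \<open>vec.dim\<close> of the eigenspace.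
  The sums are finite: there are at most \<open>n\<close> eigenvalues.\<close>

definition levi_eigenspace :: "(complex ^ 'n \<Rightarrow> real) \<Rightarrow> complex ^ 'n \<Rightarrow> real \<Rightarrow> (complex ^ 'n) set" where
  "levi_eigenspace \<rho> p l =
     {u \<in> holomorphic_tangent_space \<rho> p. \<forall>v \<in> holomorphic_tangent_space \<rho> p.
        levi_form \<rho> p u v = complex_of_real l * (\<Sum>j\<in>UNIV. u $ j * cnj (v $ j))}"

definition levi_eigenvalues :: "(complex ^ 'n \<Rightarrow> real) \<Rightarrow> complex ^ 'n \<Rightarrow> real set" where
  "levi_eigenvalues \<rho> p = {l. \<exists>u \<in> levi_eigenspace \<rho> p l. u \<noteq> 0}"

definition levi_pos :: "(complex ^ 'n \<Rightarrow> real) \<Rightarrow> complex ^ 'n \<Rightarrow> nat" where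
  "levi_pos \<rho> p = (\<Sum>l \<in> {l \<in> levi_eigenvalues \<rho> p. l > 0}. vec.dim (levi_eigenspace \<rho> p l))"

definition levi_neg :: "(complex ^ 'n \<Rightarrow> real) \<Rightarrow> complex ^ 'n \<Rightarrow> nat" where
  "levi_neg \<rho> p = (\<Sum>l \<in> {l \<in> levi_eigenvalues \<rho> p. l < 0}. vec.dim (levi_eigenspace \<rho> p l))"

definition levi_zero :: "(complex ^ 'n \<Rightarrow> real) \<Rightarrow> complex ^ 'n \<Rightarrow> nat" where
  "levi_zero \<rho> p = vec.dim (levi_eigenspace \<rho> p 0)"

text \<open>The numbers \<open>e(M,p)\<close> and \<open>e\<^sub>0(M,p)\<close> do not depend on the local defining function chosen
  (a change of sign swaps \<open>e\<^sub>+\<close> and \<open>e\<^sub>-\<close>).\<close>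

definition some_defining_function :: "(complex ^ 'n) set \<Rightarrow> complex ^ 'n \<Rightarrow> complex ^ 'n \<Rightarrow> real" where
  "some_defining_function M p = (SOME \<rho>. \<exists>W. local_defining_function M p W \<rho>)"

definition levi_e :: "(complex ^ 'n) set \<Rightarrow> complex ^ 'n \<Rightarrow> nat" where
  "levi_e M p = min (levi_pos (some_defining_function M p) p) (levi_neg (some_defining_function M p) p)"

definition levi_e0 :: "(complex ^ 'n) set \<Rightarrow> complex ^ 'n \<Rightarrow> nat" where
  "levi_e0 M p = levi_zero (some_defining_function M p) p"

subsection \<open>Holomorphic nondegeneracy\<close>

text \<open>The field \<open>\<Sum>\<^sub>j a\<^sub>j(Z) \<partial>/\<partial>Z\<^sub>j\<close> is tangent to \<open>M\<close> iff it annihilates \<open>\<rho>\<close> at the points of \<open>M\<close>;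
  a germ at \<open>p\<close> is nontrivial iff no representative vanishes on a neighbourhood of \<open>p\<close>.\<close>

definition holomorphically_nondegenerate :: "(complex ^ 'n) set \<Rightarrow> bool" where
  "holomorphically_nondegenerate M \<longleftrightarrow>
     \<not> (\<exists>p\<in>M. \<exists>W \<rho>. \<exists>a :: complex ^ 'n \<Rightarrow> complex ^ 'n.
          local_defining_function M p W \<rho> \<and>
          a holomorphic_map_on W \<and>
          \<not> (\<forall>\<^sub>F z in nhds p. a z = 0) \<and>
          (\<forall>z\<in>M \<inter> W. a z \<in> holomorphic_tangent_space \<rho> z))"

end

theory Submission
  imports Defs "HOL-Complex_Analysis.Conformal_Mappings"
begin

text \<open>Let \<open>\<rho>\<close> and \<open>\<rho>'\<close> be defining functions of \<open>M\<close> and \<open>M'\<close> and \<open>f = \<rho>' \<circ> H\<close>.  By the identity theorem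
  and connectedness of \<open>M\<close>, either \<open>f\<close> vanishes near every point of \<open>M\<close>, which is the claim, or near
  none.  In the second case let \<open>k\<close> be the generic order of vanishing of \<open>f\<close> along \<open>M\<close>.  Holomorphic
  vector fields \<open>a\<close> in the kernel of \<open>dH\<close> annihilate \<open>f\<close>, and comparing terms of order \<open>k - 1\<close> shows
  that they are tangent to \<open>M\<close>; so holomorphic nondegeneracy makes \<open>dH\<close> injective at points of \<open>M\<close>
  arbitrarily close to a point where \<open>e(M, \<cdot>)\<close> is maximal.  At such a point \<open>q\<close> one has \<open>df = c d\<rho>\<close>, and
  \<open>dH\<close> pulls the Levi form of \<open>M'\<close> back to \<open>c\<close> times that of \<open>M\<close>.  If \<open>c \<noteq> 0\<close>, then \<open>e(M, q) \<le> e(M', H q)\<close>;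
  if \<open>c = 0\<close>, then \<open>dH\<close> maps the tangent space of \<open>M\<close> injectively onto an isotropic subspace, whose
  dimension is at most \<open>e(M', H q) + e\<^sub>0(M', H q)\<close>.  Both contradict the hypothesis.

  Real-analytic functions are handled through \<open>f(z) = F(z, cnj z)\<close> with \<open>F\<close> holomorphic.\<close>

subsection \<open>Holomorphic functions of several variables\<close>

text \<open>Heuristically f = g \<rho>^k near a generic point of M, but no division by \<rho> takes
  place. The order k is detected by iterated derivatives of the complexification in one fixed real
  direction v transversal to M, and a function vanishing on M is exploited only through its
  differential, which is a multiple of d\<rho> there. In the same spirit the comparison of Levi
  forms differentiates a 2 by 2 determinant of first derivatives instead of a quotient.

  The point where dH is injective cannot be prescribed. The supremum of e(M, .) is attained, being
  bounded by the dimension, and definite subspaces of the Levi form persist at nearby points; hence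
  an injective point close enough to the maximum serves as well.

  Complexification makes z and its conjugate independent variables: the Wirtinger operators become
  commuting directional derivatives, and the one-variable identity theorem on complex lines applies
  to real-analytic functions.\<close>

lemma norm_vector_scalar_mult: "norm (c *s v) = norm c * norm v" for v :: "complex ^ 'n"
  by (simp add: norm_vec_def norm_mult L2_set_right_distrib)

lemma scaleR_eq_of_real_smult: "r *\<^sub>R v = complex_of_real r *s v" for v :: "complex ^ 'n"
  by (simp add: vec_eq_iff complex_eq_iff)

lemma bounded_linear_smult_left: "bounded_linear (\<lambda>c. c *s v)" for v :: "complex ^ 'n"
  by (rule bounded_linear_intro[where K = "norm v"])
    (auto simp: vec.scale_left_distrib vec_eq_iff norm_vector_scalar_mult)

lemmas continuous_on_smult_left [continuous_intros] =
  bounded_linear.continuous_on [OF bounded_linear_smult_left]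

text \<open>Real differentiability with a complex-linear derivative at each point. Continuity of the
  derivative is not demanded but recovered from Cauchy's formula in
  \<open>continuous_on_dir_deriv\<close>.\<close>

definition hol_on :: "(complex ^ 'k \<Rightarrow> complex) \<Rightarrow> (complex ^ 'k) set \<Rightarrow> bool" (infix "hol'_on" 50) where
  "F hol_on S \<longleftrightarrow> (\<forall>p\<in>S. \<exists>D. (F has_derivative D) (at p) \<and> (\<forall>c v. D (c *s v) = c * D v))"

text \<open>The direction comes first so that \<open>dir_deriv v\<close> is an operator on functions
  that can be iterated with \<open>^^\<close>. Being a real directional derivative, it serves for
  holomorphic functions, for the map \<open>H\<close> and for functions that are only real
  differentiable.\<close>

definition dir_deriv :: "'a \<Rightarrow> ('a::real_normed_vector \<Rightarrow> 'b::real_normed_vector) \<Rightarrow> 'a \<Rightarrow> 'b" where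
  "dir_deriv v F p = frechet_derivative F (at p) v"

lemma hol_onI:
  "(\<And>p. p \<in> S \<Longrightarrow> (F has_derivative D p) (at p)) \<Longrightarrow> (\<And>p c v. p \<in> S \<Longrightarrow> D p (c *s v) = c * D p v) \<Longrightarrow> F hol_on S"
  unfolding hol_on_def by blast

lemma dir_deriv_eqI: "(F has_derivative D) (at p) \<Longrightarrow> dir_deriv v F p = D v"
  unfolding dir_deriv_def using frechet_derivative_at by metis

lemma hol_on_has_derivative:
  assumes "F hol_on S" "p \<in> S"
  shows "(F has_derivative (\<lambda>v. dir_deriv v F p)) (at p)"
  using assms unfolding hol_on_def dir_deriv_def
  by (metis differentiableI eta_contract_eq frechet_derivative_works)

lemma hol_on_subset: "F hol_on S \<Longrightarrow> T \<subseteq> S \<Longrightarrow> F hol_on T"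
  unfolding hol_on_def by blast

lemma dir_deriv_smult:
  assumes "F hol_on S" "p \<in> S"
  shows "dir_deriv (c *s v) F p = c * dir_deriv v F p"
  using assms unfolding hol_on_def by (metis dir_deriv_eqI)

lemma dir_deriv_add:
  assumes "F hol_on S" "p \<in> S"
  shows "dir_deriv (u + v) F p = dir_deriv u F p + dir_deriv v F p"
  using has_derivative_linear[OF hol_on_has_derivative[OF assms]] by (rule linear_add)

lemma dir_deriv_sum:
  assumes "F hol_on S" "p \<in> S"
  shows "dir_deriv (sum g A) F p = (\<Sum>a\<in>A. dir_deriv (g a) F p)"
  using has_derivative_linear[OF hol_on_has_derivative[OF assms]] by (rule linear_sum)

lemma dir_deriv_0:
  assumes "F hol_on S" "p \<in> S"
  shows "dir_deriv 0 F p = 0"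
  using has_derivative_linear[OF hol_on_has_derivative[OF assms]] by (rule linear_0)

lemma dir_deriv_cong_open:
  assumes "open S" "p \<in> S" "\<And>z. z \<in> S \<Longrightarrow> F z = G z"
  shows "dir_deriv v F p = dir_deriv v G p"
proof -
  have "(F has_derivative D) (at p) \<longleftrightarrow> (G has_derivative D) (at p)" for D
    using assms by (metis has_derivative_transform_within_open)
  then show ?thesis unfolding dir_deriv_def frechet_derivative_def by simp
qed

lemma hol_on_cong:
  assumes "open S" "\<And>z. z \<in> S \<Longrightarrow> F z = G z" "F hol_on S"
  shows "G hol_on S"
  using assms unfolding hol_on_def by (metis has_derivative_transform_within_open)

lemma hol_on_imp_continuous_on: "F hol_on S \<Longrightarrow> continuous_on S F"
  by (meson continuous_at_imp_continuous_on has_derivative_continuous hol_on_has_derivative)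

lemma hol_on_line:
  assumes "F hol_on S" "z + \<zeta> *s v \<in> S"
  shows "((\<lambda>\<zeta>. F (z + \<zeta> *s v)) has_field_derivative dir_deriv v F (z + \<zeta> *s v)) (at \<zeta>)"
proof -
  have "((\<lambda>\<zeta>. z + \<zeta> *s v) has_derivative (\<lambda>\<zeta>. \<zeta> *s v)) (at \<zeta>)"
    by (auto intro!: derivative_eq_intros bounded_linear_imp_has_derivative bounded_linear_smult_left)
  from has_derivative_compose[OF this hol_on_has_derivative[OF assms]]
  show ?thesis
    by (simp add: has_field_derivative_def dir_deriv_smult[OF assms] mult_commute_abs)
qed

lemma hol_on_line_holomorphic:
  assumes "F hol_on S" "\<And>\<zeta>. \<zeta> \<in> A \<Longrightarrow> z + \<zeta> *s v \<in> S"
  shows "(\<lambda>\<zeta>. F (z + \<zeta> *s v)) holomorphic_on A"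
  using hol_on_line[OF assms(1)] assms(2)
  unfolding holomorphic_on_def field_differentiable_def
  by (meson has_field_derivative_at_within)

section \<open>Cauchy's formula along a complex direction and regularity of derivatives\<close>

definition circ :: "real \<Rightarrow> real \<Rightarrow> complex" where
  "circ d t = complex_of_real d * exp (2 * of_real pi * \<i> * of_real t)"

lemma norm_circ: "d \<ge> 0 \<Longrightarrow> norm (circ d t) = d"
  by (simp add: circ_def norm_mult)

lemma circ_nonzero: "d > 0 \<Longrightarrow> circ d t \<noteq> 0"
  by (simp add: circ_def)

lemma continuous_on_circ [continuous_intros]:
  "continuous_on A g \<Longrightarrow> continuous_on A (\<lambda>x. circ d (g x))"
  unfolding circ_def by (intro continuous_intros)

text \<open>Cauchy's formula for the derivative at 0 of the slice \<zeta> \<mapsto> F(z + \<zeta>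
  v), with 2 pi i and one power of the circle parameter cancelled. It expresses a derivative by
  values of F alone, so its regularity in z follows by differentiating under the integral.\<close>

lemma dir_deriv_Cauchy:
  assumes F: "F hol_on S" and d: "d > 0" and sub: "\<And>\<zeta>. norm \<zeta> \<le> d \<Longrightarrow> z + \<zeta> *s v \<in> S"
  shows "dir_deriv v F z = integral {0..1} (\<lambda>t. F (z + circ d t *s v) / circ d t)"
proof -
  define f where "f = (\<lambda>\<zeta>. F (z + \<zeta> *s v))"
  have hol: "f holomorphic_on cball 0 d"
    unfolding f_def by (rule hol_on_line_holomorphic[OF F]) (use sub in auto)
  have 1: "(f has_field_derivative (1 / (2 * of_real pi * \<i>) * contour_integral (circlepath 0 d) (\<lambda>u. f u / (u - 0)^2))) (at 0)"
    by (rule Cauchy_derivative_integral_circlepath(2))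
      (use d hol in \<open>auto intro: holomorphic_on_imp_continuous_on holomorphic_on_subset\<close>)
  have 2: "(f has_field_derivative dir_deriv v F z) (at 0)"
    using hol_on_line[OF F, of z 0 v] sub[of 0] d unfolding f_def by simp
  have "dir_deriv v F z = 1 / (2 * of_real pi * \<i>) * contour_integral (circlepath 0 d) (\<lambda>u. f u / (u - 0)^2)"
    using DERIV_unique[OF 2 1] .
  also have "contour_integral (circlepath 0 d) (\<lambda>u. f u / (u - 0)^2) =
     integral {0..1} (\<lambda>t. (2 * of_real pi * \<i>) * (f (circ d t) / circ d t))"
    unfolding contour_integral_integral vector_derivative_circlepath
    by (rule arg_cong[where f = "integral _"])
      (use d in \<open>auto simp: fun_eq_iff circlepath circ_def power2_eq_square field_simps\<close>)
  also have "\<dots> = (2 * of_real pi * \<i>) * integral {0..1} (\<lambda>t. f (circ d t) / circ d t)"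
    by (rule integral_mult_right)
  finally show ?thesis unfolding f_def by simp
qed

text \<open>One disc radius d serves all centres z near p, as the parameter-dependent Cauchy
  integral requires.\<close>

lemma exists_radius:
  fixes S :: "(complex ^ 'k) set"
  assumes "open S" "p \<in> S"
  obtains r d where "r > 0" "d > 0" "ball p r \<subseteq> S"
    "\<And>z \<zeta>. z \<in> ball p r \<Longrightarrow> norm \<zeta> \<le> d \<Longrightarrow> z + \<zeta> *s v \<in> S"
proof -
  obtain e where e: "e > 0" "ball p e \<subseteq> S" using assms openE by blast
  \<comment> \<open>This gives d * norm v \<le> e / 2; the added 1 keeps the denominator positive
    for v = 0.\<close>
  define d where "d = e / (2 * (norm v + 1))"
  have nv: "norm v + 1 > 0" by (smt (verit) norm_ge_zero)
  have d: "d > 0" using e nv by (simp add: d_def)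
  have dv: "d * norm v \<le> e / 2"
  proof -
    have "d * norm v \<le> d * (norm v + 1)" using d by simp
    also have "\<dots> = e / 2" using nv by (simp add: d_def field_simps)
    finally show ?thesis .
  qed
  show ?thesis
  proof (rule that[of "e/2" d])
    fix z \<zeta> assume z: "z \<in> ball p (e/2)" and ze: "norm (\<zeta>::complex) \<le> d"
    have "norm (\<zeta> *s v) \<le> e / 2"
      using dv mult_right_mono[OF ze norm_ge_zero[of v]] by (simp add: norm_vector_scalar_mult)
    then have "dist p (z + \<zeta> *s v) < e"
      using z dist_triangle[of p "z + \<zeta> *s v" z] by (simp add: dist_norm)
    then show "z + \<zeta> *s v \<in> S" using e by auto
  qed (use e d in auto)
qed

lemma continuous_on_line_circ:
  assumes "continuous_on S F" "d > 0" "\<And>z \<zeta>. z \<in> U \<Longrightarrow> norm \<zeta> \<le> d \<Longrightarrow> z + \<zeta> *s v \<in> S"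
  shows "continuous_on (U \<times> A) (\<lambda>(z, t). F (z + circ d t *s v) / circ d t)"
  unfolding case_prod_unfold
  by (intro continuous_intros continuous_on_compose2[OF assms(1)] bounded_linear.continuous_on[OF bounded_linear_smult_left])
    (use assms norm_circ circ_nonzero in auto)

text \<open>The Cauchy integral is continuous in its centre because F is. This upgrades pointwise
  complex differentiability to continuous differentiability, on which the Leibniz rule below
  relies.\<close>

lemma continuous_on_dir_deriv:
  assumes "open S" "F hol_on S"
  shows "continuous_on S (dir_deriv v F)"
proof (rule continuous_at_imp_continuous_on, rule ballI)
  fix p assume "p \<in> S"
  obtain r d where rd: "r > 0" "d > 0" "ball p r \<subseteq> S" "\<And>z \<zeta>. z \<in> ball p r \<Longrightarrow> norm \<zeta> \<le> d \<Longrightarrow> z + \<zeta> *s v \<in> S"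
    using exists_radius[OF \<open>open S\<close> \<open>p \<in> S\<close>, of v] by metis
  have "continuous_on (ball p r) (\<lambda>z. integral (cbox 0 1) (\<lambda>t. F (z + circ d t *s v) / circ d t))"
    by (rule integral_continuous_on_param,
        rule continuous_on_line_circ[OF hol_on_imp_continuous_on[OF assms(2)] rd(2,4)])
  then have "continuous_on (ball p r) (dir_deriv v F)"
    by (rule continuous_on_cong[THEN iffD1, rotated 2])
      (use dir_deriv_Cauchy[OF assms(2) rd(2)] rd in auto)
  then show "isCont (dir_deriv v F) p"
    using rd(1) by (auto simp: continuous_on_eq_continuous_at)
qed

text \<open>Differentiation under the Cauchy integral. The derivative is returned in explicit form
  because it is used twice: its complex linearity in h gives \<open>hol_on_dir_deriv\<close>, and
  comparing it with Cauchy's formula gives \<open>dir_deriv_commute\<close>.\<close>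

lemma hol_on_dir_deriv_aux:
  assumes "open S" "F hol_on S" "p \<in> S"
  obtains r d where "r > 0" "d > 0" "\<And>z \<zeta>. z \<in> ball p r \<Longrightarrow> norm \<zeta> \<le> d \<Longrightarrow> z + \<zeta> *s v \<in> S"
    "(dir_deriv v F has_derivative (\<lambda>h. integral {0..1} (\<lambda>t. dir_deriv h F (p + circ d t *s v) / circ d t))) (at p)"
proof -
  obtain r d where rd: "r > 0" "d > 0" "ball p r \<subseteq> S" "\<And>z \<zeta>. z \<in> ball p r \<Longrightarrow> norm \<zeta> \<le> d \<Longrightarrow> z + \<zeta> *s v \<in> S"
    using exists_radius[OF \<open>open S\<close> \<open>p \<in> S\<close>, of v] by metis
  define U where "U = ball p r"
  \<comment> \<open>\<open>leibniz_rule\<close> wants the derivative of the integrand as a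
    continuous function into bounded linear maps; continuity there is checked on basis vectors,
    where \<open>continuous_on_dir_deriv\<close> applies.\<close>
  define fx where "fx = (\<lambda>z t. Blinfun (\<lambda>h. dir_deriv h F (z + circ d t *s v) / circ d t))"
  have inS: "z + circ d t *s v \<in> S" if "z \<in> U" for z t
    using rd that norm_circ[of d t] by (simp add: U_def)
  have bl: "bounded_linear (\<lambda>h. dir_deriv h F (z + circ d t *s v) / circ d t)" if "z \<in> U" for z t
    using hol_on_has_derivative[OF assms(2) inS[OF that]]
    by (intro bounded_linear_compose[OF bounded_linear_divide]) (auto dest: has_derivative_bounded_linear)
  have fx: "blinfun_apply (fx z t) = (\<lambda>h. dir_deriv h F (z + circ d t *s v) / circ d t)" if "z \<in> U" for z t
    unfolding fx_def by (rule bounded_linear_Blinfun_apply[OF bl[OF that]])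
  have der: "((\<lambda>z. F (z + circ d t *s v) / circ d t) has_derivative blinfun_apply (fx z t)) (at z within U)"
    if "z \<in> U" for z t
  proof -
    have "((\<lambda>z. F (z + circ d t *s v)) has_derivative (\<lambda>h. dir_deriv h F (z + circ d t *s v))) (at z)"
      by (rule has_derivative_compose[where f = "\<lambda>z. z + circ d t *s v" and f' = "\<lambda>h. h", OF _ hol_on_has_derivative[OF assms(2) inS[OF that, of t]]])
        (auto intro!: derivative_eq_intros)
    then have "((\<lambda>z. F (z + circ d t *s v) / circ d t) has_derivative (\<lambda>h. dir_deriv h F (z + circ d t *s v) / circ d t)) (at z)"
      by (rule bounded_linear.has_derivative[OF bounded_linear_divide])
    then show ?thesis unfolding fx[OF that] by (rule has_derivative_at_withinI)
  qed
  have cont: "continuous_on (U \<times> cbox 0 1) (\<lambda>(z, t). fx z t)"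
  proof (rule continuous_on_blinfun_componentwise)
    fix i :: "complex ^ 'a" assume "i \<in> Basis"
    have "continuous_on (U \<times> cbox (0::real) 1) (\<lambda>(z, t). dir_deriv i F (z + circ d t *s v) / circ d t)"
      by (rule continuous_on_line_circ[OF continuous_on_dir_deriv[OF assms(1,2)] rd(2)])
        (use rd U_def in auto)
    then show "continuous_on (U \<times> cbox 0 1) (\<lambda>x. blinfun_apply (case x of (z, t) \<Rightarrow> fx z t) i)"
      by (rule continuous_on_cong[THEN iffD1, rotated 2]) (auto simp: fx)
  qed
  have p: "p \<in> U" using rd by (simp add: U_def)
  have "((\<lambda>z. integral (cbox 0 1) (\<lambda>t. F (z + circ d t *s v) / circ d t)) has_derivative
      blinfun_apply (integral (cbox 0 1) (fx p))) (at p within U)"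
  proof (rule leibniz_rule[OF der _ cont p])
    fix z assume z: "z \<in> U"
    have c: "continuous_on (cbox 0 1) (Pair z :: real \<Rightarrow> _)" by (intro continuous_intros)
    have "continuous_on (cbox 0 1) (\<lambda>t. F (z + circ d t *s v) / circ d t)"
      using continuous_on_compose2[OF continuous_on_line_circ[OF hol_on_imp_continuous_on[OF assms(2)] rd(2), of U v UNIV] c]
        rd(4) z by (simp add: U_def image_subset_iff)
    then show "(\<lambda>t. F (z + circ d t *s v) / circ d t) integrable_on cbox 0 1"
      by (rule integrable_continuous)
  qed (auto simp: U_def)
  then have D: "((\<lambda>z. integral (cbox 0 1) (\<lambda>t. F (z + circ d t *s v) / circ d t)) has_derivative
      blinfun_apply (integral (cbox 0 1) (fx p))) (at p)"
    using p by (subst (asm) at_within_open) (auto simp: U_def)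
  have "continuous_on (cbox 0 1) (fx p)"
    using continuous_on_compose2[OF cont, of "cbox 0 1" "Pair p"] p
    by (simp add: continuous_on_Pair continuous_on_id image_subset_iff)
  then have "fx p integrable_on cbox 0 1" by (rule integrable_continuous)
  then have "blinfun_apply (integral (cbox 0 1) (fx p)) h = integral (cbox 0 1) (\<lambda>t. dir_deriv h F (p + circ d t *s v) / circ d t)" for h
    by (subst blinfun_apply_integral) (auto simp: fx[OF p])
  then have eq: "blinfun_apply (integral (cbox 0 1) (fx p)) = (\<lambda>h. integral {0..1} (\<lambda>t. dir_deriv h F (p + circ d t *s v) / circ d t))"
    by auto
  have "(dir_deriv v F has_derivative (\<lambda>h. integral {0..1} (\<lambda>t. dir_deriv h F (p + circ d t *s v) / circ d t))) (at p)"
    by (rule has_derivative_transform_within_open[OF D[unfolded eq], of U])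
      (use dir_deriv_Cauchy[OF assms(2) rd(2)] rd p in \<open>auto simp: U_def\<close>)
  then show ?thesis using that rd by blast
qed

lemma hol_on_dir_deriv:
  assumes "open S" "F hol_on S"
  shows "dir_deriv v F hol_on S"
  unfolding hol_on_def
proof
  fix p assume p: "p \<in> S"
  obtain r d where rd: "r > 0" "d > 0" "\<And>z \<zeta>. z \<in> ball p r \<Longrightarrow> norm \<zeta> \<le> d \<Longrightarrow> z + \<zeta> *s v \<in> S"
    and D: "(dir_deriv v F has_derivative (\<lambda>h. integral {0..1} (\<lambda>t. dir_deriv h F (p + circ d t *s v) / circ d t))) (at p)"
    by (rule hol_on_dir_deriv_aux[OF assms p, of v]) blast
  have "integral {0..1} (\<lambda>t. dir_deriv (c *s h) F (p + circ d t *s v) / circ d t) =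
      c * integral {0..1} (\<lambda>t. dir_deriv h F (p + circ d t *s v) / circ d t)" for c h
  proof -
    have "p + circ d t *s v \<in> S" for t using rd norm_circ[of d t] by auto
    then show ?thesis
      by (simp add: dir_deriv_smult[OF assms(2)] flip: integral_mult_right)
  qed
  then show "\<exists>D. (dir_deriv v F has_derivative D) (at p) \<and> (\<forall>c v. D (c *s v) = c * D v)"
    using D by blast
qed

text \<open>Differentiating the Cauchy integral for direction v in direction w gives the Cauchy
  integral of \<open>dir_deriv w F\<close>, which is its derivative in direction v by the same
  formula.\<close>

lemma dir_deriv_commute:
  assumes "open S" "F hol_on S" "p \<in> S"
  shows "dir_deriv w (dir_deriv v F) p = dir_deriv v (dir_deriv w F) p"
proof -
  obtain r d where rd: "r > 0" "d > 0" "\<And>z \<zeta>. z \<in> ball p r \<Longrightarrow> norm \<zeta> \<le> d \<Longrightarrow> z + \<zeta> *s v \<in> S"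
    and D: "(dir_deriv v F has_derivative (\<lambda>h. integral {0..1} (\<lambda>t. dir_deriv h F (p + circ d t *s v) / circ d t))) (at p)"
    by (rule hol_on_dir_deriv_aux[OF assms, of v]) blast
  show ?thesis
    unfolding dir_deriv_eqI[OF D]
    by (rule dir_deriv_Cauchy[OF hol_on_dir_deriv[OF assms(1,2)] rd(2), symmetric])
      (use rd in auto)
qed

section \<open>Closure properties of holomorphic functions\<close>

lemma hol_on_const [simp, intro]: "(\<lambda>z. c) hol_on S"
  by (rule hol_onI[where D = "\<lambda>_ _. 0"]) auto

lemma hol_on_add:
  assumes "F hol_on S" "G hol_on S"
  shows "(\<lambda>z. F z + G z) hol_on S"
  by (rule hol_onI[where D = "\<lambda>p v. dir_deriv v F p + dir_deriv v G p"])
    (auto intro!: derivative_intros hol_on_has_derivative assms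
      simp: dir_deriv_smult[OF assms(1)] dir_deriv_smult[OF assms(2)] algebra_simps)

lemma hol_on_mult:
  assumes "F hol_on S" "G hol_on S"
  shows "(\<lambda>z. F z * G z) hol_on S"
  by (rule hol_onI[where D = "\<lambda>p v. F p * dir_deriv v G p + dir_deriv v F p * G p"])
    (rule has_derivative_mult[OF hol_on_has_derivative[OF assms(1)] hol_on_has_derivative[OF assms(2)]],
      assumption+, simp add: dir_deriv_smult[OF assms(1)] dir_deriv_smult[OF assms(2)] algebra_simps)

lemma dir_deriv_mult:
  assumes "F hol_on S" "G hol_on S" "p \<in> S"
  shows "dir_deriv v (\<lambda>z. F z * G z) p = F p * dir_deriv v G p + dir_deriv v F p * G p"
  by (rule dir_deriv_eqI) (intro has_derivative_mult hol_on_has_derivative[where S = S] assms)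

lemma hol_on_diff:
  assumes "F hol_on S" "G hol_on S"
  shows "(\<lambda>z. F z - G z) hol_on S"
  using hol_on_add[OF assms(1) hol_on_mult[OF hol_on_const[of "-1"] assms(2)]] by simp

lemma dir_deriv_diff:
  assumes "F hol_on S" "G hol_on S" "p \<in> S"
  shows "dir_deriv v (\<lambda>z. F z - G z) p = dir_deriv v F p - dir_deriv v G p"
  by (rule dir_deriv_eqI) (intro has_derivative_diff hol_on_has_derivative[where S = S] assms)

lemma hol_on_sum: "(\<And>a. a \<in> A \<Longrightarrow> F a hol_on S) \<Longrightarrow> (\<lambda>z. \<Sum>a\<in>A. F a z) hol_on S"
  by (induction A rule: infinite_finite_induct) (auto intro: hol_on_add)

lemma hol_on_prod: "(\<And>a. a \<in> A \<Longrightarrow> F a hol_on S) \<Longrightarrow> (\<lambda>z. \<Prod>a\<in>A. F a z) hol_on S"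
  by (induction A rule: infinite_finite_induct) (auto intro: hol_on_mult)

lemma hol_on_power: "F hol_on S \<Longrightarrow> (\<lambda>z. F z ^ n) hol_on S"
  by (induction n) (auto intro: hol_on_mult)

lemma hol_on_inverse:
  assumes "F hol_on S" "\<And>z. z \<in> S \<Longrightarrow> F z \<noteq> 0"
  shows "(\<lambda>z. inverse (F z)) hol_on S"
  by (rule hol_onI[where D = "\<lambda>p v. - (inverse (F p) * dir_deriv v F p * inverse (F p))"])
    (rule Deriv.has_derivative_inverse[OF assms(2) hol_on_has_derivative[OF assms(1)]],
      assumption+, simp add: dir_deriv_smult[OF assms(1)] algebra_simps)

lemma hol_on_linear:
  assumes "bounded_linear F" "\<And>c v. F (c *s v) = c * F v"
  shows "F hol_on S"
  by (rule hol_onI[where D = "\<lambda>_. F"])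
    (use assms in \<open>auto intro: bounded_linear_imp_has_derivative\<close>)

lemma hol_on_component: "(\<lambda>z. z $ j) hol_on S"
  by (rule hol_on_linear) (auto intro: bounded_linear_vec_nth)

section \<open>Holomorphic maps and their components\<close>

lemma holomorphic_map_on_has_derivative:
  assumes "H holomorphic_map_on S" "p \<in> S"
  shows "(H has_derivative (\<lambda>v. dir_deriv v H p)) (at p)"
    and "dir_deriv (c *s v) H p = c *s dir_deriv v H p"
proof -
  obtain D where D: "(H has_derivative D) (at p)" "\<And>c v. D (c *s v) = c *s D v"
    using assms unfolding holomorphic_map_on_def by blast
  have "dir_deriv v H p = D v" for v by (rule dir_deriv_eqI[OF D(1)])
  then show "(H has_derivative (\<lambda>v. dir_deriv v H p)) (at p)"
      and "dir_deriv (c *s v) H p = c *s dir_deriv v H p"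
    using D by auto
qed

lemma hol_on_compose_map:
  assumes "F hol_on T" "H holomorphic_map_on S" "H ` S \<subseteq> T"
  shows "(\<lambda>z. F (H z)) hol_on S"
    and "p \<in> S \<Longrightarrow> dir_deriv v (\<lambda>z. F (H z)) p = dir_deriv (dir_deriv v H p) F (H p)"
proof -
  have D: "((\<lambda>z. F (H z)) has_derivative (\<lambda>v. dir_deriv (dir_deriv v H p) F (H p))) (at p)" if "p \<in> S" for p
    using has_derivative_compose[OF holomorphic_map_on_has_derivative(1)[OF assms(2) that] hol_on_has_derivative[OF assms(1)]]
      assms(3) that by blast
  show "(\<lambda>z. F (H z)) hol_on S"
  proof (rule hol_onI[OF D])
    fix p c v assume p: "p \<in> S"
    then have "H p \<in> T" using assms(3) by auto
    then show "dir_deriv (dir_deriv (c *s v) H p) F (H p) = c * dir_deriv (dir_deriv v H p) F (H p)"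
      by (simp add: holomorphic_map_on_has_derivative(2)[OF assms(2) p] dir_deriv_smult[OF assms(1)])
  qed
  show "p \<in> S \<Longrightarrow> dir_deriv v (\<lambda>z. F (H z)) p = dir_deriv (dir_deriv v H p) F (H p)"
    using dir_deriv_eqI[OF D] .
qed

lemma holomorphic_map_on_component:
  fixes H :: "complex ^ 'k \<Rightarrow> complex ^ 'm"
  assumes "H holomorphic_map_on S"
  shows "(\<lambda>z. H z $ l) hol_on S"
    and "p \<in> S \<Longrightarrow> dir_deriv v (\<lambda>z. H z $ l) p = dir_deriv v H p $ l"
proof -
  have lin: "dir_deriv w (\<lambda>x::complex ^ 'm. x $ l) q = w $ l" for w q
    by (rule dir_deriv_eqI) (intro bounded_linear_imp_has_derivative bounded_linear_vec_nth)
  have sub: "H ` S \<subseteq> UNIV" by simp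
  show "(\<lambda>z. H z $ l) hol_on S"
    by (rule hol_on_compose_map(1)[OF hol_on_component assms sub])
  show "p \<in> S \<Longrightarrow> dir_deriv v (\<lambda>z. H z $ l) p = dir_deriv v H p $ l"
    using hol_on_compose_map(2)[OF hol_on_component assms sub] lin by metis
qed

lemma vec_eq_sum_axis: "(x :: complex ^ 'k) = (\<Sum>j\<in>UNIV. x $ j *s axis j 1)"
  by (simp add: vec_eq_iff axis_def if_distrib cong: if_cong)

lemma bounded_linear_vec_lambda:
  fixes f :: "'k::finite \<Rightarrow> 'a::real_normed_vector \<Rightarrow> complex"
  assumes "\<And>l. bounded_linear (f l)"
  shows "bounded_linear (\<lambda>v. \<chi> l. f l v)"
proof -
  have "(\<lambda>v. \<chi> l. f l v) = (\<lambda>v. \<Sum>l\<in>UNIV. f l v *s axis l 1)"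
    by (rule ext, rule trans[OF vec_eq_sum_axis]) simp
  moreover have "bounded_linear (\<lambda>v. \<Sum>l\<in>UNIV. f l v *s (axis l 1 :: complex ^ 'k))"
    by (intro bounded_linear_sum bounded_linear_compose[OF bounded_linear_smult_left] assms)
  ultimately show ?thesis by simp
qed

lemma holomorphic_map_onI:
  assumes "\<And>l. (\<lambda>z. H z $ l) hol_on S"
  shows "H holomorphic_map_on S"
  unfolding holomorphic_map_on_def
proof
  fix p assume p: "p \<in> S"
  define D where "D v = (\<Sum>l\<in>UNIV. dir_deriv v (\<lambda>z. H z $ l) p *s axis l 1)" for v
  have "((\<lambda>z. \<Sum>l\<in>UNIV. H z $ l *s axis l 1) has_derivative D) (at p)"
    unfolding D_def
    by (intro has_derivative_sum bounded_linear.has_derivative[OF bounded_linear_smult_left]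
        hol_on_has_derivative[OF assms p])
  moreover have "(\<lambda>z. \<Sum>l\<in>UNIV. H z $ l *s axis l 1) = H"
    by (rule ext) (rule vec_eq_sum_axis[symmetric])
  ultimately have "(H has_derivative D) (at p)" by simp
  moreover have "D (c *s v) = c *s D v" for c v
    by (simp add: D_def dir_deriv_smult[OF assms p] vec.scale_sum_right)
  ultimately show "\<exists>D. (H has_derivative D) (at p) \<and> (\<forall>c v. D (c *s v) = c *s D v)" by blast
qed

lemma holomorphic_map_on_subset: "H holomorphic_map_on S \<Longrightarrow> T \<subseteq> S \<Longrightarrow> H holomorphic_map_on T"
  unfolding holomorphic_map_on_def by blast

section \<open>Iterated derivatives, Cauchy estimates and uniform limits\<close>

lemma hol_on_dir_deriv_funpow:
  assumes "open S" "F hol_on S"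
  shows "(dir_deriv v ^^ n) F hol_on S"
  by (induction n) (auto intro: hol_on_dir_deriv assms)

lemma dir_deriv_funpow_commute:
  assumes "open S" "F hol_on S" "p \<in> S"
  shows "(dir_deriv v ^^ n) (dir_deriv w F) p = dir_deriv w ((dir_deriv v ^^ n) F) p"
  using assms(3)
proof (induction n arbitrary: p)
  case (Suc n)
  have "(dir_deriv v ^^ Suc n) (dir_deriv w F) p = dir_deriv v (dir_deriv w ((dir_deriv v ^^ n) F)) p"
    unfolding funpow.simps comp_def
    by (rule dir_deriv_cong_open[OF assms(1) Suc.prems Suc.IH])
  also have "\<dots> = dir_deriv w ((dir_deriv v ^^ Suc n) F) p"
    by (simp add: dir_deriv_commute[OF assms(1) hol_on_dir_deriv_funpow[OF assms(1,2)] Suc.prems])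
  finally show ?case .
qed auto

lemma open_line_preimage: "open S \<Longrightarrow> open {\<zeta>. z + \<zeta> *s v \<in> S}"
  for S :: "(complex ^ 'k) set"
  by (rule open_vimage[unfolded vimage_def, where f = "\<lambda>\<zeta>. z + \<zeta> *s v"]) (auto intro!: continuous_intros)

text \<open>Carries one-variable results (identity theorem, Leibniz rule for higher derivatives)
  over to iterated directional derivatives.\<close>

lemma higher_deriv_line:
  assumes "open S" "F hol_on S" "z + \<zeta> *s v \<in> S"
  shows "(deriv ^^ n) (\<lambda>\<zeta>. F (z + \<zeta> *s v)) \<zeta> = (dir_deriv v ^^ n) F (z + \<zeta> *s v)"
  using assms(3)
proof (induction n arbitrary: \<zeta>)
  case (Suc n)
  have "\<forall>\<^sub>F w in nhds \<zeta>. z + w *s v \<in> S"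
    using open_line_preimage[OF assms(1), of z v] Suc.prems
    unfolding eventually_nhds by blast
  then have ev: "\<forall>\<^sub>F w in nhds \<zeta>. (deriv ^^ n) (\<lambda>\<zeta>. F (z + \<zeta> *s v)) w = (dir_deriv v ^^ n) F (z + w *s v)"
    by eventually_elim (rule Suc.IH)
  have "(deriv ^^ Suc n) (\<lambda>\<zeta>. F (z + \<zeta> *s v)) \<zeta> = deriv (\<lambda>w. (dir_deriv v ^^ n) F (z + w *s v)) \<zeta>"
    unfolding funpow.simps comp_def by (rule deriv_cong_ev[OF ev refl])
  also have "\<dots> = (dir_deriv v ^^ Suc n) F (z + \<zeta> *s v)"
    using DERIV_imp_deriv[OF hol_on_line[OF hol_on_dir_deriv_funpow[OF assms(1,2)] Suc.prems]] by simp
  finally show ?case .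
qed auto

text \<open>The one-variable Cauchy estimate on the disc of radius e / norm v, which the slice in
  direction v maps into \<open>cball z e\<close>.\<close>

lemma norm_dir_deriv_le:
  assumes F: "F hol_on S" and "e > 0" "cball z e \<subseteq> S" and B: "\<And>y. y \<in> S \<Longrightarrow> norm (F y) \<le> B"
  shows "norm (dir_deriv v F z) \<le> B / e * norm v"
proof (cases "v = 0")
  case True
  have "z \<in> S" using assms by auto
  then show ?thesis using True dir_deriv_0[OF F] by simp
next
  case False
  define d where "d = e / norm v"
  have d: "d > 0" using False assms by (simp add: d_def)
  have sub: "z + \<zeta> *s v \<in> S" if "norm \<zeta> \<le> d" for \<zeta>
    using assms(3) that False
    by (auto simp: subset_iff dist_norm norm_vector_scalar_mult d_def field_simps)
  have hol: "(\<lambda>\<zeta>. F (z + \<zeta> *s v)) holomorphic_on cball 0 d"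
    by (rule hol_on_line_holomorphic[OF F]) (use sub in auto)
  have "norm ((deriv ^^ 1) (\<lambda>\<zeta>. F (z + \<zeta> *s v)) 0) \<le> fact 1 * B / d ^ 1"
    by (rule Cauchy_inequality)
      (use hol d sub B in \<open>auto intro: holomorphic_on_imp_continuous_on holomorphic_on_subset simp: dist_norm\<close>)
  moreover have "(deriv ^^ 1) (\<lambda>\<zeta>. F (z + \<zeta> *s v)) 0 = dir_deriv v F z"
    using DERIV_imp_deriv[OF hol_on_line[OF F, of z 0 v]] sub[of 0] d by simp
  ultimately show ?thesis using assms(2) by (simp add: d_def)
qed

text \<open>The Cauchy estimate applied to the differences of the functions makes their derivatives
  uniformly Cauchy, so the limit is differentiable; complex linearity of the derivative passes to
  the limit.\<close>

lemma hol_on_uniform_limit: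
  fixes F :: "nat \<Rightarrow> complex ^ 'k \<Rightarrow> complex"
  assumes "open S" and F: "\<And>n. F n hol_on S" and lim: "uniform_limit S F g sequentially"
  shows "g hol_on S"
  unfolding hol_on_def
proof
  fix p assume "p \<in> S"
  then obtain e0 where e0: "e0 > 0" "ball p e0 \<subseteq> S" using assms(1) openE by blast
  \<comment> \<open>Halving leaves room for a closed ball of radius e / 2 inside S around every
    point of \<open>ball p e\<close>, where the Cauchy estimate is taken.\<close>
  define e where "e = e0 / 2"
  have e: "e > 0" using e0 by (simp add: e_def)
  have cb: "cball z (e/2) \<subseteq> S" if "z \<in> ball p e" for z
  proof
    fix y assume "y \<in> cball z (e/2)"
    then have "dist p y < e0" using that dist_triangle[of p y z] e0 by (simp add: e_def)
    then show "y \<in> S" using e0 by auto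
  qed
  define f' where "f' = (\<lambda>n z h. dir_deriv h (F n) z)"
  define g' where "g' = (\<lambda>z h. lim (\<lambda>n. f' n z h))"
  have cau: "\<exists>N. \<forall>n\<ge>N. \<forall>m\<ge>N. \<forall>z\<in>ball p e. \<forall>h. norm (f' n z h - f' m z h) \<le> \<epsilon> * norm h" if "\<epsilon> > 0" for \<epsilon>
  proof -
    have "uniformly_Cauchy_on S F"
      using lim uniformly_convergent_Cauchy unfolding uniformly_convergent_on_def by blast
    moreover have "\<epsilon> * (e/2) > 0" using that e by simp
    ultimately obtain N where N: "\<And>n m y. n \<ge> N \<Longrightarrow> m \<ge> N \<Longrightarrow> y \<in> S \<Longrightarrow> dist (F m y) (F n y) < \<epsilon> * (e/2)"
      unfolding uniformly_Cauchy_on_def by meson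
    have "norm (f' n z h - f' m z h) \<le> \<epsilon> * norm h" if nm: "n \<ge> N" "m \<ge> N" and z: "z \<in> ball p e" for n m z h
    proof -
      have zS: "z \<in> S" using cb[OF z] e by auto
      have "norm (dir_deriv h (\<lambda>z. F n z - F m z) z) \<le> (\<epsilon> * (e/2)) / (e/2) * norm h"
        by (rule norm_dir_deriv_le[OF hol_on_diff[OF F F] _ cb[OF z]])
          (use e N[OF nm(2,1)] in \<open>auto simp: dist_norm intro: less_imp_le\<close>)
      then show ?thesis using e by (simp add: f'_def dir_deriv_diff[OF F F zS])
    qed
    then show ?thesis by blast
  qed
  have conv: "(\<lambda>n. f' n z h) \<longlonglongrightarrow> g' z h" if z: "z \<in> ball p e" for z h
  proof -
    have "Cauchy (\<lambda>n. f' n z h)"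
    proof (rule metric_CauchyI)
      fix \<epsilon> :: real assume \<epsilon>: "\<epsilon> > 0"
      have nh: "norm h + 1 > 0" by (smt (verit) norm_ge_zero)
      then obtain N where N: "\<And>n m. n\<ge>N \<Longrightarrow> m\<ge>N \<Longrightarrow> norm (f' n z h - f' m z h) \<le> \<epsilon> / (norm h + 1) * norm h"
        using cau[of "\<epsilon> / (norm h + 1)"] \<epsilon> z by (meson divide_pos_pos)
      have "\<epsilon> / (norm h + 1) * norm h < \<epsilon>" using \<epsilon> nh by (simp add: field_simps)
      then show "\<exists>M. \<forall>m\<ge>M. \<forall>n\<ge>M. dist (f' m z h) (f' n z h) < \<epsilon>"
        using N unfolding dist_norm by (meson le_less_trans)
    qed
    then show ?thesis unfolding g'_def by (simp add: Cauchy_convergent_iff convergent_LIMSEQ_iff)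
  qed
  have "\<exists>g. \<forall>x\<in>ball p e. (\<lambda>n. F n x) \<longlonglongrightarrow> g x \<and> (g has_derivative g' x) (at x within ball p e)"
  proof (rule has_derivative_sequence[where f' = f' and ?x0.0 = p and l = "g p"])
    fix n x assume "x \<in> ball p e"
    then have "x \<in> S" using cb e by (meson centre_in_cball half_gt_zero less_imp_le subsetD)
    then show "(F n has_derivative f' n x) (at x within ball p e)"
      unfolding f'_def using hol_on_has_derivative[OF F] has_derivative_at_withinI by blast
  next
    fix \<epsilon> :: real assume "\<epsilon> > 0"
    then obtain N where N: "\<And>n m z h. n\<ge>N \<Longrightarrow> m\<ge>N \<Longrightarrow> z\<in>ball p e \<Longrightarrow> norm (f' n z h - f' m z h) \<le> \<epsilon> * norm h"
      using cau by metis
    have "norm (f' n z h - g' z h) \<le> \<epsilon> * norm h" if "n \<ge> N" "z \<in> ball p e" for n z h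
      by (rule LIMSEQ_le_const2[OF tendsto_norm[OF tendsto_diff[OF tendsto_const conv[OF that(2)]]]])
        (intro exI[of _ N] allI impI N that)
    then show "\<forall>\<^sub>F n in sequentially. \<forall>x\<in>ball p e. \<forall>h. norm (f' n x h - g' x h) \<le> \<epsilon> * norm h"
      unfolding eventually_sequentially by blast
  qed (use e \<open>p \<in> S\<close> tendsto_uniform_limitI[OF lim] in auto)
  then obtain g2 where g2: "\<And>x. x \<in> ball p e \<Longrightarrow> (\<lambda>n. F n x) \<longlonglongrightarrow> g2 x"
      "\<And>x. x \<in> ball p e \<Longrightarrow> (g2 has_derivative g' x) (at x within ball p e)" by blast
  have eq: "g2 x = g x" if "x \<in> ball p e" for x
  proof -
    have "x \<in> S" using cb[OF that] e by (meson centre_in_cball half_gt_zero less_imp_le subsetD)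
    then show ?thesis using LIMSEQ_unique[OF g2(1)[OF that] tendsto_uniform_limitI[OF lim]] by simp
  qed
  have pe: "p \<in> ball p e" using e by simp
  have "(g2 has_derivative g' p) (at p)"
    using g2(2)[OF pe] at_within_open[OF pe] by simp
  then have "(g has_derivative g' p) (at p)"
    by (rule has_derivative_transform_within_open[OF _ open_ball pe]) (use eq in auto)
  moreover have "g' p (c *s v) = c * g' p v" for c v
  proof -
    have "(\<lambda>n. f' n p (c *s v)) \<longlonglongrightarrow> c * g' p v"
      using tendsto_mult[OF tendsto_const conv[OF pe]] by (simp add: f'_def dir_deriv_smult[OF F \<open>p \<in> S\<close>])
    then show ?thesis using LIMSEQ_unique conv[OF pe] by blast
  qed
  ultimately show "\<exists>D. (g has_derivative D) (at p) \<and> (\<forall>c v. D (c *s v) = c * D v)" by blast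
qed

subsection \<open>Complexification and the Levi form\<close>

text \<open>The variables z and w of a complexification F(z, w) are packed into one vector indexed
  by a disjoint sum, so that \<open>hol_on\<close> and its calculus apply to F unchanged.\<close>

definition join :: "complex ^ 'n \<Rightarrow> complex ^ 'n \<Rightarrow> complex ^ ('n + 'n)" where
  "join z w = (\<chi> i. case i of Inl j \<Rightarrow> z $ j | Inr j \<Rightarrow> w $ j)"

definition cnjv :: "complex ^ 'n \<Rightarrow> complex ^ 'n" where
  "cnjv z = (\<chi> j. cnj (z $ j))"

text \<open>The embedding onto the totally real set w = cnj z of the doubled space, on which a
  real-analytic function is the restriction of a holomorphic one.\<close>

definition dg :: "complex ^ 'n \<Rightarrow> complex ^ ('n + 'n)" where
  "dg z = join z (cnjv z)"

lemma join_nth [simp]: "join z w $ Inl j = z $ j" "join z w $ Inr j = w $ j"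
  by (simp_all add: join_def)

lemma cnjv_nth [simp]: "cnjv z $ j = cnj (z $ j)"
  by (simp add: cnjv_def)

lemma vec_sum_eq_iff: "x = y \<longleftrightarrow> (\<forall>j. x $ Inl j = y $ Inl j) \<and> (\<forall>j. x $ Inr j = y $ Inr j)"
  for x y :: "complex ^ ('n::finite + 'm::finite)"
  by (auto simp: vec_eq_iff) (metis sum.exhaust)

lemma join_add: "join (a + b) (c + d) = join a c + join b d"
  and join_diff: "join (a - b) (c - d) = join a c - join b d"
  and join_smult: "join (x *s a) (x *s b) = x *s join a b"
  and join_0: "join 0 0 = 0"
  by (auto simp: vec_sum_eq_iff)

lemma cnjv_add: "cnjv (a + b) = cnjv a + cnjv b"
  and cnjv_diff: "cnjv (a - b) = cnjv a - cnjv b"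
  and cnjv_smult: "cnjv (x *s a) = cnj x *s cnjv a"
  and cnjv_0: "cnjv 0 = 0"
  and cnjv_cnjv: "cnjv (cnjv a) = a"
  by (auto simp: vec_eq_iff)

lemma dg_add: "dg (a + b) = dg a + dg b"
  and dg_diff: "dg (a - b) = dg a - dg b"
  and dg_of_real_smult: "dg (complex_of_real r *s a) = complex_of_real r *s dg a"
  by (auto simp: dg_def join_add join_diff cnjv_add cnjv_diff join_smult cnjv_smult)

text \<open>The Wirtinger combinations: \<open>dg\<close> is only real linear, and combining its
  values at u and at i u isolates the half linear in u and the half conjugate linear in u. A
  complex-linear map on the doubled space is therefore determined by its values on all
  \<open>dg v\<close>.\<close>

lemma join_left_eq: "join u 0 = (1/2) *s (dg u - \<i> *s dg (\<i> *s u))"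
  and join_right_eq: "join 0 (cnjv u) = (1/2) *s (dg u + \<i> *s dg (\<i> *s u))"
  by (auto simp: vec_sum_eq_iff dg_def vec_eq_iff)

lemma bounded_linear_cnjv: "bounded_linear cnjv"
  unfolding cnjv_def
  by (intro bounded_linear_vec_lambda bounded_linear_compose[OF bounded_linear_cnj bounded_linear_vec_nth])

lemma bounded_linear_dg: "bounded_linear dg"
proof -
  have "bounded_linear (\<lambda>z. case i of Inl j \<Rightarrow> z $ j | Inr j \<Rightarrow> cnjv z $ j)" for i :: "'a + 'a"
    by (cases i) (auto intro!: bounded_linear_compose[OF bounded_linear_cnj bounded_linear_vec_nth] bounded_linear_vec_nth)
  then show ?thesis
    unfolding dg_def join_def by (rule bounded_linear_vec_lambda)
qed

lemma continuous_on_dg [continuous_intros]: "continuous_on A g \<Longrightarrow> continuous_on A (\<lambda>x. dg (g x))"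
  by (rule bounded_linear.continuous_on[OF bounded_linear_dg])

section \<open>Functions with a holomorphic extension to the doubled space\<close>

definition complexifies ::
  "(complex ^ ('n::finite + 'n) \<Rightarrow> complex) \<Rightarrow> (complex ^ ('n + 'n)) set \<Rightarrow> (complex ^ 'n \<Rightarrow> complex) \<Rightarrow> (complex ^ 'n) set \<Rightarrow> bool"
  where "complexifies F T f S \<longleftrightarrow>
    open S \<and> open T \<and> F hol_on T \<and> (\<forall>z\<in>S. dg z \<in> T \<and> f z = F (dg z))"

lemma complexifies_subset:
  "complexifies F T f S \<Longrightarrow> open S' \<Longrightarrow> S' \<subseteq> S \<Longrightarrow> complexifies F T f S'"
  unfolding complexifies_def by blast

lemma complexifiesD:
  assumes "complexifies F T f S"
  shows "open S" "open T" "F hol_on T" "z \<in> S \<Longrightarrow> dg z \<in> T" "z \<in> S \<Longrightarrow> f z = F (dg z)"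
  using assms unfolding complexifies_def by blast+

lemma complexifies_has_derivative:
  assumes "complexifies F T f S" "z \<in> S"
  shows "(f has_derivative (\<lambda>v. dir_deriv (dg v) F (dg z))) (at z)"
proof -
  note C = complexifiesD[OF assms(1)]
  have "((\<lambda>z. F (dg z)) has_derivative (\<lambda>v. dir_deriv (dg v) F (dg z))) (at z)"
    by (rule has_derivative_compose[OF bounded_linear_imp_has_derivative[OF bounded_linear_dg]
          hol_on_has_derivative[OF C(3) C(4)[OF assms(2)]]])
  then show ?thesis
    by (rule has_derivative_transform_within_open[OF _ C(1) assms(2)]) (use C(5) in auto)
qed

lemma complexifies_dir_deriv:
  assumes "complexifies F T f S"
  shows "complexifies (dir_deriv (dg v) F) T (dir_deriv v f) S"
  using complexifiesD[OF assms] dir_deriv_eqI[OF complexifies_has_derivative[OF assms]]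
  unfolding complexifies_def by (auto intro: hol_on_dir_deriv)

text \<open>In the doubled space z and its conjugate are independent, so each Wirtinger operator
  becomes a derivative along a coordinate axis of one half.\<close>

lemma complexifies_dZ:
  assumes "complexifies F T f S"
  shows "complexifies (dir_deriv (join (axis j 1) 0) F) T (dZ j f) S"
    and "complexifies (dir_deriv (join 0 (axis j 1)) F) T (dZbar j f) S"
proof -
  note C = complexifiesD[OF assms]
  have ax: "axis j \<i> = \<i> *s axis j 1" "cnjv (axis j 1) = axis j 1" for j :: 'a
    by (auto simp: vec_eq_iff axis_def)
  have lin: "dir_deriv ((1/2) *s (a + c *s b)) F y = (dir_deriv a F y + c * dir_deriv b F y) / 2" if "y \<in> T" for a b c y
    by (simp add: dir_deriv_smult[OF C(3) that] dir_deriv_add[OF C(3) that])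
  have fd: "frechet_derivative f (at z) = (\<lambda>v. dir_deriv (dg v) F (dg z))" if "z \<in> S" for z
    using frechet_derivative_at[OF complexifies_has_derivative[OF assms that]] by simp
  have "dZ j f z = dir_deriv (join (axis j 1) 0) F (dg z)" if "z \<in> S" for z
    unfolding join_left_eq dZ_def fd[OF that] ax
    using lin[OF C(4)[OF that], of "dg (axis j 1)" "-\<i>" "dg (\<i> *s axis j 1)"] by (simp add: vec.scale_minus_left)
  then show "complexifies (dir_deriv (join (axis j 1) 0) F) T (dZ j f) S"
    using C unfolding complexifies_def by (auto intro: hol_on_dir_deriv)
  have "dZbar j f z = dir_deriv (join 0 (axis j 1)) F (dg z)" if "z \<in> S" for z
    using lin[OF C(4)[OF that], of "dg (axis j 1)" "\<i>" "dg (\<i> *s axis j 1)"]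
    using join_right_eq[of "axis j 1"]
    unfolding dZbar_def fd[OF that] ax by simp
  then show "complexifies (dir_deriv (join 0 (axis j 1)) F) T (dZbar j f) S"
    using C unfolding complexifies_def by (auto intro: hol_on_dir_deriv)
qed

lemma join_sum_axis: "join u 0 = (\<Sum>j\<in>UNIV. u $ j *s join (axis j 1) 0)"
    "join 0 u = (\<Sum>j\<in>UNIV. u $ j *s join 0 (axis j 1))"
  by (auto simp: vec_sum_eq_iff axis_def if_distrib cong: if_cong)

abbreviation (input) cx :: "('a \<Rightarrow> real) \<Rightarrow> 'a \<Rightarrow> complex" where
  "cx \<rho> \<equiv> (\<lambda>z. complex_of_real (\<rho> z))"

lemma dir_deriv_2_sum:
  assumes "open T" "F hol_on T" "y \<in> T"
  shows "dir_deriv (\<Sum>k\<in>B. b k *s w k) (dir_deriv (\<Sum>j\<in>A. a j *s v j) F) y =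
    (\<Sum>j\<in>A. \<Sum>k\<in>B. a j * b k * dir_deriv (w k) (dir_deriv (v j) F) y)"
proof -
  note h = hol_on_dir_deriv[OF assms(1,2)]
  have "dir_deriv (\<Sum>k\<in>B. b k *s w k) (dir_deriv (\<Sum>j\<in>A. a j *s v j) F) y =
    dir_deriv (\<Sum>j\<in>A. a j *s v j) (dir_deriv (\<Sum>k\<in>B. b k *s w k) F) y"
    by (rule dir_deriv_commute[OF assms])
  also have "\<dots> = (\<Sum>j\<in>A. a j * dir_deriv (v j) (dir_deriv (\<Sum>k\<in>B. b k *s w k) F) y)"
    by (simp add: dir_deriv_sum[OF h assms(3)] dir_deriv_smult[OF h assms(3)])
  also have "\<dots> = (\<Sum>j\<in>A. a j * dir_deriv (\<Sum>k\<in>B. b k *s w k) (dir_deriv (v j) F) y)"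
    using dir_deriv_commute[OF assms] by metis
  also have "\<dots> = (\<Sum>j\<in>A. a j * (\<Sum>k\<in>B. b k * dir_deriv (w k) (dir_deriv (v j) F) y))"
    by (simp add: dir_deriv_sum[OF h assms(3)] dir_deriv_smult[OF h assms(3)])
  finally show ?thesis by (simp add: sum_distrib_left mult.assoc)
qed

text \<open>Sesquilinearity of the Levi form becomes bilinearity of a second derivative of F, the
  conjugation being absorbed in the direction \<open>cnjv v\<close>.\<close>

lemma levi_form_complexified:
  assumes "complexifies F T (cx \<rho>) S" "p \<in> S"
  shows "levi_form \<rho> p u v = dir_deriv (join 0 (cnjv v)) (dir_deriv (join u 0) F) (dg p)"
proof -
  note C = complexifiesD[OF assms(1)]
  have "dZbar k (dZ j (cx \<rho>)) p = dir_deriv (join 0 (axis k 1)) (dir_deriv (join (axis j 1) 0) F) (dg p)" for j k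
    by (rule complexifiesD(5)[OF complexifies_dZ(2)[OF complexifies_dZ(1)[OF assms(1)]] assms(2)])
  then show ?thesis
    unfolding levi_form_def join_sum_axis(1)[of u] join_sum_axis(2)[of "cnjv v"] dir_deriv_2_sum[OF C(2,3) C(4)[OF assms(2)]]
    by (simp add: mult_ac)
qed

lemma holomorphic_tangent_space_complexified:
  assumes "complexifies F T (cx \<rho>) S" "p \<in> S"
  shows "u \<in> holomorphic_tangent_space \<rho> p \<longleftrightarrow> dir_deriv (join u 0) F (dg p) = 0"
proof -
  note C = complexifiesD[OF assms(1)]
  have "dZ j (cx \<rho>) p = dir_deriv (join (axis j 1) 0) F (dg p)" for j
    by (rule complexifiesD(5)[OF complexifies_dZ(1)[OF assms(1)] assms(2)])
  then show ?thesis
    unfolding holomorphic_tangent_space_def join_sum_axis(1)[of u]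
    by (simp add: dir_deriv_sum[OF C(3) C(4)[OF assms(2)]] dir_deriv_smult[OF C(3) C(4)[OF assms(2)]] mult_ac)
qed

text \<open>f equals its conjugate on S, so by uniqueness of derivatives its real directional
  derivatives equal their conjugates.\<close>

lemma real_dir_deriv_dg:
  assumes "complexifies F T f S" "\<And>z. z \<in> S \<Longrightarrow> f z \<in> \<real>" "z \<in> S"
  shows "dir_deriv (dg v) F (dg z) \<in> \<real>"
proof -
  note C = complexifiesD[OF assms(1)]
  have "(f has_derivative (\<lambda>v. dir_deriv (dg v) F (dg z))) (at z)"
    by (rule complexifies_has_derivative[OF assms(1,3)])
  then have "((\<lambda>z. cnj (f z)) has_derivative (\<lambda>v. cnj (dir_deriv (dg v) F (dg z)))) (at z)"
    by (rule bounded_linear.has_derivative[OF bounded_linear_cnj])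
  then have "(f has_derivative (\<lambda>v. cnj (dir_deriv (dg v) F (dg z)))) (at z)"
    by (rule has_derivative_transform_within_open[OF _ C(1) assms(3)])
      (use assms(2) Reals_cnj_iff in auto)
  from dir_deriv_eqI[OF this, of v] dir_deriv_eqI[OF complexifies_has_derivative[OF assms(1,3)], of v]
  show ?thesis by (simp add: Reals_cnj_iff)
qed

text \<open>Second derivatives in real directions \<open>dg a\<close>, \<open>dg b\<close> are real
  and symmetric. When the mixed derivative is expanded in these directions, conjugation changes the
  sign of i in the Wirtinger coefficients, which amounts to exchanging u and v.\<close>

lemma levi_form_hermitian:
  assumes "complexifies F T (cx \<rho>) S" "p \<in> S"
  shows "levi_form \<rho> p u v = cnj (levi_form \<rho> p v u)"
proof -
  note C = complexifiesD[OF assms(1)]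
  note y = C(4)[OF assms(2)]
  have "dir_deriv a F (dg z) \<in> \<real>" if "a = dg w" "z \<in> S" for a w z
    using real_dir_deriv_dg[OF assms(1)] that by auto
  then have re: "dir_deriv (dg a) (dir_deriv (dg b) F) (dg p) \<in> \<real>" for a b
    using real_dir_deriv_dg[OF complexifies_dir_deriv[OF assms(1)] _ assms(2)]
      complexifiesD(5)[OF complexifies_dir_deriv[OF assms(1)]] by metis
  define B where "B a b = dir_deriv a (dir_deriv b F) (dg p)" for a b
  note h = hol_on_dir_deriv[OF C(2,3)]
  have com: "B a b = B b a" for a b
    unfolding B_def by (rule dir_deriv_commute[OF C(2,3) y])
  have lin: "B (a + b) c = B a c + B b c" "B (x *s a) c = x * B a c" for a b c x
    unfolding B_def by (simp_all add: dir_deriv_add[OF h y] dir_deriv_smult[OF h y])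
  have lin': "B c (a + b) = B c a + B c b" "B c (x *s a) = x * B c a" for a b c x
    using lin com by metis+
  have exp: "B ((1/2) *s (a1 + x *s a2)) ((1/2) *s (b1 + z *s b2)) =
     1/4 * (B a1 b1 + z * B a1 b2 + x * B a2 b1 + x * z * B a2 b2)" for a1 a2 b1 b2 x z
    by (simp add: lin lin' algebra_simps)
  have cB: "cnj (B (dg a) (dg b)) = B (dg a) (dg b)" for a b
    using re unfolding B_def by (simp add: Reals_cnj_iff)
  have L: "levi_form \<rho> p u v = B (join 0 (cnjv v)) (join u 0)" for u v
    unfolding B_def by (rule levi_form_complexified[OF assms])
  have jl: "join u 0 = (1/2) *s (dg u + (-\<i>) *s dg (\<i> *s u))" for u :: "complex ^ 'a"
    unfolding join_left_eq by (simp add: vec.scale_minus_left)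
  show ?thesis
    unfolding L jl join_right_eq exp
    by (simp add: cB com[of "dg u"] com[of "dg (\<i> *s u)"])
qed

subsection \<open>Complexification of real-analytic functions\<close>

text \<open>The complex-linear extension of the real coordinate z \<mapsto> z \<bullet> b from the
  totally real set to the doubled space; these functions are the variables of the extended power
  series.\<close>

definition cinner :: "complex ^ 'n \<Rightarrow> complex ^ ('n + 'n) \<Rightarrow> complex" where
  "cinner b y = (\<Sum>j\<in>UNIV. y $ Inl j * cnj (b $ j) + y $ Inr j * b $ j) / 2"

lemma cinner_dg: "cinner b (dg z) = complex_of_real (z \<bullet> b)"
proof -
  have "(x * cnj y + cnj x * y) / 2 = complex_of_real (x \<bullet> y)" for x y :: complex
    by (simp add: complex_eq_iff inner_complex_def)
  then show ?thesis
    by (simp add: cinner_def dg_def inner_vec_def sum_divide_distrib)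
qed

lemma bounded_linear_cinner: "bounded_linear (cinner b)"
  unfolding cinner_def
  by (intro bounded_linear_compose[OF bounded_linear_divide] bounded_linear_sum bounded_linear_add
      bounded_linear_compose[OF bounded_linear_mult_left] bounded_linear_vec_nth)

lemma cinner_smult: "cinner b (c *s y) = c * cinner b y"
  by (simp add: cinner_def sum_distrib_left algebra_simps)

text \<open>The Weierstrass test yields a limit along the finite subsets of the index set, while
  \<open>hol_on_uniform_limit\<close> speaks of sequences. A sequence of finite subsets
  \<open>X n\<close> with error below 1 / Suc n bridges the two.\<close>

lemma hol_on_infsum:
  fixes T :: "'i \<Rightarrow> complex ^ 'k \<Rightarrow> complex"
  assumes "open S" "\<And>a. a \<in> I \<Longrightarrow> T a hol_on S"
    and "\<And>a y. a \<in> I \<Longrightarrow> y \<in> S \<Longrightarrow> norm (T a y) \<le> M a" "M summable_on I"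
  shows "(\<lambda>y. \<Sum>\<^sub>\<infinity>a\<in>I. T a y) hol_on S"
proof -
  define g where "g = (\<lambda>y. \<Sum>\<^sub>\<infinity>a\<in>I. T a y)"
  have lim: "uniform_limit S (\<lambda>X y. \<Sum>a\<in>X. T a y) g (finite_subsets_at_top I)"
    unfolding g_def using assms(3,4) by (rule Weierstrass_m_test_general)
  have "\<exists>X. finite X \<and> X \<subseteq> I \<and> (\<forall>y\<in>S. dist (\<Sum>a\<in>X. T a y) (g y) < 1 / Suc n)" for n
  proof -
    have "\<forall>\<^sub>F X in finite_subsets_at_top I. \<forall>y\<in>S. dist (\<Sum>a\<in>X. T a y) (g y) < 1 / Suc n"
      using lim by (rule uniform_limitD) simp
    then obtain X where "finite X" "X \<subseteq> I"
        "\<forall>Y. finite Y \<and> X \<subseteq> Y \<and> Y \<subseteq> I \<longrightarrow> (\<forall>y\<in>S. dist (\<Sum>a\<in>Y. T a y) (g y) < 1 / Suc n)"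
      unfolding eventually_finite_subsets_at_top by (elim exE conjE)
    then show ?thesis by (intro exI[of _ X]) simp
  qed
  then have "\<forall>n. \<exists>X. finite X \<and> X \<subseteq> I \<and> (\<forall>y\<in>S. dist (\<Sum>a\<in>X. T a y) (g y) < 1 / Suc n)"
    by blast
  from choice[OF this] obtain X where X: "\<And>n. finite (X n)" "\<And>n. X n \<subseteq> I"
      "\<And>n y. y \<in> S \<Longrightarrow> dist (\<Sum>a\<in>X n. T a y) (g y) < 1 / Suc n"
    by blast
  have "uniform_limit S (\<lambda>n y. \<Sum>a\<in>X n. T a y) g sequentially"
  proof (rule uniform_limitI)
    fix \<epsilon> :: real assume "\<epsilon> > 0"
    then obtain N where N: "1 / Suc N < \<epsilon>" using nat_approx_posE by blast
    have "dist (\<Sum>a\<in>X n. T a y) (g y) < \<epsilon>" if "n \<ge> N" "y \<in> S" for n y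
    proof -
      have "1 / real (Suc n) \<le> 1 / real (Suc N)" using that by (simp add: frac_le)
      then show ?thesis using X(3)[OF that(2), of n] N by linarith
    qed
    then show "\<forall>\<^sub>F n in sequentially. \<forall>y\<in>S. dist (\<Sum>a\<in>X n. T a y) (g y) < \<epsilon>"
      unfolding eventually_sequentially by blast
  qed
  then have "g hol_on S"
    by (rule hol_on_uniform_limit[OF assms(1), rotated]) (intro hol_on_sum assms(2) subsetD[OF X(2)])
  then show ?thesis unfolding g_def .
qed

text \<open>Replacing each real coordinate in the power series by \<open>cinner b\<close> extends it
  to the doubled space. One majorant suffices: absolute convergence at a single point whose
  coordinates relative to p all equal t bounds the terms wherever the new variables have modulus at
  most t.\<close>

lemma real_analytic_complexification:
  fixes \<rho> :: "complex ^ 'n \<Rightarrow> real"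
  assumes "\<rho> real_analytic_on S" "p \<in> S"
  obtains R e s where "e > 0" "s > 0" "complexifies R (ball (dg p) e) (cx \<rho>) (ball p s)"
proof -
  obtain r c where r: "r > 0" and c: "\<And>x. x \<in> ball p r \<Longrightarrow>
      ((\<lambda>\<alpha>. c \<alpha> * (\<Prod>b\<in>Basis. ((x - p) \<bullet> b) ^ \<alpha> b)) has_sum \<rho> x) (Basis \<rightarrow>\<^sub>E UNIV)"
    using bspec[OF assms(1)[unfolded real_analytic_on_def] assms(2)] by (elim exE conjE) blast
  \<comment> \<open>The vector all of whose real coordinates are 1; t below is small enough to keep
    the point p + t w in the ball of convergence.\<close>
  define w where "w = (\<Sum>b\<in>Basis. b :: complex ^ 'n)"
  define t where "t = r / (2 * (norm w + 1))"
  have nw: "norm w + 1 > 0" by (smt (verit) norm_ge_zero)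
  have t: "t > 0" using r nw by (simp add: t_def)
  have "t * norm w \<le> t * (norm w + 1)" using t by simp
  also have "\<dots> = r / 2" using nw by (simp add: t_def field_simps)
  finally have x0: "p + t *\<^sub>R w \<in> ball p r" using t r by (simp add: dist_norm)
  have wb: "w \<bullet> b = 1" if "b \<in> Basis" for b
    unfolding w_def using that by (simp add: inner_sum_left_Basis)
  define I where "I = ((Basis :: (complex ^ 'n) set) \<rightarrow>\<^sub>E (UNIV :: nat set))"
  define M where "M \<alpha> = \<bar>c \<alpha>\<bar> * (\<Prod>b\<in>(Basis :: (complex ^ 'n) set). t ^ \<alpha> b)" for \<alpha>
  have "(\<lambda>\<alpha>. c \<alpha> * (\<Prod>b\<in>(Basis :: (complex ^ 'n) set). ((p + t *\<^sub>R w - p) \<bullet> b) ^ \<alpha> b)) summable_on I"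
    unfolding I_def by (rule has_sum_imp_summable[OF c[OF x0]])
  then have "(\<lambda>\<alpha>. norm (c \<alpha> * (\<Prod>b\<in>(Basis :: (complex ^ 'n) set). ((p + t *\<^sub>R w - p) \<bullet> b) ^ \<alpha> b))) summable_on I"
    by (rule summable_on_iff_abs_summable_on_real[THEN iffD1])
  moreover have "norm (c \<alpha> * (\<Prod>b\<in>(Basis :: (complex ^ 'n) set). ((p + t *\<^sub>R w - p) \<bullet> b) ^ \<alpha> b)) = M \<alpha>" for \<alpha>
    using t by (simp add: M_def abs_mult wb abs_prod power_abs)
  ultimately have sumM: "M summable_on I" by simp
  have "\<forall>b. \<exists>K>0. \<forall>y. norm (cinner (b :: complex ^ 'n) y) \<le> norm y * K"
    using bounded_linear.pos_bounded[OF bounded_linear_cinner] by blast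
  from choice[OF this] obtain K where K: "\<And>b. K b > 0" "\<And>b y. norm (cinner (b :: complex ^ 'n) y) \<le> norm y * K b"
    by blast
  \<comment> \<open>Each bound \<open>K b\<close> is at most the sum of all of them, so within this
    radius every variable \<open>cinner b (y - dg p)\<close> has modulus at most t.\<close>
  define e where "e = t / (\<Sum>b\<in>(Basis :: (complex ^ 'n) set). K b)"
  have sK: "(\<Sum>b\<in>(Basis :: (complex ^ 'n) set). K b) > 0"
    by (rule sum_pos) (use K in auto)
  have e: "e > 0" using t sK by (simp add: e_def)
  have cle: "norm (cinner b (y - dg p)) \<le> t" if "y \<in> ball (dg p) e" "b \<in> Basis" for b :: "complex ^ 'n" and y
  proof -
    have "norm (cinner b (y - dg p)) \<le> norm (y - dg p) * K b" by (rule K)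
    also have "\<dots> \<le> e * (\<Sum>b\<in>(Basis :: (complex ^ 'n) set). K b)"
    proof (rule mult_mono)
      show "K b \<le> (\<Sum>b\<in>(Basis :: (complex ^ 'n) set). K b)"
        by (rule member_le_sum) (use K(1) that in \<open>auto intro: less_imp_le\<close>)
    qed (use that e K(1)[of b] in \<open>auto simp: dist_norm norm_minus_commute\<close>)
    also have "\<dots> = t" using sK by (simp add: e_def)
    finally show ?thesis .
  qed
  define T where "T \<alpha> y = complex_of_real (c \<alpha>) * (\<Prod>b\<in>Basis. cinner b (y - dg p) ^ \<alpha> b)" for \<alpha> and y :: "complex ^ ('n + 'n)"
  define R where "R y = (\<Sum>\<^sub>\<infinity>\<alpha>\<in>I. T \<alpha> y)" for y
  have "R hol_on ball (dg p) e"
    unfolding R_def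
  proof (rule hol_on_infsum[OF _ _ _ sumM])
    fix \<alpha> :: "complex ^ 'n \<Rightarrow> nat"
    have "(\<lambda>y. cinner b (y - dg p)) hol_on ball (dg p) e" for b
    proof -
      have "(\<lambda>y. cinner b (y - dg p)) = (\<lambda>y. cinner b y - cinner b (dg p))"
        using linear_diff[OF bounded_linear.linear[OF bounded_linear_cinner]] by blast
      then show ?thesis
        using hol_on_diff[OF hol_on_linear[OF bounded_linear_cinner cinner_smult] hol_on_const] by simp
    qed
    then show "T \<alpha> hol_on ball (dg p) e"
      unfolding T_def by (intro hol_on_mult hol_on_const hol_on_prod hol_on_power)
  next
    fix \<alpha> :: "complex ^ 'n \<Rightarrow> nat" and y assume y: "y \<in> ball (dg p) e"
    have "(\<Prod>b\<in>(Basis :: (complex ^ 'n) set). norm (cinner b (y - dg p)) ^ \<alpha> b) \<le> (\<Prod>b\<in>(Basis :: (complex ^ 'n) set). t ^ \<alpha> b)"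
      by (rule prod_mono) (use cle[OF y] in \<open>auto intro: power_mono\<close>)
    then show "norm (T \<alpha> y) \<le> M \<alpha>"
      by (auto simp: T_def M_def norm_mult prod_norm[symmetric] norm_power intro: mult_left_mono)
  qed auto
  moreover obtain s where s: "s > 0" "s \<le> r" "\<And>z. z \<in> ball p s \<Longrightarrow> dg z \<in> ball (dg p) e"
  proof -
    have "isCont dg p" by (intro linear_continuous_at bounded_linear_dg)
    then obtain d where "d > 0" "\<And>z. dist z p < d \<Longrightarrow> dist (dg z) (dg p) < e"
      using e unfolding continuous_at_eps_delta by blast
    then show ?thesis using r by (intro that[of "min d r"]) (auto simp: dist_commute)
  qed
  moreover have "cx \<rho> z = R (dg z)" if z: "z \<in> ball p s" for z
  proof -
    have "z \<in> ball p r" using z s by auto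
    from has_sum_of_real[OF c[OF this], where ?'a = complex]
    have "((\<lambda>\<alpha>. T \<alpha> (dg z)) has_sum complex_of_real (\<rho> z)) I"
      by (simp add: T_def I_def cinner_dg flip: dg_diff)
    then show ?thesis unfolding R_def by (simp add: infsumI)
  qed
  ultimately have "complexifies R (ball (dg p) e) (cx \<rho>) (ball p s)"
    unfolding complexifies_def by auto
  then show ?thesis using that e s by blast
qed

subsection \<open>Hypersurface charts\<close>

text \<open>Stands in for the implicit function theorem. A tangent step t w is corrected by a
  multiple s u of a transversal vector to a zero of \<rho>, found by the intermediate value theorem.
  There g vanishes, so the first-order expansion of g bounds g' w by a constant times an arbitrarily
  small \<eta>.\<close>

lemma tangential_derivative_eq_0:
  fixes \<rho> :: "'a::real_normed_vector \<Rightarrow> real" and g :: "'a \<Rightarrow> 'b::real_normed_vector"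
  assumes \<rho>: "(\<rho> has_derivative r) (at q)" and g: "(g has_derivative g') (at q)"
    and N: "open N" "q \<in> N" "continuous_on N \<rho>" and "\<rho> q = 0"
    and van: "\<And>z. z \<in> N \<Longrightarrow> \<rho> z = 0 \<Longrightarrow> g z = 0"
    and "r v \<noteq> 0" "r w = 0"
  shows "g' w = 0"
proof -
  interpret r: bounded_linear r using \<rho> by (rule has_derivative_bounded_linear)
  interpret g: bounded_linear g' using g by (rule has_derivative_bounded_linear)
  define u where "u = v /\<^sub>R r v"
  have ru: "r u = 1" using assms(8) by (simp add: u_def r.scaleR)
  define L where "L = norm w + norm u"
  have "u \<noteq> 0" using ru r.zero by auto
  then have L: "L > 0" by (simp add: L_def add_nonneg_pos)
  have bound: "norm (g' w) \<le> \<eta> * (L * (1 + 2 * norm (g' u)))" if \<eta>: "\<eta> > 0" "2 * \<eta> * L \<le> 1" for \<eta>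
  proof -
    obtain d1 where d1: "d1 > 0" "\<And>y. norm (y - q) < d1 \<Longrightarrow> norm (\<rho> y - \<rho> q - r (y - q)) \<le> \<eta> * norm (y - q)"
      using \<rho> \<eta>(1) unfolding has_derivative_at_alt by meson
    obtain d2 where d2: "d2 > 0" "\<And>y. norm (y - q) < d2 \<Longrightarrow> norm (g y - g q - g' (y - q)) \<le> \<eta> * norm (y - q)"
      using g \<eta>(1) unfolding has_derivative_at_alt by meson
    obtain d3 where d3: "d3 > 0" "ball q d3 \<subseteq> N" using N openE by blast
    define t where "t = min d1 (min d2 d3) / (2 * L)"
    have t: "t > 0" using d1 d2 d3 L by (simp add: t_def)
    have tL: "t * L < d1" "t * L < d2" "t * L < d3" using d1(1) d2(1) d3(1) L by (auto simp: t_def)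
    \<comment> \<open>t \<epsilon> is twice the error \<eta> (t L) in linearising \<rho>, so the
      signs of \<rho> at s = - t \<epsilon> and s = t \<epsilon> are decided. The condition 2 \<eta>
      L \<le> 1 keeps the correction s below t in modulus, which bounds h s by t L.\<close>
    define \<epsilon> where "\<epsilon> = 2 * \<eta> * L"
    have \<epsilon>: "\<epsilon> > 0" "\<epsilon> \<le> 1" using \<eta> L by (simp_all add: \<epsilon>_def)
    define h where "h s = t *\<^sub>R w + s *\<^sub>R u" for s
    have nh: "norm (h s) \<le> t * L" if "\<bar>s\<bar> \<le> t * \<epsilon>" for s
    proof -
      have "\<bar>s\<bar> \<le> t * 1" using that \<epsilon> t by (meson mult_left_mono less_imp_le order_trans)
      then have "norm (h s) \<le> t * norm w + t * norm u"
        unfolding h_def using t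
        by (intro order_trans[OF norm_triangle_ineq] add_mono) (auto intro: mult_right_mono)
      then show ?thesis by (simp add: L_def distrib_left)
    qed
    have rh: "r (h s) = s" for s using assms(9) ru by (simp add: h_def r.add r.scaleR)
    have near: "\<bar>\<rho> (q + h s) - s\<bar> \<le> \<eta> * (t * L)" if "\<bar>s\<bar> \<le> t * \<epsilon>" for s
    proof -
      have "norm (\<rho> (q + h s) - s) \<le> \<eta> * norm (h s)"
        using d1(2)[of "q + h s"] nh[OF that] tL assms(6) rh by simp
      also have "\<dots> \<le> \<eta> * (t * L)" using nh[OF that] \<eta> by simp
      finally show ?thesis by simp
    qed
    have te: "t * \<epsilon> = 2 * (\<eta> * (t * L))" by (simp add: \<epsilon>_def)
    have pos: "\<eta> * (t * L) > 0" using \<eta> t L by simp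
    have "\<exists>s\<ge>-(t*\<epsilon>). s \<le> t * \<epsilon> \<and> \<rho> (q + h s) = 0"
    proof (rule IVT')
      show "\<rho> (q + h (- (t * \<epsilon>))) \<le> 0" "0 \<le> \<rho> (q + h (t * \<epsilon>))"
        using near[of "- (t * \<epsilon>)"] near[of "t * \<epsilon>"] te pos by linarith+
      show "- (t * \<epsilon>) \<le> t * \<epsilon>" using t \<epsilon> by simp
      have "q + h s \<in> N" if "s \<in> {- (t * \<epsilon>)..t * \<epsilon>}" for s
        using nh[of s] that tL(3) d3(2) by (auto simp: subset_iff dist_norm abs_le_iff)
      then show "continuous_on {- (t * \<epsilon>)..t * \<epsilon>} (\<lambda>s. \<rho> (q + h s))"
        by (intro continuous_on_compose2[OF N(3)]) (auto simp: h_def intro!: continuous_intros)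
    qed
    then obtain s where s: "\<bar>s\<bar> \<le> t * \<epsilon>" "\<rho> (q + h s) = 0" by (metis abs_le_iff minus_le_iff)
    have "q + h s \<in> N" using nh[OF s(1)] tL(3) d3(2) by (auto simp: subset_iff dist_norm)
    then have "g (q + h s) = 0" "g q = 0" using van s(2) N(2) assms(6) by auto
    then have "norm (g' (h s)) \<le> \<eta> * norm (h s)"
      using d2(2)[of "q + h s"] nh[OF s(1)] tL by simp
    also have "\<dots> \<le> \<eta> * (t * L)" using nh[OF s(1)] \<eta> by simp
    finally have 1: "norm (g' (h s)) \<le> \<eta> * (t * L)" .
    have "t *\<^sub>R g' w = g' (h s) - s *\<^sub>R g' u" by (simp add: h_def g.add g.scaleR)
    then have "norm (t *\<^sub>R g' w) \<le> norm (g' (h s)) + \<bar>s\<bar> * norm (g' u)"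
      by (metis norm_triangle_ineq4 norm_scaleR)
    also have "\<dots> \<le> \<eta> * (t * L) + t * \<epsilon> * norm (g' u)"
      using 1 s(1) by (intro add_mono mult_right_mono) auto
    also have "\<dots> = t * (\<eta> * (L * (1 + 2 * norm (g' u))))" by (simp add: \<epsilon>_def algebra_simps)
    finally show ?thesis using t by simp
  qed
  have "norm (g' w) \<le> 0"
  proof (rule field_le_epsilon)
    fix e :: real assume e: "e > 0"
    define K where "K = L * (1 + 2 * norm (g' u))"
    have K: "K > 0" using L by (simp add: K_def add_pos_nonneg)
    define \<eta> where "\<eta> = min (e / K) (1 / (2 * L))"
    have \<eta>: "\<eta> > 0" using e K L by (simp add: \<eta>_def)
    have "\<eta> * (2 * L) \<le> (1 / (2 * L)) * (2 * L)" using L by (intro mult_right_mono) (auto simp: \<eta>_def)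
    then have "2 * \<eta> * L \<le> 1" using L by (simp add: mult_ac)
    from bound[OF \<eta> this] have "norm (g' w) \<le> \<eta> * K" by (simp add: K_def)
    also have "\<dots> \<le> (e / K) * K" using K by (intro mult_right_mono) (auto simp: \<eta>_def)
    finally show "norm (g' w) \<le> 0 + e" using K by simp
  qed
  then show ?thesis by simp
qed

text \<open>The sign change of \<rho> along v at q persists on the parallel lines through nearby y,
  and the intermediate value theorem gives a zero on each. So translates of the zero set along v
  fill a neighbourhood of q, which is how vanishing on M is spread to open sets.\<close>

lemma eventually_translate_to_zero_set:
  fixes \<rho> :: "'a::real_normed_vector \<Rightarrow> real"
  assumes \<rho>: "(\<rho> has_derivative r) (at q)" and N: "open N" "q \<in> N" "continuous_on N \<rho>"
    and "\<rho> q = 0" "r v \<noteq> 0" "\<delta> > 0"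
  shows "\<forall>\<^sub>F y in nhds q. \<exists>t. \<bar>t\<bar> < \<delta> \<and> y - t *\<^sub>R v \<in> N \<and> \<rho> (y - t *\<^sub>R v) = 0"
proof -
  have pos: "\<forall>\<^sub>F y in nhds q. \<exists>t. \<bar>t\<bar> < \<delta> \<and> y + t *\<^sub>R u \<in> N \<and> \<rho> (y + t *\<^sub>R u) = 0" if up: "r u > 0" for u
  proof -
    obtain e where e: "e > 0" "ball q e \<subseteq> N" using N openE by blast
    have "((\<lambda>t. \<rho> (q + t *\<^sub>R u)) has_derivative (\<lambda>t. r (t *\<^sub>R u))) (at 0)"
      by (rule has_derivative_compose[where f = "\<lambda>t. q + t *\<^sub>R u" and g = \<rho>])
        (auto intro!: derivative_eq_intros \<rho>)
    moreover have "(\<lambda>t. r (t *\<^sub>R u)) = (*) (r u)"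
      using linear_cmul[OF has_derivative_linear[OF \<rho>]] by (auto simp: mult.commute)
    ultimately have D: "((\<lambda>t. \<rho> (q + t *\<^sub>R u)) has_real_derivative r u) (at 0)"
      by (simp add: has_field_derivative_def)
    obtain d1 where d1: "d1 > 0" "\<And>h. 0 < h \<Longrightarrow> h < d1 \<Longrightarrow> \<rho> (q + h *\<^sub>R u) > 0"
      using DERIV_pos_inc_right[OF D up] assms(5) by auto
    obtain d2 where d2: "d2 > 0" "\<And>h. 0 < h \<Longrightarrow> h < d2 \<Longrightarrow> \<rho> (q + (-h) *\<^sub>R u) < 0"
      using DERIV_pos_inc_left[OF D up] assms(5) by auto
    have nu: "norm u + 1 > 0" by (smt (verit) norm_ge_zero)
    define m where "m = min (min d1 d2) (min \<delta> (e / (norm u + 1)))"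
    define t where "t = m / 2"
    have m: "m > 0" "m \<le> d1" "m \<le> d2" "m \<le> \<delta>" "m \<le> e / (norm u + 1)"
      using d1 d2 assms(7) e nu by (auto simp: m_def)
    then have t: "t > 0" "t < d1" "t < d2" "t < \<delta>" unfolding t_def by linarith+
    have "t * norm u \<le> t * (norm u + 1)" using t by simp
    also have "\<dots> \<le> e / (norm u + 1) / 2 * (norm u + 1)"
      unfolding t_def by (intro mult_right_mono divide_right_mono m) (use nu in auto)
    also have "\<dots> = e / 2" using nu by (simp add: field_simps)
    finally have tu: "t * norm u \<le> e / 2" .
    have inN: "y + s *\<^sub>R u \<in> N" if "y \<in> ball q (e/2)" "\<bar>s\<bar> \<le> t" for y s
    proof -
      have "norm (s *\<^sub>R u) \<le> t * norm u" using that by (auto intro: mult_right_mono)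
      then have "norm (s *\<^sub>R u) \<le> e / 2" using tu by linarith
      then have "dist q (y + s *\<^sub>R u) < e"
        using that dist_triangle[of q "y + s *\<^sub>R u" y] by (simp add: dist_norm)
      then show ?thesis using e by auto
    qed
    have cont: "((\<lambda>y. \<rho> (y + s *\<^sub>R u)) \<longlongrightarrow> \<rho> (q + s *\<^sub>R u)) (nhds q)" if "\<bar>s\<bar> \<le> t" for s
    proof -
      have "continuous_on (ball q (e/2)) (\<lambda>y. \<rho> (y + s *\<^sub>R u))"
        by (rule continuous_on_compose2[OF N(3)]) (auto intro!: continuous_intros inN that)
      then have "isCont (\<lambda>y. \<rho> (y + s *\<^sub>R u)) q" using e by (auto simp: continuous_on_eq_continuous_at)
      then show ?thesis
        unfolding isCont_def using tendsto_at_iff_tendsto_nhds[of "\<lambda>y. \<rho> (y + s *\<^sub>R u)" q] by simp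
    qed
    have "\<forall>\<^sub>F y in nhds q. \<rho> (y + t *\<^sub>R u) > 0"
      using order_tendstoD(1)[OF cont d1(2)] t by simp
    moreover have "\<forall>\<^sub>F y in nhds q. \<rho> (y + (-t) *\<^sub>R u) < 0"
      using order_tendstoD(2)[OF cont d2(2)] t by simp
    moreover have "\<forall>\<^sub>F y in nhds q. y \<in> ball q (e/2)"
      using e by (intro eventually_nhds_in_open) auto
    ultimately show ?thesis
    proof eventually_elim
      case (elim y)
      have "\<exists>s\<ge>-t. s \<le> t \<and> \<rho> (y + s *\<^sub>R u) = 0"
      proof (rule IVT')
        show "continuous_on {-t..t} (\<lambda>s. \<rho> (y + s *\<^sub>R u))"
          by (intro continuous_on_compose2[OF N(3)]) (use inN[OF elim(3)] in \<open>auto intro!: continuous_intros\<close>)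
      qed (use elim t in auto)
      then obtain s where "\<bar>s\<bar> \<le> t" "\<rho> (y + s *\<^sub>R u) = 0" by (metis abs_le_iff minus_le_iff)
      then show ?case using t inN[OF elim(3)] by (intro exI[of _ s]) auto
    qed
  qed
  have "r (- v) = - r v" using linear_neg[OF has_derivative_linear[OF \<rho>]] .
  then consider "r (- v) > 0" | "r v > 0" using assms(6) by linarith
  then show ?thesis
  proof cases
    case 1
    from pos[OF 1] show ?thesis by simp
  next
    case 2
    from pos[OF 2] show ?thesis
    proof eventually_elim
      case (elim y)
      then obtain t where "\<bar>t\<bar> < \<delta>" "y + t *\<^sub>R v \<in> N" "\<rho> (y + t *\<^sub>R v) = 0" by blast
      then show ?case by (intro exI[of _ "-t"]) auto
    qed
  qed
qed

text \<open>A chart without a base point, so that it can be used at every point of M in W. The last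
  assumption is d\<rho> \<noteq> 0, expressed by the complexification.\<close>

locale hypersurface_chart =
  fixes M W :: "(complex ^ 'n) set" and \<rho> :: "complex ^ 'n \<Rightarrow> real"
    and R :: "complex ^ ('n + 'n) \<Rightarrow> complex" and T :: "(complex ^ ('n + 'n)) set"
  assumes complexified: "complexifies R T (cx \<rho>) W"
    and zero_set: "M \<inter> W = {z \<in> W. \<rho> z = 0}"
    and nondegenerate: "z \<in> W \<Longrightarrow> \<exists>v. dir_deriv (dg v) R (dg z) \<noteq> 0"
begin

lemmas chart = complexifiesD[OF complexified]

lemma chart_has_derivative:
  assumes "z \<in> W"
  shows "(\<rho> has_derivative (\<lambda>v. Re (dir_deriv (dg v) R (dg z)))) (at z)"
  using bounded_linear.has_derivative[OF bounded_linear_Re complexifies_has_derivative[OF complexified assms]]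
  by simp

lemma chart_real: "z \<in> W \<Longrightarrow> dir_deriv (dg v) R (dg z) \<in> \<real>"
  by (rule real_dir_deriv_dg[OF complexified]) auto

lemma chart_Re: "z \<in> W \<Longrightarrow> dir_deriv (dg v) R (dg z) = of_real (Re (dir_deriv (dg v) R (dg z)))"
  using chart_real by (simp add: complex_is_Real_iff complex_eq_iff)

lemma chart_continuous: "continuous_on W \<rho>"
  by (meson chart_has_derivative continuous_at_imp_continuous_on has_derivative_continuous)

lemma tangential:
  assumes "(g has_derivative g') (at q)" "q \<in> M" "q \<in> N" "open N" "N \<subseteq> W"
    and "\<And>z. z \<in> M \<inter> N \<Longrightarrow> g z = 0" "dir_deriv (dg w) R (dg q) = 0"
  shows "g' w = 0"
proof -
  have qW: "q \<in> W" using assms by auto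
  obtain v where v: "dir_deriv (dg v) R (dg q) \<noteq> 0" using nondegenerate[OF qW] by blast
  have "g z = 0" if "z \<in> N" "\<rho> z = 0" for z
    using assms(5,6) zero_set that by auto
  moreover have "\<rho> q = 0" using zero_set assms(2) qW by auto
  moreover have "Re (dir_deriv (dg v) R (dg q)) \<noteq> 0" using chart_Re[OF qW] v by (metis of_real_0)
  ultimately show ?thesis
    using tangential_derivative_eq_0[OF chart_has_derivative[OF qW] assms(1,4,3) continuous_on_subset[OF chart_continuous assms(5)]]
      assms(7) by auto
qed

lemma translate_to_M:
  assumes "q \<in> M" "q \<in> N" "open N" "N \<subseteq> W" "dir_deriv (dg v) R (dg q) \<noteq> 0" "\<delta> > 0"
  shows "\<forall>\<^sub>F y in nhds q. \<exists>t. \<bar>t\<bar> < \<delta> \<and> y - complex_of_real t *s v \<in> M \<inter> N"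
proof -
  have qW: "q \<in> W" using assms by auto
  have "Re (dir_deriv (dg v) R (dg q)) \<noteq> 0" using chart_Re[OF qW] assms(5) by (metis of_real_0)
  moreover have "\<rho> q = 0" using zero_set assms(1) qW by auto
  ultimately have "\<forall>\<^sub>F y in nhds q. \<exists>t. \<bar>t\<bar> < \<delta> \<and> y - t *\<^sub>R v \<in> N \<and> \<rho> (y - t *\<^sub>R v) = 0"
    using eventually_translate_to_zero_set[OF chart_has_derivative[OF qW] assms(3,2) continuous_on_subset[OF chart_continuous assms(4)]]
      assms(6) by blast
  then show ?thesis
    by eventually_elim (use zero_set assms(4) in \<open>auto simp: scaleR_eq_of_real_smult\<close>)
qed

text \<open>Subtracting a suitable real multiple of v from w leaves a real tangent vector, on which
  the differential of f vanishes by \<open>tangential\<close>. The multiple is real because \<rho>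
  is, while c may be complex because f is complex valued. Complex linearity carries the
  proportionality over to (1,0)-directions.\<close>

lemma proportional:
  assumes "complexifies F T' f S" "S \<subseteq> W" "\<And>z. z \<in> M \<inter> S \<Longrightarrow> f z = 0" "q \<in> M \<inter> S"
    and v: "dir_deriv (dg v) R (dg q) \<noteq> 0"
    and c: "c = dir_deriv (dg v) F (dg q) / dir_deriv (dg v) R (dg q)"
  shows "dir_deriv (dg w) F (dg q) = c * dir_deriv (dg w) R (dg q)"
    and "dir_deriv (join w 0) F (dg q) = c * dir_deriv (join w 0) R (dg q)"
proof -
  note F = complexifiesD[OF assms(1)]
  have q: "q \<in> W" "q \<in> S" "q \<in> M" using assms by auto
  note hF = F(3) F(4)[OF q(2)] and hR = chart(3) chart(4)[OF q(1)]
  have main: "dir_deriv (dg w) F (dg q) = c * dir_deriv (dg w) R (dg q)" for w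
  proof -
    define l where "l = Re (dir_deriv (dg w) R (dg q)) / Re (dir_deriv (dg v) R (dg q))"
    have l: "complex_of_real l = dir_deriv (dg w) R (dg q) / dir_deriv (dg v) R (dg q)"
      using chart_Re[OF q(1), of w] chart_Re[OF q(1), of v] by (metis l_def of_real_divide)
    have split: "dg (w + complex_of_real (-l) *s v) = dg w + complex_of_real (-l) *s dg v"
      by (simp add: dg_add dg_of_real_smult del: of_real_minus)
    have "dir_deriv (dg (w + complex_of_real (-l) *s v)) R (dg q) = 0"
      unfolding split dir_deriv_add[OF hR] dir_deriv_smult[OF hR] using v by (simp add: l)
    then have "dir_deriv (dg (w + complex_of_real (-l) *s v)) F (dg q) = 0"
      using tangential[OF complexifies_has_derivative[OF assms(1) q(2)] q(3,2) F(1) assms(2,3)] by blast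
    then show ?thesis
      unfolding split dir_deriv_add[OF hF] dir_deriv_smult[OF hF] using v by (simp add: l c)
  qed
  show "dir_deriv (dg w) F (dg q) = c * dir_deriv (dg w) R (dg q)" by (rule main)
  have jl: "join u 0 = (1/2) *s (dg u + (-\<i>) *s dg (\<i> *s u))" for u :: "complex ^ 'n"
    unfolding join_left_eq by (simp add: vec.scale_minus_left)
  show "dir_deriv (join w 0) F (dg q) = c * dir_deriv (join w 0) R (dg q)"
    unfolding jl dir_deriv_add[OF hF] dir_deriv_smult[OF hF] dir_deriv_add[OF hR] dir_deriv_smult[OF hR] main
    by (simp add: algebra_simps)
qed

text \<open>The derivatives of \<rho> in the directions u and i u are real, so the vanishing of
  their Wirtinger combination splits into two real equations.\<close>

lemma tangent_space_real:
  assumes "q \<in> W" "u \<in> holomorphic_tangent_space \<rho> q"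
  shows "dir_deriv (dg u) R (dg q) = 0" "dir_deriv (dg (\<i> *s u)) R (dg q) = 0"
proof -
  note hR = chart(3) chart(4)[OF assms(1)]
  have "dir_deriv (join u 0) R (dg q) = 0"
    using holomorphic_tangent_space_complexified[OF complexified assms(1)] assms(2) by blast
  moreover have "join u 0 = (1/2) *s (dg u + (-\<i>) *s dg (\<i> *s u))"
    unfolding join_left_eq by (simp add: vec.scale_minus_left)
  ultimately have "1/2 * (dir_deriv (dg u) R (dg q) + (-\<i>) * dir_deriv (dg (\<i> *s u)) R (dg q)) = 0"
    unfolding dir_deriv_add[OF hR, symmetric] dir_deriv_smult[OF hR, symmetric] by metis
  then show "dir_deriv (dg u) R (dg q) = 0" "dir_deriv (dg (\<i> *s u)) R (dg q) = 0"
    using chart_real[OF assms(1), of u] chart_real[OF assms(1), of "\<i> *s u"]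
    by (auto simp: complex_eq_iff complex_is_Real_iff)
qed

text \<open>If \<phi> = g \<rho>, the Levi forms on complex tangent vectors at q differ by the
  factor g(q), since each term with a derivative of g contains \<rho>(q) or a tangential derivative
  of \<rho>. The proof does without the quotient g. It is applied both to \<rho>' \<circ> H and to a
  change of defining function.\<close>

lemma levi_form_proportional:
  assumes "complexifies F T' (cx \<phi>) S" "S \<subseteq> W" "\<And>z. z \<in> M \<inter> S \<Longrightarrow> \<phi> z = 0" "q \<in> M \<inter> S"
  obtains c :: real
  where "\<And>w. dir_deriv (dg w) F (dg q) = c * dir_deriv (dg w) R (dg q)"
    and "\<And>w. dir_deriv (join w 0) F (dg q) = c * dir_deriv (join w 0) R (dg q)"
    and "\<And>u v. u \<in> holomorphic_tangent_space \<rho> q \<Longrightarrow> v \<in> holomorphic_tangent_space \<rho> q \<Longrightarrow>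
      levi_form \<phi> q u v = c * levi_form \<rho> q u v"
proof -
  note F = complexifiesD[OF assms(1)]
  have q: "q \<in> W" "q \<in> S" "q \<in> M" using assms by auto
  note hF = F(3) F(4)[OF q(2)] and hR = chart(3) chart(4)[OF q(1)]
  obtain v0 where v0: "dir_deriv (dg v0) R (dg q) \<noteq> 0" using nondegenerate[OF q(1)] by blast
  define c where "c = dir_deriv (dg v0) F (dg q) / dir_deriv (dg v0) R (dg q)"
  have van: "\<And>z. z \<in> M \<inter> S \<Longrightarrow> cx \<phi> z = 0" using assms(3) by simp
  have "c \<in> \<real>"
    unfolding c_def using real_dir_deriv_dg[OF assms(1) _ q(2)] chart_real[OF q(1)]
    by (intro Reals_divide) auto
  then obtain c' where c': "c = complex_of_real c'" by (auto elim: Reals_cases)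
  note ppn = proportional[OF assms(1,2) van assms(4) v0 c_def]
  have Fv0: "dir_deriv (dg v0) F (dg q) = c * dir_deriv (dg v0) R (dg q)" using v0 by (simp add: c_def)
  have lev: "levi_form \<phi> q u v = c * levi_form \<rho> q u v"
    if u: "u \<in> holomorphic_tangent_space \<rho> q" and v: "v \<in> holomorphic_tangent_space \<rho> q" for u v
  proof -
    define a where "a = join u 0"
    \<comment> \<open>The differentials of \<phi> and \<rho> are proportional on M, so this
      determinant vanishes there. At q the derivatives of both along a are zero, so differentiating
      G along the conjugate of the tangent vector v leaves exactly the two mixed second
      derivatives.\<close>
    define G where "G = (\<lambda>y. dir_deriv a F y * dir_deriv (dg v0) R y - dir_deriv (dg v0) F y * dir_deriv a R y)"
    define TT where "TT = T \<inter> T'"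
    have TT: "open TT" "dg q \<in> TT" using chart F q by (auto simp: TT_def)
    have hol: "dir_deriv b F hol_on TT" "dir_deriv b R hol_on TT" for b
      using hol_on_dir_deriv[OF F(2,3)] hol_on_dir_deriv[OF chart(2,3)] hol_on_subset
      unfolding TT_def by blast+
    have holG: "G hol_on TT" unfolding G_def by (intro hol_on_diff hol_on_mult hol)
    then have cG: "complexifies G TT (\<lambda>z. G (dg z)) S"
      using F(1) TT(1) F(4) chart(4) assms(2) by (auto simp: complexifies_def TT_def)
    have "G (dg z) = 0" if "z \<in> M \<inter> S" for z
    proof -
      have zW: "z \<in> W" using that assms(2) by auto
      obtain v1 where v1: "dir_deriv (dg v1) R (dg z) \<noteq> 0" using nondegenerate[OF zW] by blast
      obtain k where k: "k = dir_deriv (dg v1) F (dg z) / dir_deriv (dg v1) R (dg z)" by blast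
      note pk = proportional[OF assms(1,2) van that v1 k]
      have "dir_deriv (dg v0) F (dg z) = k * dir_deriv (dg v0) R (dg z)" by (rule pk(1))
      moreover have "dir_deriv a F (dg z) = k * dir_deriv a R (dg z)" unfolding a_def by (rule pk(2))
      ultimately show ?thesis unfolding G_def by simp
    qed
    then have tG: "dir_deriv (dg w) G (dg q) = 0" if "dir_deriv (dg w) R (dg q) = 0" for w
      using tangential[OF complexifies_has_derivative[OF cG q(2)] q(3,2) F(1) assms(2) _ that] by blast
    define b where "b = join 0 (cnjv v)"
    have "dir_deriv b G (dg q) = 0"
      unfolding b_def join_right_eq dir_deriv_smult[OF holG TT(2)] dir_deriv_add[OF holG TT(2)]
      using tG tangent_space_real[OF q(1) v] by simp
    moreover have "dir_deriv b G (dg q) = (dir_deriv a F (dg q) * dir_deriv b (dir_deriv (dg v0) R) (dg q)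
         + dir_deriv b (dir_deriv a F) (dg q) * dir_deriv (dg v0) R (dg q))
       - (dir_deriv (dg v0) F (dg q) * dir_deriv b (dir_deriv a R) (dg q)
         + dir_deriv b (dir_deriv (dg v0) F) (dg q) * dir_deriv a R (dg q))"
      unfolding G_def by (subst dir_deriv_diff[OF hol_on_mult[OF hol] hol_on_mult[OF hol] TT(2)])
        (simp add: dir_deriv_mult[OF hol TT(2)])
    moreover have "dir_deriv a R (dg q) = 0"
      using holomorphic_tangent_space_complexified[OF complexified q(1)] u a_def by blast
    moreover from this have "dir_deriv a F (dg q) = 0" using ppn(2) unfolding a_def by simp
    ultimately have "dir_deriv b (dir_deriv a F) (dg q) = c * dir_deriv b (dir_deriv a R) (dg q)"
      using Fv0 v0 by simp
    then show ?thesis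
      unfolding levi_form_complexified[OF assms(1) q(2)] levi_form_complexified[OF complexified q(1)] a_def b_def .
  qed
  show ?thesis
    by (rule that[of c']) (use ppn lev in \<open>simp_all add: c'\<close>)
qed

lemma zero_along_line:
  assumes "F hol_on S" "\<And>\<zeta>. norm \<zeta> \<le> d \<Longrightarrow> y + \<zeta> *s v \<in> S" "d > 0" "open S"
    and "\<And>n. (dir_deriv v ^^ n) F y = 0" "norm \<zeta> < d"
  shows "F (y + \<zeta> *s v) = 0"
proof -
  have "(\<lambda>\<zeta>. F (y + \<zeta> *s v)) holomorphic_on ball 0 d"
    by (rule hol_on_line_holomorphic[OF assms(1)]) (use assms in auto)
  moreover have "(deriv ^^ n) (\<lambda>\<zeta>. F (y + \<zeta> *s v)) 0 = 0" for n
    using higher_deriv_line[OF assms(4,1), of y 0 v n] assms(2)[of 0] assms(3,5) by simp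
  ultimately show ?thesis
    using holomorphic_fun_eq_0_on_ball[of "\<lambda>\<zeta>. F (y + \<zeta> *s v)" 0 d \<zeta>] assms(6) by simp
qed

text \<open>Hypersurfaces are sets of uniqueness for holomorphic functions. The derivative vanishes
  on a real hyperplane and is complex linear, hence it is zero on M; by induction all derivatives
  vanish on M, and the identity theorem along a transversal direction reaches a full neighbourhood
  of q.\<close>

lemma holomorphic_vanishing:
  assumes "\<phi> hol_on N" "open N" "N \<subseteq> W" "q \<in> M \<inter> N" "\<And>z. z \<in> M \<inter> N \<Longrightarrow> \<phi> z = 0"
  shows "\<forall>\<^sub>F z in nhds q. \<phi> z = 0"
proof -
  have step: "dir_deriv v \<psi> z = 0"
    if \<psi>: "\<psi> hol_on N" "\<And>z. z \<in> M \<inter> N \<Longrightarrow> \<psi> z = 0" and z: "z \<in> M \<inter> N" for \<psi> v z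
  proof -
    have zz: "z \<in> W" "z \<in> N" "z \<in> M" using z assms by auto
    note h\<psi> = \<psi>(1) zz(2) and hR = chart(3) chart(4)[OF zz(1)]
    obtain v0 where v0: "dir_deriv (dg v0) R (dg z) \<noteq> 0" using nondegenerate[OF zz(1)] by blast
    have tan: "dir_deriv w \<psi> z = l * dir_deriv v0 \<psi> z"
      if l: "complex_of_real l = dir_deriv (dg w) R (dg z) / dir_deriv (dg v0) R (dg z)" for w l
    proof -
      have "dir_deriv (dg (w + complex_of_real (-l) *s v0)) R (dg z) = 0"
        unfolding dg_add dg_of_real_smult dir_deriv_add[OF hR] dir_deriv_smult[OF hR] using v0 by (simp add: l)
      then have "dir_deriv (w + complex_of_real (-l) *s v0) \<psi> z = 0"
        using tangential[OF hol_on_has_derivative[OF h\<psi>] zz(3,2) assms(2,3) \<psi>(2)] by blast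
      then show ?thesis by (simp add: dir_deriv_add[OF h\<psi>] dir_deriv_smult[OF h\<psi>] del: of_real_minus) simp
    qed
    have ex: "\<exists>l. complex_of_real l = dir_deriv (dg w) R (dg z) / dir_deriv (dg v0) R (dg z)" for w
      using chart_Re[OF zz(1), of w] chart_Re[OF zz(1), of v0] by (metis of_real_divide)
    \<comment> \<open>Up to a tangent vector, i v0 is a real multiple l of v0. Comparing the two
      values of the derivative in direction i v0 produces the factor i - l, which is nonzero because
      l is real.\<close>
    obtain l where "complex_of_real l = dir_deriv (dg (\<i> *s v0)) R (dg z) / dir_deriv (dg v0) R (dg z)"
      using ex by blast
    from tan[OF this] have "(\<i> - of_real l) * dir_deriv v0 \<psi> z = 0"
      by (simp add: dir_deriv_smult[OF h\<psi>] algebra_simps)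
    moreover have "\<i> - of_real l \<noteq> 0" by (simp add: complex_eq_iff)
    ultimately have "dir_deriv v0 \<psi> z = 0" by simp
    then show ?thesis using tan ex[of v] by force
  qed
  have all: "(dir_deriv v ^^ n) \<phi> z = 0" if "z \<in> M \<inter> N" for v n z
    using that
  proof (induction n arbitrary: z)
    case (Suc n)
    then show ?case using step[OF hol_on_dir_deriv_funpow[OF assms(2,1)] Suc.IH] by simp
  qed (use assms in auto)
  have qW: "q \<in> W" using assms by auto
  obtain v where v: "dir_deriv (dg v) R (dg q) \<noteq> 0" using nondegenerate[OF qW] by blast
  obtain r d where rd: "r > 0" "d > 0" "ball q r \<subseteq> N" "\<And>z \<zeta>. z \<in> ball q r \<Longrightarrow> norm \<zeta> \<le> d \<Longrightarrow> z + \<zeta> *s v \<in> N"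
    using exists_radius[OF assms(2), of q v] assms(4) by (metis IntE)
  have "\<forall>\<^sub>F y in nhds q. \<exists>t. \<bar>t\<bar> < d \<and> y - complex_of_real t *s v \<in> M \<inter> ball q r"
    by (rule translate_to_M[OF _ _ open_ball _ v rd(2)]) (use assms rd in auto)
  then show ?thesis
  proof eventually_elim
    case (elim y)
    then obtain t where t: "\<bar>t\<bar> < d" "y - complex_of_real t *s v \<in> M \<inter> ball q r" by blast
    have "\<phi> (y - complex_of_real t *s v + complex_of_real t *s v) = 0"
      by (rule zero_along_line[OF assms(1) _ rd(2) assms(2)]) (use t rd all in auto)
    then show ?case by simp
  qed
qed

end

subsection \<open>Composition with a holomorphic map\<close>

definition inl :: "complex ^ ('n + 'n) \<Rightarrow> complex ^ 'n" where "inl y = (\<chi> j. y $ Inl j)"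
definition inr :: "complex ^ ('n + 'n) \<Rightarrow> complex ^ 'n" where "inr y = (\<chi> j. y $ Inr j)"

lemma inl_nth [simp]: "inl y $ j = y $ Inl j" and inr_nth [simp]: "inr y $ j = y $ Inr j"
  by (simp_all add: inl_def inr_def)

lemma inl_join [simp]: "inl (join a b) = a" and inr_join [simp]: "inr (join a b) = b"
  by (simp_all add: vec_eq_iff)

lemma inl_dg [simp]: "inl (dg z) = z" and inr_dg [simp]: "inr (dg z) = cnjv z"
  by (simp_all add: dg_def)

lemma inl_add: "inl (a + b) = inl a + inl b" and inl_smult: "inl (c *s a) = c *s inl a"
  and inr_smult: "inr (c *s a) = c *s inr a"
  by (simp_all add: vec_eq_iff)

lemma bounded_linear_inl: "bounded_linear inl" and bounded_linear_inr: "bounded_linear inr"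
  unfolding inl_def inr_def by (intro bounded_linear_vec_lambda bounded_linear_vec_nth)+

lemma bounded_linear_join: "bounded_linear (\<lambda>a. join a 0)" "bounded_linear (\<lambda>b. join 0 b)"
proof -
  have "bounded_linear (\<lambda>a. case i of Inl j \<Rightarrow> a $ j | Inr j \<Rightarrow> 0 $ j)" for i :: "'a + 'a"
    by (cases i) (auto intro: bounded_linear_vec_nth)
  then show "bounded_linear (\<lambda>a. join a 0 :: complex ^ ('a + 'a))"
    unfolding join_def by (rule bounded_linear_vec_lambda)
  have "bounded_linear (\<lambda>a. case i of Inl j \<Rightarrow> 0 $ j | Inr j \<Rightarrow> a $ j)" for i :: "'b + 'b"
    by (cases i) (auto intro: bounded_linear_vec_nth)
  then show "bounded_linear (\<lambda>a. join 0 a :: complex ^ ('b + 'b))"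
    unfolding join_def by (rule bounded_linear_vec_lambda)
qed

lemma join_split: "join a b = join a 0 + join 0 b"
  by (auto simp: vec_sum_eq_iff)

text \<open>The second half sends w to the conjugate of H at the conjugate of w. This is holomorphic
  in w and equals the conjugate of H z at w = cnj z, so composing with \<open>cx_map H\<close>
  preserves complexifications.\<close>

definition cx_map :: "(complex ^ 'n \<Rightarrow> complex ^ 'm) \<Rightarrow> complex ^ ('n + 'n) \<Rightarrow> complex ^ ('m + 'm)" where
  "cx_map H y = join (H (inl y)) (cnjv (H (cnjv (inr y))))"

lemma cx_map_dg: "cx_map H (dg z) = dg (H z)"
  by (simp add: cx_map_def cnjv_cnjv dg_def)

lemma cx_map_holomorphic:
  assumes "H holomorphic_map_on S" "\<And>y. y \<in> A \<Longrightarrow> inl y \<in> S \<and> cnjv (inr y) \<in> S"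
  shows "cx_map H holomorphic_map_on A"
    and "y \<in> A \<Longrightarrow> dir_deriv v (cx_map H) y =
      join (dir_deriv (inl v) H (inl y)) (cnjv (dir_deriv (cnjv (inr v)) H (cnjv (inr y))))"
proof -
  define D where "D y v = join (dir_deriv (inl v) H (inl y)) 0 + join 0 (cnjv (dir_deriv (cnjv (inr v)) H (cnjv (inr y))))" for y v
  have der: "(cx_map H has_derivative D y) (at y)" if "y \<in> A" for y
  proof -
    have 1: "(inl has_derivative inl) (at y)"
      by (rule bounded_linear_imp_has_derivative[OF bounded_linear_inl])
    have 2: "((\<lambda>y. cnjv (inr y)) has_derivative (\<lambda>v. cnjv (inr v))) (at y)"
      by (intro bounded_linear_imp_has_derivative bounded_linear_compose[OF bounded_linear_cnjv] bounded_linear_inr)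
    have "((\<lambda>y. H (inl y)) has_derivative (\<lambda>v. dir_deriv (inl v) H (inl y))) (at y)"
      using has_derivative_compose[OF 1 holomorphic_map_on_has_derivative(1)[OF assms(1)]] assms(2)[OF that] by blast
    then have 3: "((\<lambda>y. join (H (inl y)) 0) has_derivative (\<lambda>v. join (dir_deriv (inl v) H (inl y)) 0)) (at y)"
      by (rule bounded_linear.has_derivative[OF bounded_linear_join(1)])
    have "((\<lambda>y. H (cnjv (inr y))) has_derivative (\<lambda>v. dir_deriv (cnjv (inr v)) H (cnjv (inr y)))) (at y)"
      using has_derivative_compose[OF 2 holomorphic_map_on_has_derivative(1)[OF assms(1)]] assms(2)[OF that] by blast
    then have 4: "((\<lambda>y. join 0 (cnjv (H (cnjv (inr y))))) has_derivative (\<lambda>v. join 0 (cnjv (dir_deriv (cnjv (inr v)) H (cnjv (inr y)))))) (at y)"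
      by (intro bounded_linear.has_derivative[OF bounded_linear_join(2)] bounded_linear.has_derivative[OF bounded_linear_cnjv])
    have "cx_map H = (\<lambda>y. join (H (inl y)) 0 + join 0 (cnjv (H (cnjv (inr y)))))"
      unfolding cx_map_def by (rule ext) (rule join_split)
    then show ?thesis
      using has_derivative_add[OF 3 4] unfolding D_def by simp
  qed
  have "D y (c *s v) = c *s D y v" if "y \<in> A" for y c v
    using assms(2)[OF that]
    by (simp add: D_def inl_smult inr_smult cnjv_smult holomorphic_map_on_has_derivative(2)[OF assms(1)]
        vec.scale_right_distrib) (simp add: vec_sum_eq_iff)
  then show "cx_map H holomorphic_map_on A"
    unfolding holomorphic_map_on_def using der by blast
  show "y \<in> A \<Longrightarrow> dir_deriv v (cx_map H) y =
      join (dir_deriv (inl v) H (inl y)) (cnjv (dir_deriv (cnjv (inr v)) H (cnjv (inr y))))"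
    using dir_deriv_eqI[OF der] unfolding D_def join_split[symmetric] .
qed

lemma continuous_on_holomorphic_map: "H holomorphic_map_on S \<Longrightarrow> continuous_on S H"
  by (meson continuous_at_imp_continuous_on has_derivative_continuous holomorphic_map_on_has_derivative(1))

text \<open>The first half of \<open>cx_map H\<close> depends on z alone and the second half on w
  alone. Directions of either kind are mapped to directions of the same kind and second derivatives
  of H do not enter the mixed derivative, so the Levi form is pulled back by dH without a correction
  term.\<close>

lemma complexifies_compose:
  assumes H: "H holomorphic_map_on S" "open S" and C: "complexifies R' T' f' W'" and sub: "H ` S \<subseteq> W'"
  obtains F T where "complexifies F T (\<lambda>z. f' (H z)) S"
    "\<And>y u. y \<in> T \<Longrightarrow> inl y \<in> S \<and> dir_deriv (join u 0) F y = dir_deriv (join (dir_deriv u H (inl y)) 0) R' (cx_map H y)"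
    "\<And>y. y \<in> T \<Longrightarrow> cx_map H y \<in> T'"
    "\<And>z u v. z \<in> S \<Longrightarrow> dir_deriv (join 0 (cnjv v)) (dir_deriv (join u 0) F) (dg z) =
       dir_deriv (join 0 (cnjv (dir_deriv v H z))) (dir_deriv (join (dir_deriv u H z) 0) R') (dg (H z))"
proof -
  note C' = complexifiesD[OF C]
  define A where "A = {y. inl y \<in> S \<and> cnjv (inr y) \<in> S}"
  have opA: "open A"
    unfolding A_def
    by (intro open_Collect_conj open_vimage[unfolded vimage_def] H(2) linear_continuous_on
        bounded_linear_inl bounded_linear_compose[OF bounded_linear_cnjv bounded_linear_inr])
  have holA: "cx_map H holomorphic_map_on A"
    by (rule cx_map_holomorphic(1)[OF H(1)]) (auto simp: A_def)
  define T where "T = A \<inter> cx_map H -` T'"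
  have opT: "open T"
    unfolding T_def by (rule continuous_open_preimage[OF continuous_on_holomorphic_map[OF holA] opA C'(2)])
  have holT: "cx_map H holomorphic_map_on T" "cx_map H ` T \<subseteq> T'" "T \<subseteq> A"
    using holA holomorphic_map_on_subset unfolding T_def by blast+
  have dcx: "dir_deriv v (cx_map H) y = join (dir_deriv (inl v) H (inl y)) (cnjv (dir_deriv (cnjv (inr v)) H (cnjv (inr y))))"
    if "y \<in> T" for v y
    by (rule cx_map_holomorphic(2)[OF H(1), of A]) (use that in \<open>auto simp: T_def A_def\<close>)
  define F where "F y = R' (cx_map H y)" for y
  have dgT: "dg z \<in> T" if "z \<in> S" for z
    using that sub C'(4) by (auto simp: T_def A_def cnjv_cnjv cx_map_dg)
  have F: "F hol_on T" unfolding F_def by (rule hol_on_compose_map(1)[OF C'(3) holT(1,2)])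
  have zero: "dir_deriv 0 H z = 0" if "z \<in> S" for z
    using holomorphic_map_on_has_derivative(2)[OF H(1) that, of 0 0] by simp
  have 2: "dir_deriv (join u 0) F y = dir_deriv (join (dir_deriv u H (inl y)) 0) R' (cx_map H y)" if "y \<in> T" for y u
  proof -
    have "cnjv (inr y) \<in> S" using that by (auto simp: T_def A_def)
    then show ?thesis
      unfolding F_def by (simp add: hol_on_compose_map(2)[OF C'(3) holT(1,2) that] dcx[OF that] cnjv_0 zero)
  qed
  have 3: "dir_deriv (join 0 (cnjv v)) (dir_deriv (join u 0) F) (dg z) =
       dir_deriv (join 0 (cnjv (dir_deriv v H z))) (dir_deriv (join (dir_deriv u H z) 0) R') (dg (H z))" if z: "z \<in> S" for z u v
  proof -
    \<comment> \<open>Moving in direction b changes only the second half, so the base point z, and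
      with it the vector \<open>dir_deriv u H z\<close> in the chain rule just proved, stays
      constant along this line.\<close>
    define G where "G = dir_deriv (join (dir_deriv u H z) 0) R'"
    define b where "b = join 0 (cnjv v)"
    have G: "G hol_on T'" unfolding G_def by (rule hol_on_dir_deriv[OF C'(2,3)])
    note GH = hol_on_compose_map[OF G holT(1,2)]
    have inT: "dg z + 0 *s b \<in> T" using dgT[OF z] by simp
    have "((\<lambda>\<zeta>. dir_deriv (join u 0) F (dg z + \<zeta> *s b)) has_field_derivative dir_deriv b (dir_deriv (join u 0) F) (dg z + 0 *s b)) (at 0)"
      by (rule hol_on_line[OF hol_on_dir_deriv[OF opT F] inT])
    moreover have "((\<lambda>\<zeta>. G (cx_map H (dg z + \<zeta> *s b))) has_field_derivative dir_deriv b (\<lambda>y. G (cx_map H y)) (dg z + 0 *s b)) (at 0)"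
      by (rule hol_on_line[OF GH(1) inT])
    then have "((\<lambda>\<zeta>. dir_deriv (join u 0) F (dg z + \<zeta> *s b)) has_field_derivative dir_deriv b (\<lambda>y. G (cx_map H y)) (dg z + 0 *s b)) (at 0)"
    proof (rule DERIV_cong_ev[THEN iffD2, OF refl _ refl, rotated])
      have "\<forall>\<^sub>F \<zeta> in nhds 0. \<zeta> \<in> {\<zeta>. dg z + \<zeta> *s b \<in> T}"
        by (rule eventually_nhds_in_open[OF open_line_preimage[OF opT]]) (use inT in simp)
      then show "\<forall>\<^sub>F \<zeta> in nhds 0. dir_deriv (join u 0) F (dg z + \<zeta> *s b) = G (cx_map H (dg z + \<zeta> *s b))"
      proof eventually_elim
        case (elim \<zeta>)
        then show ?case using 2[of "dg z + \<zeta> *s b" u]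
          by (simp add: G_def b_def inl_add inl_smult)
      qed
    qed
    ultimately have "dir_deriv b (dir_deriv (join u 0) F) (dg z) = dir_deriv b (\<lambda>y. G (cx_map H y)) (dg z)"
      using DERIV_unique by fastforce
    also have "\<dots> = dir_deriv (join 0 (cnjv (dir_deriv v H z))) G (dg (H z))"
      using GH(2)[OF dgT[OF z], of b] dcx[OF dgT[OF z], of b]
      by (simp add: cx_map_dg b_def cnjv_cnjv zero[OF z])
    finally show ?thesis unfolding b_def G_def .
  qed
  show ?thesis
  proof (rule that[of F T])
    show "complexifies F T (\<lambda>z. f' (H z)) S"
      using H(2) opT F dgT sub C'(5) by (auto simp: complexifies_def F_def cx_map_dg image_subset_iff)
    show "inl y \<in> S \<and> dir_deriv (join u 0) F y = dir_deriv (join (dir_deriv u H (inl y)) 0) R' (cx_map H y)"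
      if "y \<in> T" for y u
      using 2[OF that] that by (simp add: T_def A_def)
    show "cx_map H y \<in> T'" if "y \<in> T" for y using that by (simp add: T_def)
  qed (rule 3)
qed

section \<open>Holomorphic vector fields in the kernel of dH\<close>

lemma linear_dir_deriv:
  assumes "H holomorphic_map_on S" "z \<in> S"
  shows "Vector_Spaces.linear (*s) (*s) (\<lambda>u. dir_deriv u H z)"
  by unfold_locales
    (use assms linear_add[OF has_derivative_linear[OF holomorphic_map_on_has_derivative(1)[OF assms]]]
      holomorphic_map_on_has_derivative(2)[OF assms] in auto)

text \<open>Let B be a projection onto the kernel of dH at q and Q a left inverse of dH at q on the
  kernel of B. Then G = Q \<circ> dH + B is invertible at q, hence nearby, and a z is the solution
  of G z x = u0. Where the kernel at z is at least as large as at q, B maps it onto the kernel at q;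
  so u0 = B x for some x in the kernel at z, and x solves the same equation, whence a z = x.\<close>

lemma kernel_field:
  fixes H :: "complex ^ 'n \<Rightarrow> complex ^ 'm"
  assumes H: "H holomorphic_map_on N" "open N" and q: "q \<in> N" and u0: "dir_deriv u0 H q = 0" "u0 \<noteq> 0"
  obtains N1 a where "open N1" "q \<in> N1" "N1 \<subseteq> N" "a holomorphic_map_on N1"
    "\<And>z. z \<in> N1 \<Longrightarrow> a z \<noteq> 0"
    "\<And>z. z \<in> N1 \<Longrightarrow> vec.dim {u. dir_deriv u H q = 0} \<le> vec.dim {u. dir_deriv u H z = 0} \<Longrightarrow> dir_deriv (a z) H z = 0"
proof -
  define A where "A z u = dir_deriv u H z" for z u
  have linA: "Vector_Spaces.linear (*s) (*s) (A z)" if "z \<in> N" for z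
    using linear_dir_deriv[OF H(1) that] unfolding A_def .
  define K where "K z = {u. A z u = 0}" for z
  have subK: "vec.subspace (K z)" if "z \<in> N" for z
    unfolding K_def by (rule vec.linear_subspace_kernel[OF linA[OF that]])
  obtain B :: "complex ^ 'n \<Rightarrow> complex ^ 'n" where B: "range B \<subseteq> K q" "Vector_Spaces.linear (*s) (*s) B" "\<And>v. v \<in> K q \<Longrightarrow> B v = v"
    using vec.linear_exists_left_inverse_on[OF vec.linear_ident subK[OF q] inj_on_id2] by blast
  have "inj_on (A q) {x. B x = 0}"
  proof (rule inj_onI)
    fix x y assume *: "x \<in> {x. B x = 0}" "y \<in> {x. B x = 0}" "A q x = A q y"
    then have "x - y \<in> K q" by (simp add: K_def vec.linear_diff[OF linA[OF q]])
    moreover have "B (x - y) = 0" using * by (simp add: vec.linear_diff[OF B(2)])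
    ultimately show "x = y" using B(3) by force
  qed
  then obtain Q :: "complex ^ 'm \<Rightarrow> complex ^ 'n" where Q: "range Q \<subseteq> {x. B x = 0}" "Vector_Spaces.linear (*s) (*s) Q"
      "\<And>v. B v = 0 \<Longrightarrow> Q (A q v) = v"
    using vec.linear_exists_left_inverse_on[OF linA[OF q] vec.linear_subspace_kernel[OF B(2)]] by blast
  define G where "G z = matrix (\<lambda>u. Q (A z u) + B u)" for z
  have G: "G z *v u = Q (A z u) + B u" if "z \<in> N" for z u
    unfolding G_def
    by (rule matrix_works) (intro vec.linear_compose_add B(2) Vector_Spaces.linear_compose[OF linA[OF that] Q(2), unfolded o_def])
  have holG: "(\<lambda>z. G z $ i $ j) hol_on N" for i j
  proof -
    have "Q y $ i = (\<Sum>l\<in>UNIV. y $ l * Q (axis l 1) $ i)" for y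
    proof -
      have "Q y = Q (\<Sum>l\<in>UNIV. y $ l *s axis l 1)" by (rule arg_cong[OF vec_eq_sum_axis])
      also have "\<dots> = (\<Sum>l\<in>UNIV. y $ l *s Q (axis l 1))"
        by (simp add: vec.linear_sum[OF Q(2)] vec.linear_scale[OF Q(2)])
      finally show ?thesis by simp
    qed
    note Q_expand = this
    have eq: "G z $ i $ j = (\<Sum>l\<in>UNIV. dir_deriv (axis j 1) H z $ l * Q (axis l 1) $ i) + B (axis j 1) $ i" for z
      unfolding G_def matrix_def A_def vec_lambda_beta vector_add_component
      by (rule arg_cong[OF Q_expand])
    have "(\<lambda>z. dir_deriv (axis j 1) H z $ l) hol_on N" for l
      by (rule hol_on_cong[OF H(2) _ hol_on_dir_deriv[OF H(2) holomorphic_map_on_component(1)[OF H(1), of l], of "axis j 1"]])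
        (rule holomorphic_map_on_component(2)[OF H(1)])
    then show ?thesis unfolding eq by (intro hol_on_add hol_on_sum hol_on_mult hol_on_const)
  qed
  have holdet: "(\<lambda>z. det (X z)) hol_on N" if "\<And>i j. (\<lambda>z. X z $ i $ j) hol_on N" for X :: "complex ^ 'n \<Rightarrow> complex ^ 'n ^ 'n"
    unfolding det_def by (intro hol_on_sum hol_on_mult hol_on_prod hol_on_const that)
  define N1 where "N1 = N \<inter> (\<lambda>z. det (G z)) -` (- {0})"
  have N1: "open N1" "N1 \<subseteq> N"
    unfolding N1_def
    by (auto intro!: continuous_open_preimage hol_on_imp_continuous_on holdet holG H)
  have "inj ((*v) (G q))"
    unfolding vec.inj_iff_eq_0
  proof (intro allI impI)
    fix x assume "G q *v x = 0"
    then have 0: "Q (A q x) + B x = 0" using G[OF q] by simp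
    have "B (Q (A q x) + B x) = B x"
    proof -
      have "B (Q (A q x)) = 0" using Q(1) by blast
      moreover have "B (B x) = B x" using B(1,3) by blast
      ultimately show ?thesis by (simp add: vec.linear_add[OF B(2)])
    qed
    then have "B x = 0" using 0 vec.linear_0[OF B(2)] by simp
    then show "x = 0" using Q(3)[of x] 0 by simp
  qed
  then have "det (G q) \<noteq> 0"
    using matrix_left_invertible_injective invertible_left_inverse invertible_det_nz by blast
  then have qN1: "q \<in> N1" using q by (simp add: N1_def)
  \<comment> \<open>Cramer's rule is chosen for its form: a quotient of determinants is visibly
    holomorphic in z.\<close>
  define a where "a z = (\<chi> k. det (\<chi> i j. if j = k then u0 $ i else G z $ i $ j) / det (G z))" for z
  have Ga: "G z *v x = u0 \<longleftrightarrow> x = a z" if "z \<in> N1" for z x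
    unfolding a_def by (rule cramer) (use that in \<open>simp add: N1_def\<close>)
  have u0K: "u0 \<in> K q" using u0 by (simp add: K_def A_def)
  show ?thesis
  proof (rule that[OF N1(1) qN1 N1(2)])
    show "a holomorphic_map_on N1"
    proof (rule holomorphic_map_onI)
      fix k
      have num: "(\<lambda>z. det (\<chi> i j. if j = k then u0 $ i else G z $ i $ j)) hol_on N"
      proof (rule holdet)
        fix i j show "(\<lambda>z. (\<chi> i j. if j = k then u0 $ i else G z $ i $ j) $ i $ j) hol_on N"
          unfolding vec_lambda_beta by (cases "j = k") (simp_all add: holG)
      qed
      show "(\<lambda>z. a z $ k) hol_on N1"
        unfolding a_def divide_inverse vec_lambda_beta
        by (rule hol_on_mult[OF hol_on_subset[OF num N1(2)] hol_on_inverse[OF hol_on_subset[OF holdet[OF holG] N1(2)]]])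
          (auto simp: N1_def)
    qed
    show "a z \<noteq> 0" if "z \<in> N1" for z
      using Ga[OF that, of "a z"] u0(2) by (metis matrix_vector_mult_0_right)
    fix z assume z: "z \<in> N1" and dim: "vec.dim {u. dir_deriv u H q = 0} \<le> vec.dim {u. dir_deriv u H z = 0}"
    have zN: "z \<in> N" using z N1 by auto
    have inj: "inj_on B (K z)"
    proof (rule inj_onI)
      fix x y assume *: "x \<in> K z" "y \<in> K z" "B x = B y"
      then have "G z *v x = G z *v y" using G[OF zN] vec.linear_0[OF Q(2)] by (simp add: K_def)
      moreover have "inj ((*v) (G z))"
        using z invertible_det_nz[of "G z"] by (simp add: N1_def invertible_left_inverse matrix_left_invertible_injective)
      ultimately show "x = y" by (simp add: inj_eq)
    qed
    have sK: "vec.span (K z) = K z" using subK[OF zN] vec.span_eq_iff by blast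
    have injs: "inj_on B (vec.span (K z))" unfolding sK by (rule inj)
    have "B ` K z = K q"
    proof (rule vec.subspace_dim_equal)
      show "vec.dim (K q) \<le> vec.dim (B ` K z)"
        unfolding vec.dim_image_eq[OF B(2) injs] using dim by (simp add: K_def A_def)
    qed (use subK q zN B vec.linear_subspace_image[OF B(2)] in auto)
    then obtain x where x: "x \<in> K z" "B x = u0" using u0K by (metis imageE)
    then have "G z *v x = u0" using G[OF zN] vec.linear_0[OF Q(2)] by (simp add: K_def)
    then show "dir_deriv (a z) H z = 0" using x(1) Ga[OF z] by (simp add: K_def A_def)
  qed
qed

subsection \<open>Points of injectivity\<close>

text \<open>In the Leibniz rule every term except the one with all m derivatives on g j contains a
  vanishing lower derivative.\<close>

lemma holomorphic_on_sum_mult_higher_deriv: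
  assumes "finite J" "open S" "z \<in> S" "\<And>j. j \<in> J \<Longrightarrow> f j holomorphic_on S" "\<And>j. j \<in> J \<Longrightarrow> g j holomorphic_on S"
    and "\<And>j i. j \<in> J \<Longrightarrow> i < m \<Longrightarrow> (deriv ^^ i) (g j) z = 0"
  shows "(deriv ^^ m) (\<lambda>w. \<Sum>j\<in>J. f j w * g j w) z = (\<Sum>j\<in>J. f j z * (deriv ^^ m) (g j) z)"
  using assms(1,4-6)
proof (induction J rule: finite_induct)
  case empty
  have "(deriv ^^ m) (\<lambda>w. 0 :: complex) = (\<lambda>w. 0)" by (induction m) auto
  then show ?case by simp
next
  case (insert j J)
  have "(deriv ^^ m) (\<lambda>w. f j w * g j w) z =
      (\<Sum>i = 0..m. of_nat (m choose i) * (deriv ^^ i) (f j) z * (deriv ^^ (m - i)) (g j) z)"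
    by (rule higher_deriv_mult[OF _ _ assms(2,3)]) (use insert.prems in auto)
  also have "\<dots> = (\<Sum>i = 0..m. if i = 0 then f j z * (deriv ^^ m) (g j) z else 0)"
    using insert.prems(3)[of j] by (intro sum.cong) auto
  also have "\<dots> = f j z * (deriv ^^ m) (g j) z" by simp
  finally have 1: "(deriv ^^ m) (\<lambda>w. f j w * g j w) z = f j z * (deriv ^^ m) (g j) z" .
  have "(deriv ^^ m) (\<lambda>w. f j w * g j w + (\<Sum>j\<in>J. f j w * g j w)) z =
      (deriv ^^ m) (\<lambda>w. f j w * g j w) z + (deriv ^^ m) (\<lambda>w. \<Sum>j\<in>J. f j w * g j w) z"
    by (rule higher_deriv_add[OF _ _ assms(2,3)]) (use insert.prems in \<open>auto intro!: holomorphic_intros\<close>)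
  then show ?case using insert 1 by simp
qed

section \<open>Order of vanishing along M and tangency of kernel fields\<close>

context hypersurface_chart
begin

text \<open>If all these derivatives were zero along M, F would vanish on complex discs in direction
  \<open>dg v\<close> centred at points of M. By \<open>translate_to_M\<close> the discs reach
  \<open>dg y\<close> for all y near q, so f would vanish near q.\<close>

lemma normal_order:
  assumes F: "complexifies F T' f N" "N \<subseteq> W" "q \<in> M \<inter> N" "dir_deriv (dg v) R (dg q) \<noteq> 0"
    and nz: "\<not> (\<forall>\<^sub>F z in nhds q. f z = 0)"
  shows "\<exists>n. \<exists>z\<in>M \<inter> N. (dir_deriv (dg v) ^^ n) F (dg z) \<noteq> 0"
proof (rule ccontr)
  note C = complexifiesD[OF F(1)]
  assume "\<not> ?thesis"
  then have van: "\<And>n z. z \<in> M \<inter> N \<Longrightarrow> (dir_deriv (dg v) ^^ n) F (dg z) = 0" by blast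
  have qN: "q \<in> N" using F(3) by auto
  obtain r d where rd: "r > 0" "d > 0" "ball (dg q) r \<subseteq> T'"
      "\<And>y \<zeta>. y \<in> ball (dg q) r \<Longrightarrow> norm \<zeta> \<le> d \<Longrightarrow> y + \<zeta> *s dg v \<in> T'"
    by (rule exists_radius[OF C(2) C(4)[OF qN], of "dg v"]) blast
  \<comment> \<open>Around base points in N' the disc of the uniform radius d stays in T', so a
    translation by less than d can be bridged by the identity theorem.\<close>
  define N' where "N' = N \<inter> dg -` ball (dg q) r"
  have N': "open N'" "q \<in> N'" "N' \<subseteq> N"
    using C(1) qN rd unfolding N'_def
    by (auto intro!: continuous_open_preimage continuous_intros)
  have "\<forall>\<^sub>F y in nhds q. \<exists>t. \<bar>t\<bar> < d \<and> y - complex_of_real t *s v \<in> M \<inter> N'"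
    by (rule translate_to_M[OF _ N'(2,1) _ F(4) rd(2)]) (use F N' in auto)
  moreover have "\<forall>\<^sub>F y in nhds q. y \<in> N"
    using C(1) qN by (rule eventually_nhds_in_open)
  ultimately have "\<forall>\<^sub>F y in nhds q. f y = 0"
  proof eventually_elim
    case (elim y)
    then obtain t where t: "\<bar>t\<bar> < d" "y - complex_of_real t *s v \<in> M \<inter> N'" by blast
    have "F (dg (y - complex_of_real t *s v) + complex_of_real t *s dg v) = 0"
      by (rule zero_along_line[OF C(3) _ rd(2) C(2)]) (use t rd(4) van N' in \<open>auto simp: N'_def\<close>)
    moreover have "dg (y - complex_of_real t *s v) + complex_of_real t *s dg v = dg y"
      by (simp add: dg_diff dg_of_real_smult)
    ultimately show ?case using C(5)[OF elim(2)] by simp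
  qed
  then show False using nz by blast
qed

text \<open>Here m is k - 1. The identity expressing that a annihilates F is differentiated m times
  along the line through \<open>dg z\<close> in direction \<open>dg v\<close>. By
  \<open>proportional\<close>, the i-th normal derivative of a (1,0)-derivative of F is the normal
  derivative of F of order i + 1 times a multiple of the same derivative of \<rho>, so at z it is
  zero for i < m. Only the terms with undifferentiated a survive, and they sum to a nonzero multiple
  of the derivative of \<rho> along a z.\<close>

lemma kernel_field_tangent:
  assumes F: "complexifies F T' f N" "N \<subseteq> W"
    and a: "a holomorphic_map_on N"
    and ann: "\<And>y. y \<in> T' \<Longrightarrow> inl y \<in> N \<Longrightarrow> dir_deriv (join (a (inl y)) 0) F y = 0"
    and low: "\<And>i x. i \<le> m \<Longrightarrow> x \<in> M \<inter> N \<Longrightarrow> (dir_deriv (dg v) ^^ i) F (dg x) = 0"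
    and z: "z \<in> M \<inter> N" and top: "(dir_deriv (dg v) ^^ Suc m) F (dg z) \<noteq> 0"
    and v: "dir_deriv (dg v) R (dg z) \<noteq> 0"
  shows "a z \<in> holomorphic_tangent_space \<rho> z"
proof -
  note C = complexifiesD[OF F(1)]
  have zN: "z \<in> N" and zW: "z \<in> W" using z F by auto
  note zT = C(4)[OF zN]
  define Fi where "Fi i = (dir_deriv (dg v) ^^ i) F" for i
  have hFi: "Fi i hol_on T'" for i unfolding Fi_def by (rule hol_on_dir_deriv_funpow[OF C(2,3)])
  have cFi: "complexifies (Fi i) T' (\<lambda>x. Fi i (dg x)) N" for i
    using C hFi unfolding complexifies_def by blast
  have vanFi: "Fi i (dg x) = 0" if "i \<le> m" "x \<in> M \<inter> N" for i x using low that by (simp add: Fi_def)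
  have prp: "dir_deriv (join w 0) (Fi i) (dg z) =
      (Fi (Suc i) (dg z) / dir_deriv (dg v) R (dg z)) * dir_deriv (join w 0) R (dg z)" if "i \<le> m" for w i
    using proportional(2)[OF cFi F(2) vanFi[OF that] z v] by (simp add: Fi_def)
  obtain r d where rd: "r > 0" "d > 0" "ball z r \<subseteq> N" "\<And>y \<zeta>. y \<in> ball z r \<Longrightarrow> norm \<zeta> \<le> d \<Longrightarrow> y + \<zeta> *s v \<in> N"
    by (rule exists_radius[OF C(1) zN, of v]) blast
  obtain r' d' where rd': "r' > 0" "d' > 0" "ball (dg z) r' \<subseteq> T'" "\<And>y \<zeta>. y \<in> ball (dg z) r' \<Longrightarrow> norm \<zeta> \<le> d' \<Longrightarrow> y + \<zeta> *s dg v \<in> T'"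
    by (rule exists_radius[OF C(2) zT, of "dg v"]) blast
  define D where "D = ball (0::complex) (min d d')"
  have D: "open D" "0 \<in> D" using rd rd' by (auto simp: D_def)
  have inN: "z + \<zeta> *s v \<in> N" and inT: "dg z + \<zeta> *s dg v \<in> T'" if "\<zeta> \<in> D" for \<zeta>
    using that rd(1,4) rd'(1,4) by (auto simp: D_def)
  define \<alpha> where "\<alpha> j \<zeta> = a (z + \<zeta> *s v) $ j" for j \<zeta>
  define \<psi> where "\<psi> j \<zeta> = dir_deriv (join (axis j 1) 0) F (dg z + \<zeta> *s dg v)" for j \<zeta>
  have hE: "dir_deriv (join (axis j 1) 0) F hol_on T'" for j by (rule hol_on_dir_deriv[OF C(2,3)])
  have hol: "\<alpha> j holomorphic_on D" "\<psi> j holomorphic_on D" for j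
    unfolding \<alpha>_def \<psi>_def
    using hol_on_line_holomorphic[OF holomorphic_map_on_component(1)[OF a] inN]
      hol_on_line_holomorphic[OF hE inT] by blast+
  have der: "(deriv ^^ i) (\<psi> j) 0 = dir_deriv (join (axis j 1) 0) (Fi i) (dg z)" for i j
    using higher_deriv_line[OF C(2) hE, of "dg z" 0 "dg v" i j] zT
    unfolding \<psi>_def Fi_def by (simp add: dir_deriv_funpow_commute[OF C(2,3) zT])
  have low0: "(deriv ^^ i) (\<psi> j) 0 = 0" if "i < m" for i j
    unfolding der using prp[of i] vanFi[of "Suc i" z] that z by simp
  have zero: "(\<Sum>j\<in>UNIV. \<alpha> j \<zeta> * \<psi> j \<zeta>) = 0" if "\<zeta> \<in> D" for \<zeta>
  proof -
    have i: "inl (dg z + \<zeta> *s dg v) = z + \<zeta> *s v" by (simp add: inl_add inl_smult)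
    have "0 = dir_deriv (join (a (z + \<zeta> *s v)) 0) F (dg z + \<zeta> *s dg v)"
      using ann[OF inT[OF that]] inN[OF that] by (simp add: i)
    also have "\<dots> = (\<Sum>j\<in>UNIV. \<alpha> j \<zeta> * \<psi> j \<zeta>)"
      unfolding join_sum_axis(1)[of "a (z + \<zeta> *s v)"] \<alpha>_def \<psi>_def
      by (simp add: dir_deriv_sum[OF C(3) inT[OF that]] dir_deriv_smult[OF C(3) inT[OF that]])
    finally show ?thesis by simp
  qed
  have "(deriv ^^ m) (\<lambda>w. \<Sum>j\<in>UNIV. \<alpha> j w * \<psi> j w) 0 = (deriv ^^ m) (\<lambda>w. 0) 0"
    by (rule higher_deriv_transform_within_open[OF _ _ D]) (use hol zero in \<open>auto intro!: holomorphic_intros\<close>)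
  also have "(deriv ^^ m) (\<lambda>w. 0) = (\<lambda>w. 0 :: complex)" by (induction m) auto
  finally have "(\<Sum>j\<in>UNIV. \<alpha> j 0 * (deriv ^^ m) (\<psi> j) 0) = 0"
    using holomorphic_on_sum_mult_higher_deriv[OF _ D, of UNIV \<alpha> \<psi> m] hol low0 by simp
  then have "dir_deriv (join (a z) 0) (Fi m) (dg z) = 0"
    unfolding join_sum_axis(1)[of "a z"] der \<alpha>_def
    by (simp add: dir_deriv_sum[OF hFi zT] dir_deriv_smult[OF hFi zT])
  then have "dir_deriv (join (a z) 0) R (dg z) = 0"
    using prp[of m "a z"] top v by (simp add: Fi_def)
  then show ?thesis using holomorphic_tangent_space_complexified[OF complexified zW] by blast
qed

text \<open>Minimality of the kernel dimension at q is what lets \<open>kernel_field\<close> act at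
  all points of M near q. \<open>holomorphic_vanishing\<close> then carries dH a = 0 from M to an
  open set, as is required before the relation can be differentiated off M. The field has no zeros,
  so each of its germs is nontrivial.\<close>

lemma exists_injective_point:
  assumes ra: "\<rho> real_analytic_on W"
    and nondeg: "holomorphically_nondegenerate M"
    and N: "open N" "N \<subseteq> W" "q0 \<in> M \<inter> N"
    and H: "H holomorphic_map_on N" "H ` N \<subseteq> W'" and C': "complexifies R' T' f' W'"
    and van: "\<And>z. z \<in> M \<inter> N \<Longrightarrow> f' (H z) = 0"
    and nz: "\<And>q. q \<in> M \<inter> N \<Longrightarrow> \<not> (\<forall>\<^sub>F z in nhds q. f' (H z) = 0)"
  shows "\<exists>q\<in>M \<inter> N. \<forall>u. dir_deriv u H q = 0 \<longrightarrow> u = 0"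
proof (rule ccontr)
  assume "\<not> ?thesis"
  then have sing: "\<exists>u. dir_deriv u H q = 0 \<and> u \<noteq> 0" if "q \<in> M \<inter> N" for q using that by blast
  define k where "k z = vec.dim {u. dir_deriv u H z = 0}" for z
  obtain q where q: "q \<in> M \<inter> N" "\<And>z. z \<in> M \<inter> N \<Longrightarrow> k q \<le> k z"
    using ex_has_least_nat[of "\<lambda>z. z \<in> M \<inter> N" q0 k] N(3) by blast
  obtain u0 where u0: "dir_deriv u0 H q = 0" "u0 \<noteq> 0" using sing[OF q(1)] by blast
  have qN: "q \<in> N" and qW: "q \<in> W" using q N by auto
  obtain N1 a where N1: "open N1" "q \<in> N1" "N1 \<subseteq> N" "a holomorphic_map_on N1"
      and a0: "\<And>z. z \<in> N1 \<Longrightarrow> a z \<noteq> 0"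
      and aker: "\<And>z. z \<in> N1 \<Longrightarrow> k q \<le> k z \<Longrightarrow> dir_deriv (a z) H z = 0"
    using kernel_field[OF H(1) N(1) qN u0] unfolding k_def by metis
  have H1: "H holomorphic_map_on N1" by (rule holomorphic_map_on_subset[OF H(1) N1(3)])
  have comp: "\<forall>\<^sub>F z in nhds q. dir_deriv (a z) H z $ l = 0" for l
  proof (rule holomorphic_vanishing[OF _ N1(1)])
    have hl: "dir_deriv (axis j 1) (\<lambda>z. H z $ l) hol_on N1" for j
      by (rule hol_on_dir_deriv[OF N1(1) holomorphic_map_on_component(1)[OF H1]])
    have eq: "(\<Sum>j\<in>UNIV. a z $ j * dir_deriv (axis j 1) (\<lambda>z. H z $ l) z) = dir_deriv (a z) H z $ l" if "z \<in> N1" for z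
    proof -
      have "dir_deriv (a z) (\<lambda>z. H z $ l) z = dir_deriv (\<Sum>j\<in>UNIV. a z $ j *s axis j 1) (\<lambda>z. H z $ l) z"
        using vec_eq_sum_axis[of "a z"] by (rule arg_cong)
      then show ?thesis
        using holomorphic_map_on_component(2)[OF H1 that, of "a z" l]
        by (simp add: dir_deriv_sum[OF holomorphic_map_on_component(1)[OF H1] that]
            dir_deriv_smult[OF holomorphic_map_on_component(1)[OF H1] that])
    qed
    show "(\<lambda>z. dir_deriv (a z) H z $ l) hol_on N1"
      by (rule hol_on_cong[OF N1(1) eq], assumption)
        (intro hol_on_sum hol_on_mult hl holomorphic_map_on_component(1)[OF N1(4)])
  qed (use N1 N q aker in auto)
  have "\<forall>\<^sub>F z in nhds q. \<forall>l. dir_deriv (a z) H z $ l = 0"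
    using comp by (rule eventually_all_finite)
  then obtain N2' where N2': "open N2'" "q \<in> N2'" "\<And>z. z \<in> N2' \<Longrightarrow> dir_deriv (a z) H z = 0"
    unfolding eventually_nhds by (auto simp: vec_eq_iff)
  obtain v where v: "dir_deriv (dg v) R (dg q) \<noteq> 0" using nondegenerate[OF qW] by blast
  define N2 where "N2 = N1 \<inter> N2' \<inter> {z \<in> W. dir_deriv (dg v) R (dg z) \<noteq> 0}"
  have opv: "open {z \<in> W. dir_deriv (dg v) R (dg z) \<noteq> 0}"
  proof -
    have "continuous_on W (\<lambda>z. dir_deriv (dg v) R (dg z))"
      by (rule continuous_on_compose2[OF hol_on_imp_continuous_on[OF hol_on_dir_deriv[OF chart(2,3)]]])
        (auto intro!: continuous_intros chart(4))
    from continuous_open_preimage[OF this chart(1), of "- {0}"]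
    show ?thesis by (simp add: vimage_def Int_def open_Compl)
  qed
  have N2: "open N2" "q \<in> N2" "N2 \<subseteq> N1" "N2 \<subseteq> N" "N2 \<subseteq> W"
    using N1 N2' opv v qW N unfolding N2_def by auto
  have H2: "H holomorphic_map_on N2" "H ` N2 \<subseteq> W'"
    using holomorphic_map_on_subset[OF H1 N2(3)] H(2) N2(4) by auto
  obtain F TT where F: "complexifies F TT (\<lambda>z. f' (H z)) N2"
    and Fj: "\<And>y u. y \<in> TT \<Longrightarrow> inl y \<in> N2 \<and> dir_deriv (join u 0) F y = dir_deriv (join (dir_deriv u H (inl y)) 0) R' (cx_map H y)"
    and FT: "\<And>y. y \<in> TT \<Longrightarrow> cx_map H y \<in> T'"
    by (rule complexifies_compose[OF H2(1) N2(1) C' H2(2)]) blast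
  note CF = complexifiesD[OF F]
  have "\<exists>n. \<exists>z\<in>M \<inter> N2. (dir_deriv (dg v) ^^ n) F (dg z) \<noteq> 0"
    by (rule normal_order[OF F N2(5) _ v]) (use q N2 nz in auto)
  then obtain n where n: "\<exists>z\<in>M \<inter> N2. (dir_deriv (dg v) ^^ n) F (dg z) \<noteq> 0"
      "\<And>i. i < n \<Longrightarrow> \<not> (\<exists>z\<in>M \<inter> N2. (dir_deriv (dg v) ^^ i) F (dg z) \<noteq> 0)"
    using exists_least_iff[of "\<lambda>n. \<exists>z\<in>M \<inter> N2. (dir_deriv (dg v) ^^ n) F (dg z) \<noteq> 0"] by blast
  \<comment> \<open>The composed function vanishes on M itself, so the least order is at least 1 and
    has a predecessor m.\<close>
  have "n \<noteq> 0"
  proof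
    assume "n = 0"
    then obtain z where z: "z \<in> M \<inter> N2" "F (dg z) \<noteq> 0" using n(1) by auto
    then show False using CF(5)[of z] van[of z] N2(4) by auto
  qed
  then obtain m where m: "n = Suc m" using not0_implies_Suc by blast
  obtain q2 where q2: "q2 \<in> M \<inter> N2" "(dir_deriv (dg v) ^^ n) F (dg q2) \<noteq> 0" using n(1) by blast
  \<comment> \<open>Tangency is available only where the n-th normal derivative is nonzero. This
    open set around q2 becomes the domain of the restricted defining function, because tangency has
    to hold at all points of M in that domain.\<close>
  define N3 where "N3 = {z \<in> N2. (dir_deriv (dg v) ^^ n) F (dg z) \<noteq> 0}"
  have opN3: "open N3"
  proof -
    have "continuous_on N2 (\<lambda>z. (dir_deriv (dg v) ^^ n) F (dg z))"
      by (rule continuous_on_compose2[OF hol_on_imp_continuous_on[OF hol_on_dir_deriv_funpow[OF CF(2,3)]]])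
        (auto intro!: continuous_intros CF(4))
    from continuous_open_preimage[OF this N2(1), of "- {0}"]
    show ?thesis by (simp add: N3_def vimage_def Int_def open_Compl)
  qed
  have N3: "N3 \<subseteq> N2" "q2 \<in> N3" using q2 by (auto simp: N3_def)
  have a2: "a holomorphic_map_on N2" by (rule holomorphic_map_on_subset[OF N1(4) N2(3)])
  have tan: "a z \<in> holomorphic_tangent_space \<rho> z" if z: "z \<in> M \<inter> N3" for z
  proof (rule kernel_field_tangent[OF F N2(5) a2, where v = v and m = m])
    show "dir_deriv (join (a (inl y)) 0) F y = 0" if y: "y \<in> TT" "inl y \<in> N2" for y
    proof -
      have "dir_deriv (a (inl y)) H (inl y) = 0" using y(2) N2'(3) by (auto simp: N2_def)
      moreover have "dir_deriv (join 0 0) R' (cx_map H y) = 0"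
        using dir_deriv_0[OF complexifiesD(3)[OF C'] FT[OF y(1)]] by (simp add: join_0)
      ultimately show ?thesis using Fj[OF y(1), of "a (inl y)"] by simp
    qed
  next
    show "(dir_deriv (dg v) ^^ i) F (dg x) = 0" if "i \<le> m" "x \<in> M \<inter> N2" for i x
      using n(2)[of i] that m by auto
  qed (use z N3 m in \<open>auto simp: N3_def N2_def\<close>)
  have "local_defining_function M q2 N3 \<rho>"
    unfolding local_defining_function_def
  proof (intro conjI ballI)
    show "\<rho> real_analytic_on N3" using ra N3 N2 unfolding real_analytic_on_def by blast
    show "M \<inter> N3 = {z \<in> N3. \<rho> z = 0}" using zero_set N3 N2 by auto
    fix z assume "z \<in> N3"
    then have zW: "z \<in> W" and "dir_deriv (dg v) R (dg z) \<noteq> 0" using N3 by (auto simp: N2_def)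
    then have "Re (dir_deriv (dg v) R (dg z)) \<noteq> 0" using chart_Re[OF zW, of v] by auto
    then show "frechet_derivative \<rho> (at z) \<noteq> (\<lambda>v. 0)"
      using frechet_derivative_at[OF chart_has_derivative[OF zW]] by metis
  qed (use opN3 N3 in auto)
  moreover have "a holomorphic_map_on N3" by (rule holomorphic_map_on_subset[OF a2 N3(1)])
  moreover have "\<not> (\<forall>\<^sub>F z in nhds q2. a z = 0)"
    using a0[of q2] N3 N2 eventually_nhds_x_imp_x[of "\<lambda>z. a z = 0" q2] by blast
  moreover have "q2 \<in> M" using q2 by simp
  ultimately show False using nondeg tan unfolding holomorphically_nondegenerate_def by blast
qed

end

subsection \<open>Signature of a hermitian form\<close>

definition ip :: "complex ^ 'n \<Rightarrow> complex ^ 'n \<Rightarrow> complex" where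
  "ip u v = (\<Sum>j\<in>UNIV. u $ j * cnj (v $ j))"

lemma ip_self: "ip u u = of_real ((norm u)\<^sup>2)"
proof -
  have "ip u u = of_real (\<Sum>j\<in>UNIV. (norm (u $ j))\<^sup>2)"
    by (simp add: ip_def complex_norm_square[symmetric] del: of_real_power)
  also have "(\<Sum>j\<in>UNIV. (norm (u $ j))\<^sup>2) = (norm u)\<^sup>2"
    by (simp add: norm_vec_def L2_set_def sum_nonneg)
  finally show ?thesis .
qed

lemma Re_ip: "Re (ip u v) = u \<bullet> v"
  by (simp add: ip_def inner_vec_def inner_complex_def)

lemma real_subspace: "vec.subspace S \<Longrightarrow> subspace S" for S :: "(complex ^ 'n) set"
  unfolding subspace_def vec.subspace_def by (simp add: scaleR_eq_of_real_smult)

text \<open>The first-order condition at an extremum, used below for variations of the form on the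
  unit sphere.\<close>

lemma nonneg_quadratic_imp_linear_coeff_0:
  fixes b c :: real
  assumes "\<And>t. t * b + t\<^sup>2 * c \<ge> 0"
  shows "b = 0"
proof (rule ccontr)
  assume b: "b \<noteq> 0"
  define K where "K = \<bar>c\<bar> + 1"
  have K: "K > 0" "c \<le> K" by (auto simp: K_def)
  \<comment> \<open>With K positive and at least c, the linear term is - b\<twosuperior> / (2 K)
    while the quadratic term is at most b\<twosuperior> / (4 K), so the sum is negative.\<close>
  define t where "t = - b / (2 * K)"
  have t: "t * b = - (2 * (b\<^sup>2 / (4 * K)))" using K by (simp add: t_def power2_eq_square field_simps)
  have "t\<^sup>2 * c \<le> t\<^sup>2 * K" using K by (intro mult_left_mono) auto
  also have "\<dots> = b\<^sup>2 / (4 * K)" using K by (simp add: t_def power2_eq_square field_simps)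
  finally have "t * b + t\<^sup>2 * c \<le> - (b\<^sup>2 / (4 * K))" unfolding t by linarith
  moreover have "b\<^sup>2 / (4 * K) > 0" using b K by simp
  ultimately show False using assms[of t] by linarith
qed

text \<open>The form lives on the whole space and T is the subspace to which it is restricted, as
  with the Levi form, whose formula makes sense for all vectors.\<close>

locale hermitian_form =
  fixes T :: "(complex ^ 'n) set" and h :: "complex ^ 'n \<Rightarrow> complex ^ 'n \<Rightarrow> complex"
  assumes subspace_T: "vec.subspace T"
    and add: "h (u + v) w = h u w + h v w"
    and smult: "h (c *s u) w = c * h u w"
    and herm: "h u v = cnj (h v u)"
begin

lemma zero: "h 0 w = 0" using smult[of 0 0 w] by simp

lemma add_right: "h w (u + v) = h w u + h w v"
  using add[of u v w] by (metis herm complex_cnj_add)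

lemma smult_right: "h w (c *s u) = cnj c * h w u"
  using smult[of c u w] by (metis herm complex_cnj_mult)

lemma zero_right: "h w 0 = 0" using zero by (metis herm complex_cnj_zero)

lemma sum: "h (\<Sum>a\<in>A. f a) w = (\<Sum>a\<in>A. h (f a) w)"
  by (induction A rule: infinite_finite_induct) (auto simp: zero add)

lemma sum_right: "h w (\<Sum>a\<in>A. f a) = (\<Sum>a\<in>A. h w (f a))"
  by (induction A rule: infinite_finite_induct) (auto simp: zero_right add_right)

lemma diagonal: "Re (h (u + of_real t *s v) (u + of_real t *s v)) =
    Re (h u u) + t * (2 * Re (h u v)) + t\<^sup>2 * Re (h v v)"
proof -
  have "Re (h v u) = Re (h u v)" using herm[of v u] by simp
  then show ?thesis by (simp add: add add_right smult smult_right power2_eq_square algebra_simps)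
qed

lemma continuous_diagonal: "continuous_on A (\<lambda>u. h u u)"
proof -
  have eq: "h u u = (\<Sum>k\<in>UNIV. \<Sum>n\<in>UNIV. cnj (u $ k) * (u $ n * h (axis n 1) (axis k 1)))" for u
  proof -
    have "h u u = h (\<Sum>j\<in>UNIV. u $ j *s axis j 1) (\<Sum>k\<in>UNIV. u $ k *s axis k 1)"
      using vec_eq_sum_axis[of u] by (rule arg_cong2)  (rule vec_eq_sum_axis)
    then show ?thesis by (simp add: sum sum_right smult smult_right sum_distrib_left)
  qed
  show ?thesis unfolding eq by (intro continuous_intros)
qed

section \<open>Eigenspaces and diagonalisation\<close>

definition eigenspace :: "real \<Rightarrow> (complex ^ 'n) set" where
  "eigenspace l = {u \<in> T. \<forall>v\<in>T. h u v = of_real l * ip u v}"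

definition eigenvalues :: "real set" where
  "eigenvalues = {l. \<exists>u\<in>eigenspace l. u \<noteq> 0}"

text \<open>Taken over the eigenvalues of one sign, these are the subspaces on which the form is
  definite.\<close>

definition eigensum :: "real set \<Rightarrow> (complex ^ 'n) set" where
  "eigensum A = vec.span (\<Union>l\<in>A. eigenspace l)"

text \<open>The standard inner product obeys the same axioms, so its sesquilinearity and the
  expansion \<open>diagonal\<close> become available under the prefix \<open>ip\<close>.\<close>

sublocale ip: hermitian_form T ip
  by unfold_locales (auto simp: ip_def subspace_T sum.distrib algebra_simps sum_distrib_left)

lemma subspace_eigenspace: "vec.subspace (eigenspace l)"
  using subspace_T
  by (auto simp: eigenspace_def vec.subspace_def add smult ip.add ip.smult zero ip.zero distrib_left)

lemma eigenspace_orthogonal: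
  assumes "u \<in> eigenspace l" "v \<in> eigenspace l'" "l \<noteq> l'"
  shows "ip u v = 0" "h u v = 0"
proof -
  have 1: "h u v = of_real l * ip u v" using assms by (auto simp: eigenspace_def)
  have "h v u = of_real l' * ip v u" using assms by (auto simp: eigenspace_def)
  then have "h u v = of_real l' * ip u v" by (metis herm ip.herm complex_cnj_mult complex_cnj_complex_of_real)
  then have "(of_real l - of_real l') * ip u v = 0" using 1 by (simp add: algebra_simps)
  then show "ip u v = 0" using assms(3) by simp
  then show "h u v = 0" using 1 by simp
qed

lemma subspace_eigensum: "vec.subspace (eigensum A)"
  unfolding eigensum_def by (rule vec.subspace_span)

lemma eigensum_subset: "eigensum A \<subseteq> T"
  unfolding eigensum_def by (rule vec.span_minimal[OF _ subspace_T]) (auto simp: eigenspace_def)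

lemma eigensum_orthogonal:
  assumes "l \<notin> A" "u \<in> eigenspace l" "v \<in> eigensum A"
  shows "ip u v = 0"
proof -
  have "vec.subspace {v. ip u v = 0}"
    by (auto simp: vec.subspace_def ip.zero_right ip.add_right ip.smult_right)
  then have "eigensum A \<subseteq> {v. ip u v = 0}"
    unfolding eigensum_def by (rule vec.span_minimal[rotated]) (use assms eigenspace_orthogonal(1) in blast)
  then show ?thesis using assms(3) by blast
qed

lemma eigensum_insert: "eigensum (insert l A) = {x + y |x y. x \<in> eigenspace l \<and> y \<in> eigensum A}"
proof -
  have e: "vec.span (eigenspace l) = eigenspace l" using subspace_eigenspace vec.span_eq_iff by blast
  show ?thesis unfolding eigensum_def UN_insert vec.span_Un e by (rule refl)
qed

lemma dim_eigensum:
  assumes "finite A"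
  shows "vec.dim (eigensum A) = (\<Sum>l\<in>A. vec.dim (eigenspace l))"
  using assms
proof (induction A)
  case empty
  then show ?case by (simp add: eigensum_def)
next
  case (insert l A)
  have "x = 0" if "x \<in> eigenspace l" "x \<in> eigensum A" for x
    using eigensum_orthogonal[OF insert.hyps(2) that] by (simp add: ip_self)
  then have "eigenspace l \<inter> eigensum A \<subseteq> {0}" by blast
  then have "vec.dim (eigenspace l \<inter> eigensum A) = 0" by (simp only: vec.dim_eq_0)
  then have "vec.dim (eigensum (insert l A)) = vec.dim (eigenspace l) + vec.dim (eigensum A)"
    using vec.dim_sums_Int[OF subspace_eigenspace subspace_eigensum, of l A]
    unfolding eigensum_insert by linarith
  then show ?case using insert by simp
qed

lemma dim_eigenspace_pos: "l \<in> eigenvalues \<Longrightarrow> vec.dim (eigenspace l) > 0"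
  by (auto simp: eigenvalues_def vec.dim_eq_0 intro!: gr0I)

text \<open>Each eigenvalue adds at least one dimension to the direct sum of eigenspaces inside
  T.\<close>

lemma finite_eigenvalues: "finite eigenvalues"
proof (rule finite_if_finite_subsets_card_bdd[THEN conjunct1])
  fix A assume A: "A \<subseteq> eigenvalues" "finite A"
  have "card A \<le> (\<Sum>l\<in>A. vec.dim (eigenspace l))"
    using sum_mono[of A "\<lambda>_. 1" "\<lambda>l. vec.dim (eigenspace l)"] A dim_eigenspace_pos by (auto simp: Suc_le_eq)
  also have "\<dots> = vec.dim (eigensum A)" by (rule dim_eigensum[OF A(2), symmetric])
  also have "\<dots> \<le> vec.dim T" by (rule vec.dim_subset[OF eigensum_subset])
  finally show "card A \<le> vec.dim T" .
qed

lemma eigensum_decompose: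
  assumes "finite A" "u \<in> eigensum A"
  shows "\<exists>w. (\<forall>l\<in>A. w l \<in> eigenspace l) \<and> u = (\<Sum>l\<in>A. w l)"
  using assms
proof (induction A arbitrary: u)
  case empty
  then show ?case by (simp add: eigensum_def)
next
  case (insert l A)
  then obtain x y where xy: "x \<in> eigenspace l" "y \<in> eigensum A" "u = x + y"
    unfolding eigensum_insert by blast
  obtain w where w: "\<forall>l\<in>A. w l \<in> eigenspace l" "y = (\<Sum>l\<in>A. w l)" using insert.IH[OF xy(2)] by blast
  have "(\<Sum>k\<in>A. (w(l := x)) k) = (\<Sum>k\<in>A. w k)" using insert.hyps by (intro sum.cong) auto
  then show ?case
    using insert.hyps xy w by (intro exI[of _ "w(l := x)"]) auto
qed

text \<open>The weights are the squared norms of the eigencomponents of u; one of them is positive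
  because u \<noteq> 0. The sign statements below are read off from this.\<close>

lemma eigensum_diagonal:
  assumes "finite A" "u \<in> eigensum A" "u \<noteq> 0"
  obtains w where "Re (h u u) = (\<Sum>l\<in>A. l * w l)" "\<And>l. w l \<ge> (0::real)" "\<exists>l\<in>A. w l > 0"
proof -
  obtain x where x: "\<forall>l\<in>A. x l \<in> eigenspace l" "u = (\<Sum>l\<in>A. x l)"
    using eigensum_decompose[OF assms(1,2)] by blast
  have "h u u = (\<Sum>k\<in>A. \<Sum>l\<in>A. h (x l) (x k))" by (simp add: x(2) sum sum_right)
  also have "\<dots> = (\<Sum>k\<in>A. \<Sum>l\<in>A. if l = k then h (x k) (x k) else 0)"
    using x(1) eigenspace_orthogonal(2) by (intro sum.cong refl) metis
  also have "\<dots> = (\<Sum>k\<in>A. h (x k) (x k))" using assms(1) by simp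
  also have "\<dots> = (\<Sum>k\<in>A. of_real (k * (norm (x k))\<^sup>2))"
  proof (rule sum.cong[OF refl])
    fix k assume "k \<in> A"
    then have "x k \<in> eigenspace k" using x by blast
    then have "h (x k) (x k) = of_real k * ip (x k) (x k)" by (auto simp: eigenspace_def)
    then show "h (x k) (x k) = of_real (k * (norm (x k))\<^sup>2)" by (simp add: ip_self)
  qed
  finally have "Re (h u u) = (\<Sum>k\<in>A. k * (norm (x k))\<^sup>2)" by simp
  moreover have "\<exists>l\<in>A. x l \<noteq> 0" using assms(3) x(2) by (metis sum.neutral)
  ultimately show ?thesis using that[of "\<lambda>k. (norm (x k))\<^sup>2"] by auto
qed

lemma eigensum_positive:
  assumes "finite A" "u \<in> eigensum A" "u \<noteq> 0" "\<And>l. l \<in> A \<Longrightarrow> l > 0"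
  shows "Re (h u u) > 0"
proof -
  obtain w where w: "Re (h u u) = (\<Sum>l\<in>A. l * w l)" "\<And>l. w l \<ge> (0::real)" "\<exists>l\<in>A. w l > 0"
    using eigensum_diagonal[OF assms(1-3)] by blast
  obtain l where l: "l \<in> A" "w l > 0" using w(3) by blast
  show ?thesis unfolding w(1)
    by (rule sum_pos2[OF assms(1) l(1)]) (use assms(4) l w(2) in \<open>auto intro!: mult_nonneg_nonneg simp: less_imp_le\<close>)
qed

lemma eigensum_negative:
  assumes "finite A" "u \<in> eigensum A" "u \<noteq> 0" "\<And>l. l \<in> A \<Longrightarrow> l < 0"
  shows "Re (h u u) < 0"
proof -
  obtain w where w: "Re (h u u) = (\<Sum>l\<in>A. l * w l)" "\<And>l. w l \<ge> (0::real)" "\<exists>l\<in>A. w l > 0"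
    using eigensum_diagonal[OF assms(1-3)] by blast
  obtain l where l: "l \<in> A" "w l > 0" using w(3) by blast
  have "(\<Sum>l\<in>A. - l * w l) > 0"
    by (rule sum_pos2[OF assms(1) l(1)])
      (use assms(4) l w(2) in \<open>auto intro!: mult_nonpos_nonneg simp: less_imp_le mult_less_0_iff\<close>)
  then show ?thesis unfolding w(1) by (simp add: sum_negf)
qed

lemma eigensum_nonpos:
  assumes "finite A" "u \<in> eigensum A" "\<And>l. l \<in> A \<Longrightarrow> l \<le> 0"
  shows "Re (h u u) \<le> 0"
proof (cases "u = 0")
  case False
  obtain w where w: "Re (h u u) = (\<Sum>l\<in>A. l * w l)" "\<And>l. w l \<ge> (0::real)"
    using eigensum_diagonal[OF assms(1,2) False] by blast
  show ?thesis unfolding w(1) by (rule sum_nonpos) (use assms(3) w(2) in \<open>auto simp: mult_nonpos_nonneg\<close>)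
qed (simp add: zero)

lemma eigensum_nonneg:
  assumes "finite A" "u \<in> eigensum A" "\<And>l. l \<in> A \<Longrightarrow> l \<ge> 0"
  shows "Re (h u u) \<ge> 0"
proof (cases "u = 0")
  case False
  obtain w where w: "Re (h u u) = (\<Sum>l\<in>A. l * w l)" "\<And>l. w l \<ge> (0::real)"
    using eigensum_diagonal[OF assms(1,2) False] by blast
  show ?thesis unfolding w(1) by (rule sum_nonneg) (use assms(3) w(2) in auto)
qed (simp add: zero)

text \<open>Maximising the form on the unit sphere of the orthogonal complement of all eigenspaces
  would produce a further eigenvector.\<close>

theorem eigensum_eigenvalues: "eigensum eigenvalues = T"
proof (rule ccontr)
  assume neq: "eigensum eigenvalues \<noteq> T"
  define E where "E = eigensum eigenvalues"
  have sE: "vec.subspace E" unfolding E_def by (rule subspace_eigensum)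
  have ET: "E \<subseteq> T" unfolding E_def by (rule eigensum_subset)
  define C where "C = {u \<in> T. \<forall>e\<in>E. ip u e = 0}"
  have sC: "vec.subspace C"
    using subspace_T by (auto simp: C_def vec.subspace_def ip.add ip.smult ip.zero)
  have decomp: "\<exists>y\<in>E. v - y \<in> C" if "v \<in> T" for v
  proof -
    obtain y z where yz: "y \<in> span E" "\<And>w. w \<in> span E \<Longrightarrow> orthogonal z w" "v = y + z"
      using orthogonal_subspace_decomp_exists by blast
    have sp: "span E = E" using real_subspace[OF sE] by (simp add: span_eq_iff)
    have re: "Re (ip z w) = 0" if "w \<in> E" for w
      using yz(2)[of w] that sp by (simp add: Re_ip orthogonal_def)
    \<comment> \<open>Real orthogonality controls only the real part of \<open>ip\<close>; testing
      with i w as well gives the imaginary part.\<close>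
    have "ip z w = 0" if w: "w \<in> E" for w
    proof -
      have "\<i> *s w \<in> E" using sE w unfolding vec.subspace_def by blast
      then have "Re (ip z (\<i> *s w)) = 0" by (rule re)
      then have "Im (ip z w) = 0" by (simp add: ip.smult_right)
      then show ?thesis using re[OF w] by (simp add: complex_eq_iff)
    qed
    moreover have "z \<in> T" using vec.subspace_diff[OF subspace_T that] ET yz sp by (metis add_diff_cancel_left' subsetD)
    ultimately show ?thesis using yz sp by (intro bexI[of _ y]) (auto simp: C_def)
  qed
  obtain v0 where v0: "v0 \<in> T" "v0 \<notin> E" using neq ET E_def by blast
  then obtain y0 where y0: "y0 \<in> E" "v0 - y0 \<in> C" using decomp by blast
  define c0 where "c0 = v0 - y0"
  have c0: "c0 \<in> C" "c0 \<noteq> 0" using y0 v0 by (auto simp: c0_def)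
  define K where "K = C \<inter> sphere 0 1"
  have "compact K"
    unfolding K_def by (intro closed_Int_compact closed_subspace real_subspace sC compact_sphere)
  moreover have "c0 /\<^sub>R norm c0 \<in> K"
    using c0 subspace_scale[OF real_subspace[OF sC]] by (auto simp: K_def)
  moreover have "continuous_on K (\<lambda>u. Re (h u u))" by (intro continuous_intros continuous_diagonal)
  ultimately obtain u where u: "u \<in> K" "\<And>v. v \<in> K \<Longrightarrow> Re (h v v) \<le> Re (h u u)"
    using continuous_attains_sup[of K "\<lambda>u. Re (h u u)"] by blast
  define l where "l = Re (h u u)"
  have uC: "u \<in> C" "norm u = 1" using u by (auto simp: K_def)
  have le: "Re (h v v) \<le> l * (norm v)\<^sup>2" if "v \<in> C" for v
  proof (cases "v = 0")
    case False
    define w where "w = v /\<^sub>R norm v"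
    have "w \<in> K" using that False subspace_scale[OF real_subspace[OF sC]] by (auto simp: K_def w_def)
    then have "Re (h w w) \<le> l" using u(2) by (simp add: l_def)
    moreover have "Re (h w w) = Re (h v v) / (norm v)\<^sup>2"
      using False by (simp add: w_def scaleR_eq_of_real_smult smult smult_right power2_eq_square field_simps)
    ultimately show ?thesis using False by (simp add: field_simps)
  qed (simp add: zero)
  \<comment> \<open>First variation at the maximum: for all real t the form at u + t v is at most l
    times the squared norm. The constant terms agree, so the linear coefficient must vanish.\<close>
  have re: "Re (h u v) = l * Re (ip u v)" if v: "v \<in> C" for v
  proof -
    have "t * (2 * (l * Re (ip u v) - Re (h u v))) + t\<^sup>2 * (l * (norm v)\<^sup>2 - Re (h v v)) \<ge> 0" for t
    proof -
      have "u + of_real t *s v \<in> C" using sC uC(1) v unfolding vec.subspace_def by blast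
      from le[OF this] have "Re (h u u) + t * (2 * Re (h u v)) + t\<^sup>2 * Re (h v v) \<le>
          l * Re (ip (u + of_real t *s v) (u + of_real t *s v))"
        unfolding diagonal by (simp add: ip_self)
      then have "Re (h u u) + t * (2 * Re (h u v)) + t\<^sup>2 * Re (h v v) \<le>
          l * (Re (ip u u) + t * (2 * Re (ip u v)) + t\<^sup>2 * Re (ip v v))"
        unfolding ip.diagonal .
      then show ?thesis using uC(2) by (simp add: ip_self l_def algebra_simps)
    qed
    then have "2 * (l * Re (ip u v) - Re (h u v)) = 0" by (rule nonneg_quadratic_imp_linear_coeff_0)
    then show ?thesis by simp
  qed
  have eqC: "h u v = of_real l * ip u v" if v: "v \<in> C" for v
  proof -
    have "\<i> *s v \<in> C" using sC v unfolding vec.subspace_def by blast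
    from re[OF this] have "Im (h u v) = l * Im (ip u v)" by (simp add: smult_right ip.smult_right)
    then show ?thesis using re[OF v] by (simp add: complex_eq_iff)
  qed
  \<comment> \<open>An eigenvector e is orthogonal to u, so h e u is its eigenvalue times 0. Hence
    the eigenvector equation obtained on C holds against all of T.\<close>
  have eqE: "h u e = 0" if "e \<in> E" for e
  proof -
    have "vec.subspace {e. h u e = 0}" by (auto simp: vec.subspace_def zero_right add_right smult_right)
    then have "E \<subseteq> {e. h u e = 0}"
      unfolding E_def eigensum_def
    proof (rule vec.span_minimal[rotated])
      show "(\<Union>l\<in>eigenvalues. eigenspace l) \<subseteq> {e. h u e = 0}"
      proof safe
        fix l e assume le: "l \<in> eigenvalues" "e \<in> eigenspace l"
        then have "e \<in> E" unfolding E_def eigensum_def by (intro vec.span_base) auto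
        then have "ip e u = 0" using uC(1) ip.herm[of e u] by (auto simp: C_def)
        moreover have "h e u = of_real l * ip e u" using le uC(1) by (auto simp: eigenspace_def C_def)
        ultimately show "h u e = 0" using herm[of u e] by simp
      qed
    qed
    then show ?thesis using that by blast
  qed
  have "u \<in> eigenspace l"
    unfolding eigenspace_def
  proof (intro CollectI conjI ballI)
    show "u \<in> T" using uC(1) by (simp add: C_def)
    fix v assume "v \<in> T"
    then obtain y where y: "y \<in> E" "v - y \<in> C" using decomp by blast
    have "h u v = h u y + h u (v - y)" "ip u v = ip u y + ip u (v - y)"
      using add_right[of u y "v - y"] ip.add_right[of u y "v - y"] by simp_all
    then show "h u v = of_real l * ip u v"
      using eqC[OF y(2)] eqE[OF y(1)] uC(1) y(1) by (simp add: C_def)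
  qed
  moreover have "u \<noteq> 0" using uC(2) by auto
  ultimately have "l \<in> eigenvalues" by (auto simp: eigenvalues_def)
  then have "u \<in> E" using \<open>u \<in> eigenspace l\<close> unfolding E_def eigensum_def by (intro vec.span_base) auto
  then have "ip u u = 0" using uC(1) by (simp add: C_def)
  then show False using uC(2) by (simp add: ip_self)
qed

section \<open>Indices and dimension bounds\<close>

definition pos_index :: nat where "pos_index = (\<Sum>l\<in>{l \<in> eigenvalues. l > 0}. vec.dim (eigenspace l))"
definition neg_index :: nat where "neg_index = (\<Sum>l\<in>{l \<in> eigenvalues. l < 0}. vec.dim (eigenspace l))"
definition null_index :: nat where "null_index = vec.dim (eigenspace 0)"

text \<open>S and \<open>eigensum A\<close> meet only in 0, so their dimensions add up to at most
  that of T, which is the sum over A and B because the eigenspaces span T.\<close>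

lemma dim_le_complementary_eigenspaces:
  assumes S: "vec.subspace S" "S \<subseteq> T" and AB: "eigenvalues = A \<union> B" "A \<inter> B = {}"
    and int: "\<And>u. u \<in> S \<Longrightarrow> u \<in> eigensum A \<Longrightarrow> u = 0"
  shows "vec.dim S \<le> (\<Sum>l\<in>B. vec.dim (eigenspace l))"
proof -
  have fin: "finite A" "finite B" using finite_eigenvalues AB by auto
  have "vec.dim (S \<inter> eigensum A) = 0" unfolding vec.dim_eq_0 using int by blast
  then have "vec.dim S + vec.dim (eigensum A) = vec.dim {x + y |x y. x \<in> S \<and> y \<in> eigensum A}"
    using vec.dim_sums_Int[OF S(1) subspace_eigensum, of A] by linarith
  also have "\<dots> \<le> vec.dim T"
  proof (rule vec.dim_subset, safe)
    fix x y assume "x \<in> S" "y \<in> eigensum A"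
    then show "x + y \<in> T" using S(2) eigensum_subset[of A] by (intro vec.subspace_add[OF subspace_T]) auto
  qed
  also have "\<dots> = (\<Sum>l\<in>A. vec.dim (eigenspace l)) + (\<Sum>l\<in>B. vec.dim (eigenspace l))"
    using dim_eigensum[OF finite_eigenvalues] sum.union_disjoint[OF fin AB(2), of "\<lambda>l. vec.dim (eigenspace l)"]
    unfolding eigensum_eigenvalues AB(1)[symmetric] by simp
  finally show ?thesis using dim_eigensum[OF fin(1)] by simp
qed

lemma dim_le_pos_index:
  assumes "vec.subspace S" "S \<subseteq> T" "\<And>u. u \<in> S \<Longrightarrow> u \<noteq> 0 \<Longrightarrow> Re (h u u) > 0"
  shows "vec.dim S \<le> pos_index"
  unfolding pos_index_def
proof (rule dim_le_complementary_eigenspaces[OF assms(1,2), of "{l \<in> eigenvalues. l \<le> 0}"])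
  show "u = 0" if "u \<in> S" "u \<in> eigensum {l \<in> eigenvalues. l \<le> 0}" for u
  proof (rule ccontr)
    have "Re (h u u) \<le> 0"
      by (rule eigensum_nonpos[OF _ that(2)]) (use finite_eigenvalues in auto)
    moreover assume "u \<noteq> 0"
    ultimately show False using assms(3)[OF that(1)] by simp
  qed
qed auto

lemma dim_le_neg_index:
  assumes "vec.subspace S" "S \<subseteq> T" "\<And>u. u \<in> S \<Longrightarrow> u \<noteq> 0 \<Longrightarrow> Re (h u u) < 0"
  shows "vec.dim S \<le> neg_index"
  unfolding neg_index_def
proof (rule dim_le_complementary_eigenspaces[OF assms(1,2), of "{l \<in> eigenvalues. l \<ge> 0}"])
  show "u = 0" if "u \<in> S" "u \<in> eigensum {l \<in> eigenvalues. l \<ge> 0}" for u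
  proof (rule ccontr)
    have "Re (h u u) \<ge> 0"
      by (rule eigensum_nonneg[OF _ that(2)]) (use finite_eigenvalues in auto)
    moreover assume "u \<noteq> 0"
    ultimately show False using assms(3)[OF that(1)] by simp
  qed
qed auto

lemma null_sum: "(\<Sum>l\<in>{l \<in> eigenvalues. l = 0}. vec.dim (eigenspace l)) = null_index"
proof (cases "0 \<in> eigenvalues")
  case True
  then have "{l \<in> eigenvalues. l = 0} = {0}" by auto
  then show ?thesis by (simp add: null_index_def)
next
  case False
  then have e: "{l \<in> eigenvalues. l = 0} = {}" and "eigenspace 0 \<subseteq> {0}" by (auto simp: eigenvalues_def)
  then have "vec.dim (eigenspace 0) = 0" by (simp only: vec.dim_eq_0)
  then show ?thesis unfolding e null_index_def by simp
qed

text \<open>An isotropic subspace meets both the positive and the negative eigensum only in 0; each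
  of the two facts yields one half of the minimum.\<close>

lemma dim_le_isotropic:
  assumes S: "vec.subspace S" "S \<subseteq> T" and iso: "\<And>u. u \<in> S \<Longrightarrow> h u u = 0"
  shows "vec.dim S \<le> min pos_index neg_index + null_index"
proof -
  have split: "(\<Sum>l\<in>{l \<in> eigenvalues. l \<le> 0}. vec.dim (eigenspace l)) = neg_index + null_index"
  proof -
    have "{l \<in> eigenvalues. l \<le> 0} = {l \<in> eigenvalues. l < 0} \<union> {l \<in> eigenvalues. l = 0}" by auto
    then show ?thesis
      unfolding neg_index_def null_sum[symmetric]
      using finite_eigenvalues by (simp only:) (intro sum.union_disjoint, auto)
  qed
  have split': "(\<Sum>l\<in>{l \<in> eigenvalues. l \<ge> 0}. vec.dim (eigenspace l)) = pos_index + null_index"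
  proof -
    have "{l \<in> eigenvalues. l \<ge> 0} = {l \<in> eigenvalues. l > 0} \<union> {l \<in> eigenvalues. l = 0}" by auto
    then show ?thesis
      unfolding pos_index_def null_sum[symmetric]
      using finite_eigenvalues by (simp only:) (intro sum.union_disjoint, auto)
  qed
  have "vec.dim S \<le> (\<Sum>l\<in>{l \<in> eigenvalues. l \<le> 0}. vec.dim (eigenspace l))"
  proof (rule dim_le_complementary_eigenspaces[OF S, of "{l \<in> eigenvalues. l > 0}"])
    show "u = 0" if "u \<in> S" "u \<in> eigensum {l \<in> eigenvalues. l > 0}" for u
    proof (rule ccontr)
      assume "u \<noteq> 0"
      have "Re (h u u) > 0"
        by (rule eigensum_positive[OF _ that(2) \<open>u \<noteq> 0\<close>]) (use finite_eigenvalues in auto)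
      then show False using iso[OF that(1)] by simp
    qed
  qed auto
  moreover have "vec.dim S \<le> (\<Sum>l\<in>{l \<in> eigenvalues. l \<ge> 0}. vec.dim (eigenspace l))"
  proof (rule dim_le_complementary_eigenspaces[OF S, of "{l \<in> eigenvalues. l < 0}"])
    show "u = 0" if "u \<in> S" "u \<in> eigensum {l \<in> eigenvalues. l < 0}" for u
    proof (rule ccontr)
      assume "u \<noteq> 0"
      have "Re (h u u) < 0"
        by (rule eigensum_negative[OF _ that(2) \<open>u \<noteq> 0\<close>]) (use finite_eigenvalues in auto)
      then show False using iso[OF that(1)] by simp
    qed
  qed auto
  ultimately show ?thesis unfolding split split' by linarith
qed

lemma exists_positive_subspace:
  obtains S where "vec.subspace S" "S \<subseteq> T" "vec.dim S = pos_index" "\<And>u. u \<in> S \<Longrightarrow> u \<noteq> 0 \<Longrightarrow> Re (h u u) > 0"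
proof (rule that[of "eigensum {l \<in> eigenvalues. l > 0}"])
  show "vec.dim (eigensum {l \<in> eigenvalues. l > 0}) = pos_index"
    unfolding pos_index_def using finite_eigenvalues by (intro dim_eigensum) auto
  show "Re (h u u) > 0" if "u \<in> eigensum {l \<in> eigenvalues. l > 0}" "u \<noteq> 0" for u
    by (rule eigensum_positive[OF _ that]) (use finite_eigenvalues in auto)
qed (auto intro: subspace_eigensum subsetD[OF eigensum_subset])

lemma exists_negative_subspace:
  obtains S where "vec.subspace S" "S \<subseteq> T" "vec.dim S = neg_index" "\<And>u. u \<in> S \<Longrightarrow> u \<noteq> 0 \<Longrightarrow> Re (h u u) < 0"
proof (rule that[of "eigensum {l \<in> eigenvalues. l < 0}"])
  show "vec.dim (eigensum {l \<in> eigenvalues. l < 0}) = neg_index"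
    unfolding neg_index_def using finite_eigenvalues by (intro dim_eigensum) auto
  show "Re (h u u) < 0" if "u \<in> eigensum {l \<in> eigenvalues. l < 0}" "u \<noteq> 0" for u
    by (rule eigensum_negative[OF _ that]) (use finite_eigenvalues in auto)
qed (auto intro: subspace_eigensum subsetD[OF eigensum_subset])

end

subsection \<open>Indices of the Levi form\<close>

lemma hermitian_form_levi:
  assumes "complexifies F T (cx \<rho>) S" "p \<in> S"
  shows "hermitian_form (holomorphic_tangent_space \<rho> p) (levi_form \<rho> p)"
proof
  show "vec.subspace (holomorphic_tangent_space \<rho> p)"
    by (auto simp: vec.subspace_def holomorphic_tangent_space_def algebra_simps sum.distrib
        simp flip: sum_distrib_left mult.left_commute)
  show "levi_form \<rho> p u v = cnj (levi_form \<rho> p v u)" for u v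
    by (rule levi_form_hermitian[OF assms])
qed (auto simp: levi_form_def algebra_simps sum.distrib sum_distrib_left)

context
  fixes F :: "complex ^ ('n::finite + 'n) \<Rightarrow> complex" and T \<rho> S p
  assumes C: "complexifies F T (cx \<rho>) S" "p \<in> S"
begin

interpretation hermitian_form "holomorphic_tangent_space \<rho> p" "levi_form \<rho> p"
  by (rule hermitian_form_levi[OF C])

lemma levi_eigenspace_eq: "levi_eigenspace \<rho> p = eigenspace"
  by (rule ext) (simp add: levi_eigenspace_def eigenspace_def ip_def)

lemma levi_eigenvalues_eq: "levi_eigenvalues \<rho> p = eigenvalues"
  by (simp add: levi_eigenvalues_def eigenvalues_def levi_eigenspace_eq)

lemma levi_indices:
  "levi_pos \<rho> p = pos_index" "levi_neg \<rho> p = neg_index" "levi_zero \<rho> p = null_index"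
  by (simp_all add: levi_pos_def levi_neg_def levi_zero_def pos_index_def neg_index_def null_index_def
      levi_eigenspace_eq levi_eigenvalues_eq)

lemmas levi_dim_le_pos = dim_le_pos_index[folded levi_indices]
lemmas levi_dim_le_neg = dim_le_neg_index[folded levi_indices]
lemmas levi_dim_le_isotropic = dim_le_isotropic[folded levi_indices]
lemmas levi_exists_positive = exists_positive_subspace[folded levi_indices]
lemmas levi_exists_negative = exists_negative_subspace[folded levi_indices]

end

section \<open>Charts from defining functions and stability of the indices\<close>

lemma local_defining_function_chart:
  assumes "local_defining_function M p W \<rho>"
  obtains s R T where "s > 0" "ball p s \<subseteq> W" "hypersurface_chart M (ball p s) \<rho> R T" "\<rho> real_analytic_on ball p s"
proof -
  have W: "open W" "p \<in> W" "\<rho> real_analytic_on W" "\<And>z. z \<in> W \<Longrightarrow> frechet_derivative \<rho> (at z) \<noteq> (\<lambda>v. 0)"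
      "M \<inter> W = {z \<in> W. \<rho> z = 0}"
    using assms unfolding local_defining_function_def by blast+
  obtain R e s0 where R: "e > 0" "s0 > 0" "complexifies R (ball (dg p) e) (cx \<rho>) (ball p s0)"
    by (rule real_analytic_complexification[OF W(3,2)])
  obtain s1 where s1: "s1 > 0" "ball p s1 \<subseteq> W" using W openE by blast
  define s where "s = min s0 s1"
  have s: "s > 0" "ball p s \<subseteq> W" "ball p s \<subseteq> ball p s0" using R s1 by (auto simp: s_def)
  have C: "complexifies R (ball (dg p) e) (cx \<rho>) (ball p s)"
    by (rule complexifies_subset[OF R(3) _ s(3)]) simp
  have "hypersurface_chart M (ball p s) \<rho> R (ball (dg p) e)"
  proof
    show "complexifies R (ball (dg p) e) (cx \<rho>) (ball p s)" by (rule C)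
    show "M \<inter> ball p s = {z \<in> ball p s. \<rho> z = 0}" using W(5) s(2) by blast
    fix z assume z: "z \<in> ball p s"
    have "(\<rho> has_derivative (\<lambda>v. Re (dir_deriv (dg v) R (dg z)))) (at z)"
      using bounded_linear.has_derivative[OF bounded_linear_Re complexifies_has_derivative[OF C z]] by simp
    then have "frechet_derivative \<rho> (at z) = (\<lambda>v. Re (dir_deriv (dg v) R (dg z)))"
      using frechet_derivative_at by metis
    then show "\<exists>v. dir_deriv (dg v) R (dg z) \<noteq> 0"
      using W(4)[of z] z s(2) by (metis subsetD zero_complex.sel(1))
  qed
  moreover have "\<rho> real_analytic_on ball p s" using W(3) s(2) unfolding real_analytic_on_def by blast
  ultimately show ?thesis using that s by blast
qed

lemma some_defining_function:
  assumes "real_analytic_hypersurface M" "p \<in> M"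
  obtains W where "local_defining_function M p W (some_defining_function M p)"
proof -
  have "\<exists>\<rho> W. local_defining_function M p W \<rho>"
    using assms unfolding real_analytic_hypersurface_def by blast
  then have "\<exists>W. local_defining_function M p W (some_defining_function M p)"
    unfolding some_defining_function_def by (rule someI_ex)
  then show ?thesis using that by blast
qed

text \<open>Bounds the indices so that their supremum over M is a maximum.\<close>

lemma levi_e_le:
  fixes M :: "(complex ^ 'n) set"
  assumes "real_analytic_hypersurface M" "p \<in> M"
  shows "levi_e M p \<le> vec.dim (UNIV :: (complex ^ 'n) set)"
proof -
  obtain W where W: "local_defining_function M p W (some_defining_function M p)"
    by (rule some_defining_function[OF assms])
  obtain s R T where s: "s > 0" and chart: "hypersurface_chart M (ball p s) (some_defining_function M p) R T"
    by (rule local_defining_function_chart[OF W])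
  interpret hypersurface_chart M "ball p s" "some_defining_function M p" R T by (rule chart)
  obtain S :: "(complex ^ 'n) set" where S: "vec.dim S = levi_pos (some_defining_function M p) p"
    by (rule levi_exists_positive[OF complexified, of p]) (use s in auto)
  have "vec.dim S \<le> vec.dim (UNIV :: (complex ^ 'n) set)" by (rule vec.dim_subset) simp
  then show ?thesis using S by (simp add: levi_e_def)
qed

context hypersurface_chart
begin

text \<open>Lower semicontinuity of the indices; the sign \<sigma> treats e_+ and e_- together. S is
  moved into nearby tangent spaces by the projection \<open>P q\<close> along a fixed transversal
  v0. Definiteness on the unit sphere of S is an open condition on q by compactness, homogeneity
  extends it to S, and definiteness itself makes \<open>P q\<close> injective on S, so the dimension
  is kept.\<close>

lemma stable_definite:
  fixes \<sigma> :: real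
  assumes q0: "q0 \<in> W" and S: "vec.subspace S" "S \<subseteq> holomorphic_tangent_space \<rho> q0"
    and pos: "\<And>u. u \<in> S \<Longrightarrow> u \<noteq> 0 \<Longrightarrow> \<sigma> * Re (levi_form \<rho> q0 u u) > 0"
  shows "\<forall>\<^sub>F q in nhds q0. \<exists>S'. vec.subspace S' \<and> S' \<subseteq> holomorphic_tangent_space \<rho> q \<and> vec.dim S' = vec.dim S \<and>
     (\<forall>u\<in>S'. u \<noteq> 0 \<longrightarrow> \<sigma> * Re (levi_form \<rho> q u u) > 0)"
proof -
  define l where "l q u = dir_deriv (join u 0) R (dg q)" for q u
  have tan: "u \<in> holomorphic_tangent_space \<rho> q \<longleftrightarrow> l q u = 0" if "q \<in> W" for q u
    unfolding l_def by (rule holomorphic_tangent_space_complexified[OF complexified that])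
  \<comment> \<open>Otherwise every vector would be complex tangent, and the full real differential
    of \<rho> would vanish at q0.\<close>
  have "\<exists>v0. l q0 v0 \<noteq> 0"
  proof (rule ccontr)
    assume "\<not> ?thesis"
    then have "\<And>u. u \<in> holomorphic_tangent_space \<rho> q0" using tan[OF q0] by blast
    then show False using tangent_space_real(1)[OF q0] nondegenerate[OF q0] by blast
  qed
  then obtain v0 where v0: "l q0 v0 \<noteq> 0" by blast
  have l_expand: "l q u = (\<Sum>j\<in>UNIV. u $ j * l q (axis j 1))" if "q \<in> W" for q u
    unfolding l_def join_sum_axis(1)[of u]
    by (simp add: dir_deriv_sum[OF chart(3) chart(4)[OF that]] dir_deriv_smult[OF chart(3) chart(4)[OF that]])
  have l_linear: "l q (x + y) = l q x + l q y" "l q (c *s x) = c * l q x" if "q \<in> W" for q x y c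
    using l_expand[OF that, of "x + y"] l_expand[OF that, of x] l_expand[OF that, of y] l_expand[OF that, of "c *s x"]
    by (simp_all add: algebra_simps sum.distrib sum_distrib_left)
  have cont_l: "continuous_on W (\<lambda>q. l q u)" for u
    unfolding l_def
    by (rule continuous_on_compose2[OF hol_on_imp_continuous_on[OF hol_on_dir_deriv[OF chart(2,3)]]])
      (auto intro!: continuous_intros chart(4))
  define L where "L q j k = levi_form \<rho> q (axis j 1) (axis k 1)" for q j k
  have cont_L: "continuous_on W (\<lambda>q. L q j k)" for j k
  proof -
    have "continuous_on W (\<lambda>q. dir_deriv (join 0 (cnjv (axis k 1))) (dir_deriv (join (axis j 1) 0) R) (dg q))"
      by (rule continuous_on_compose2[OF hol_on_imp_continuous_on[OF hol_on_dir_deriv[OF chart(2) hol_on_dir_deriv[OF chart(2,3)]]]])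
        (auto intro!: continuous_intros chart(4))
    then show ?thesis
      by (rule continuous_on_cong[THEN iffD1, rotated 2])
        (auto simp: L_def levi_form_complexified[OF complexified])
  qed
  have L_expand: "levi_form \<rho> q u u = (\<Sum>k\<in>UNIV. \<Sum>j\<in>UNIV. cnj (u $ k) * (u $ j * L q j k))" if "q \<in> W" for q u
  proof -
    interpret h: hermitian_form "holomorphic_tangent_space \<rho> q" "levi_form \<rho> q"
      by (rule hermitian_form_levi[OF complexified that])
    have "levi_form \<rho> q u u = levi_form \<rho> q (\<Sum>j\<in>UNIV. u $ j *s axis j 1) (\<Sum>k\<in>UNIV. u $ k *s axis k 1)"
      using vec_eq_sum_axis[of u] by (rule arg_cong2) (rule vec_eq_sum_axis)
    then show ?thesis by (simp add: h.sum h.sum_right h.smult h.smult_right sum_distrib_left L_def)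
  qed
  define N where "N = {q \<in> W. l q v0 \<noteq> 0}"
  have N: "open N" "q0 \<in> N" "N \<subseteq> W"
    using continuous_open_preimage[OF cont_l chart(1), of "- {0}" v0] q0 v0
    by (auto simp: N_def vimage_def Int_def open_Compl)
  define P where "P q u = u - (l q u / l q v0) *s v0" for q u
  define g where "g = (\<lambda>(q, u). \<sigma> * Re (levi_form \<rho> q (P q u) (P q u)))"
  have P_nth: "P q u $ j = u $ j - (\<Sum>i\<in>UNIV. u $ i * l q (axis i 1)) / l q v0 * v0 $ j" if "q \<in> W" for q u j
    using l_expand[OF that, of u] by (simp add: P_def)
  have cont_fst: "continuous_on (N \<times> UNIV) (\<lambda>x. f (fst x))" if "continuous_on W f"
    for f :: "complex ^ 'n \<Rightarrow> complex"
    by (rule continuous_on_compose2[OF that]) (use N in \<open>auto intro!: continuous_intros\<close>)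
  have cont_P: "continuous_on (N \<times> UNIV) (\<lambda>x. P (fst x) (snd x) $ j)" for j
  proof -
    have "continuous_on (N \<times> UNIV) (\<lambda>x. snd x $ j - (\<Sum>i\<in>UNIV. snd x $ i * l (fst x) (axis i 1)) / l (fst x) v0 * v0 $ j)"
      by (intro continuous_intros cont_fst[OF cont_l]) (auto simp: N_def)
    then show ?thesis
      by (rule continuous_on_cong[THEN iffD1, rotated 2]) (use N in \<open>auto simp: P_nth\<close>)
  qed
  have cont_g: "continuous_on (N \<times> UNIV) g"
  proof -
    have "continuous_on (N \<times> UNIV) (\<lambda>x. \<sigma> * Re (\<Sum>k\<in>UNIV. \<Sum>j\<in>UNIV.
        cnj (P (fst x) (snd x) $ k) * (P (fst x) (snd x) $ j * L (fst x) j k)))"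
      by (intro continuous_intros cont_fst[OF cont_L] cont_P)
    then show ?thesis
      by (rule continuous_on_cong[THEN iffD1, rotated 2]) (use N in \<open>auto simp: g_def L_expand\<close>)
  qed
  define K where "K = S \<inter> sphere 0 1"
  have K: "compact K"
    unfolding K_def by (intro closed_Int_compact closed_subspace real_subspace S compact_sphere)
  define O' where "O' = (N \<times> UNIV) \<inter> g -` {0<..}"
  have "open O'"
    unfolding O'_def by (rule continuous_open_preimage[OF cont_g open_Times[OF N(1) open_UNIV]]) simp
  moreover have "{q0} \<times> K \<subseteq> O'"
  proof -
    have "g (q0, u) > 0" if "u \<in> K" for u
    proof -
      have "u \<in> S" "u \<noteq> 0" using that by (auto simp: K_def)
      moreover from this have "P q0 u = u" using S(2) tan[OF q0, of u] by (auto simp: P_def)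
      ultimately show ?thesis using pos by (simp add: g_def)
    qed
    then show ?thesis using N by (auto simp: O'_def)
  qed
  ultimately obtain X where X: "open X" "q0 \<in> X" "X \<times> K \<subseteq> O'"
    using tube_lemma_right[of euclidean euclidean O' K q0] K
    by (auto simp: compactin_euclidean_iff) blast
  have "\<forall>\<^sub>F q in nhds q0. q \<in> X \<inter> N" using X N by (intro eventually_nhds_in_open) auto
  then show ?thesis
  proof eventually_elim
    case (elim q)
    then have qW: "q \<in> W" and qN: "l q v0 \<noteq> 0" using N by (auto simp: N_def)
    interpret h: hermitian_form "holomorphic_tangent_space \<rho> q" "levi_form \<rho> q"
      by (rule hermitian_form_levi[OF complexified qW])
    have linP: "Vector_Spaces.linear (*s) (*s) (P q)"
      by unfold_locales
        (auto simp: P_def l_linear[OF qW] vec_eq_iff algebra_simps add_divide_distrib)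
    have gpos: "\<sigma> * Re (levi_form \<rho> q (P q u) (P q u)) > 0" if u: "u \<in> S" "u \<noteq> 0" for u
    proof -
      define w where "w = complex_of_real (1 / norm u) *s u"
      have "w \<in> K"
        using u S(1) by (auto simp: K_def w_def norm_vector_scalar_mult norm_divide vec.subspace_def)
      then have "(q, w) \<in> O'" using X(3) elim by auto
      then have "\<sigma> * Re (levi_form \<rho> q (P q w) (P q w)) > 0" by (simp add: O'_def g_def)
      moreover have "P q w = complex_of_real (1 / norm u) *s P q u"
        unfolding w_def by (rule vec.linear_scale[OF linP])
      ultimately have "\<sigma> * ((1 / norm u) * (1 / norm u) * Re (levi_form \<rho> q (P q u) (P q u))) > 0"
        by (simp add: h.smult h.smult_right)
      then have "(1 / norm u)\<^sup>2 * (\<sigma> * Re (levi_form \<rho> q (P q u) (P q u))) > 0"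
        by (simp only: power2_eq_square mult_ac)
      then show ?thesis by (simp add: zero_less_mult_iff)
    qed
    have inj: "inj_on (P q) (vec.span S)"
    proof (rule inj_onI)
      fix x y assume xy: "x \<in> vec.span S" "y \<in> vec.span S" "P q x = P q y"
      have sp: "vec.span S = S" using S(1) vec.span_eq_iff by blast
      have "x - y \<in> S" using xy sp vec.subspace_diff[OF S(1)] by auto
      moreover have "P q (x - y) = 0" using xy by (simp add: vec.linear_diff[OF linP])
      ultimately show "x = y" using gpos[of "x - y"] by (auto simp: h.zero)
    qed
    show ?case
    proof (intro exI[of _ "P q ` S"] conjI)
      show "vec.subspace (P q ` S)" by (rule vec.linear_subspace_image[OF linP S(1)])
      show "vec.dim (P q ` S) = vec.dim S" by (rule vec.dim_image_eq[OF linP inj])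
      have "l q (P q u) = 0" for u
        using qN l_linear(1)[OF qW, of u "- (l q u / l q v0) *s v0"] l_linear(2)[OF qW, of "- (l q u / l q v0)" v0]
        by (simp add: P_def vec.scale_minus_left)
      then show "P q ` S \<subseteq> holomorphic_tangent_space \<rho> q" using tan[OF qW] by blast
      show "\<forall>u\<in>P q ` S. u \<noteq> 0 \<longrightarrow> \<sigma> * Re (levi_form \<rho> q u u) > 0"
        using gpos vec.linear_0[OF linP] by (metis imageE)
    qed
  qed
qed

end

subsection \<open>The mapping theorem\<close>

text \<open>On the complex line through \<open>dg p\<close> and \<open>dg z\<close>, small positive
  real parameters give points of the totally real set near \<open>dg p\<close>, where F vanishes.
  The ball makes the slice of the domain convex, so the identity theorem reaches the parameter 1,
  that is \<open>dg z\<close>.\<close>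

lemma complexified_zero_continuation:
  assumes C: "complexifies F T f S" "dg ` B \<subseteq> ball y e" "ball y e \<subseteq> T" "B \<subseteq> S"
    and p: "p \<in> B" "\<forall>\<^sub>F z in nhds p. f z = 0" and z: "z \<in> B"
  shows "f z = 0"
proof -
  note CC = complexifiesD[OF C(1)]
  define w where "w = z - p"
  define D where "D = {\<zeta>. dg p + \<zeta> *s dg w \<in> ball y e}"
  have openD: "open D" unfolding D_def by (rule open_line_preimage) simp
  have "convex D"
  proof (rule convexI)
    fix a b :: complex and u v :: real
    assume ab: "a \<in> D" "b \<in> D" and uv: "0 \<le> u" "0 \<le> v" "u + v = 1"
    have "dg p + (u *\<^sub>R a + v *\<^sub>R b) *s dg w = u *\<^sub>R (dg p + a *s dg w) + v *\<^sub>R (dg p + b *s dg w)"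
    proof -
      have "dg p = u *\<^sub>R dg p + v *\<^sub>R dg p" using uv(3) by (simp flip: scaleR_left_distrib)
      then show ?thesis
        by (simp add: scaleR_eq_of_real_smult vec.scale_right_distrib vec.scale_left_distrib scaleR_conv_of_real)
    qed
    also have "\<dots> \<in> ball y e"
      using ab uv convexD[OF convex_ball] by (simp only: D_def mem_Collect_eq)
    finally show "u *\<^sub>R a + v *\<^sub>R b \<in> D" by (simp add: D_def)
  qed
  then have conn: "connected D" by (rule convex_connected)
  have hol: "(\<lambda>\<zeta>. F (dg p + \<zeta> *s dg w)) holomorphic_on D"
    by (rule hol_on_line_holomorphic[OF CC(3)]) (use C(3) in \<open>auto simp: D_def\<close>)
  have D01: "0 \<in> D" "1 \<in> D"
  proof -
    have "dg p + 1 *s dg w = dg z" by (simp add: w_def dg_diff)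
    then show "0 \<in> D" "1 \<in> D" using C(2) p(1) z unfolding D_def by auto
  qed
  define Z where "Z = {\<zeta> \<in> D. F (dg p + \<zeta> *s dg w) = 0}"
  have lim0: "0 islimpt Z"
    unfolding islimpt_approachable
  proof (intro allI impI)
    fix \<epsilon> :: real assume \<epsilon>: "\<epsilon> > 0"
    have "((\<lambda>t::real. p + complex_of_real t *s w) \<longlongrightarrow> p + complex_of_real 0 *s w) (at_right 0)"
      by (intro tendsto_intros bounded_linear.tendsto[OF bounded_linear_smult_left])
    then have lim: "filterlim (\<lambda>t::real. p + complex_of_real t *s w) (nhds p) (at_right 0)" by simp
    have "\<forall>\<^sub>F y in nhds p. f y = 0 \<and> y \<in> S"
      by (rule eventually_conj[OF p(2) eventually_nhds_in_open[OF CC(1)]]) (use p(1) C(4) in auto)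
    from eventually_compose_filterlim[OF this lim]
    have 1: "\<forall>\<^sub>F t in at_right (0::real). f (p + complex_of_real t *s w) = 0 \<and> p + complex_of_real t *s w \<in> S" .
    have "((\<lambda>t::real. complex_of_real t) \<longlongrightarrow> complex_of_real 0) (at_right 0)" by (intro tendsto_intros)
    then have "\<forall>\<^sub>F t in at_right (0::real). complex_of_real t \<in> D"
      using topological_tendstoD[OF _ openD] D01(1) by simp
    moreover have "\<forall>\<^sub>F t in at_right (0::real). 0 < t \<and> t < \<epsilon>"
      unfolding eventually_at_right_field using \<epsilon> by blast
    ultimately have "\<forall>\<^sub>F t in at_right (0::real). complex_of_real t \<in> Z \<and> 0 < t \<and> t < \<epsilon>"
      using 1
    proof eventually_elim
      case (elim t)
      then have "F (dg (p + complex_of_real t *s w)) = 0" using CC(5)[of "p + complex_of_real t *s w"] by auto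
      then show ?case using elim by (simp add: Z_def dg_add dg_of_real_smult)
    qed
    then obtain t where "complex_of_real t \<in> Z" "0 < t" "t < \<epsilon>"
      using eventually_happens[of _ "at_right (0::real)"] by force
    then show "\<exists>x'\<in>Z. x' \<noteq> 0 \<and> dist x' 0 < \<epsilon>" by (intro bexI[of _ "complex_of_real t"]) auto
  qed
  have "F (dg p + 1 *s dg w) = 0"
    by (rule analytic_continuation[OF hol openD conn _ D01(1) lim0 _ D01(2)]) (auto simp: Z_def)
  then show ?thesis using CC(5)[of z] z C(4) by (auto simp: w_def dg_diff)
qed

text \<open>V is the largest open subset of U mapped into M'. Each p in M has a neighbourhood X on
  which \<open>complexified_zero_continuation\<close> applies, so if V meets M inside X then p
  already lies in V. Thus M \<inter> V is relatively closed as well as open in M.\<close>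

lemma mapping_dichotomy:
  fixes M U :: "(complex ^ 'n) set" and M' :: "(complex ^ 'm) set"
  assumes M': "real_analytic_hypersurface M'" and M: "connected M" "M \<subseteq> U" "open U"
    and H: "H holomorphic_map_on U" "H ` M \<subseteq> M'"
    and no: "\<not> (\<exists>V. open V \<and> V \<subseteq> U \<and> M \<subseteq> V \<and> H ` V \<subseteq> M')"
    and q: "q \<in> M"
  shows "\<not> (\<forall>\<^sub>F z in nhds q. H z \<in> M')"
proof
  assume ev: "\<forall>\<^sub>F z in nhds q. H z \<in> M'"
  define V where "V = \<Union>{X. open X \<and> X \<subseteq> U \<and> H ` X \<subseteq> M'}"
  have V: "open V" "V \<subseteq> U" "H ` V \<subseteq> M'" unfolding V_def by auto
  have inV: "p \<in> V" if "open X" "p \<in> X" "X \<subseteq> U" "H ` X \<subseteq> M'" for p X using that unfolding V_def by blast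
  have "\<exists>X. open X \<and> p \<in> X \<and> (M \<inter> V \<inter> X \<noteq> {} \<longrightarrow> p \<in> V)" if p: "p \<in> M" for p
  proof -
    have Hp: "H p \<in> M'" using H(2) p by auto
    obtain W where W: "local_defining_function M' (H p) W (some_defining_function M' (H p))"
      by (rule some_defining_function[OF M' Hp])
    define \<rho> where "\<rho> = some_defining_function M' (H p)"
    obtain s R T where s: "s > 0" and chart: "hypersurface_chart M' (ball (H p) s) \<rho> R T"
      using local_defining_function_chart[OF W] unfolding \<rho>_def by metis
    interpret hypersurface_chart M' "ball (H p) s" \<rho> R T by (rule chart)
    define S where "S = U \<inter> H -` ball (H p) s"
    have S: "open S" "p \<in> S" "S \<subseteq> U"
      using continuous_open_preimage[OF continuous_on_holomorphic_map[OF H(1)] M(3), of "ball (H p) s"] p M(2) s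
      by (auto simp: S_def)
    have "H ` S \<subseteq> ball (H p) s" by (auto simp: S_def)
    then obtain F TT where F: "complexifies F TT (\<lambda>z. cx \<rho> (H z)) S"
      by (rule complexifies_compose[OF holomorphic_map_on_subset[OF H(1) S(3)] S(1) complexified]) blast
    obtain e where e: "e > 0" "ball (dg p) e \<subseteq> TT" using complexifiesD(2,4)[OF F] S(2) openE by blast
    define X where "X = S \<inter> dg -` ball (dg p) e"
    have X: "open X" "p \<in> X" "X \<subseteq> S" "dg ` X \<subseteq> ball (dg p) e"
      using S e by (auto simp: X_def intro!: continuous_open_preimage continuous_intros)
    have zero_iff: "H z \<in> M' \<longleftrightarrow> \<rho> (H z) = 0" if "z \<in> S" for z
      using zero_set that unfolding S_def by blast
    have "p \<in> V" if p2: "p2 \<in> M \<inter> V \<inter> X" for p2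
    proof -
      have "\<forall>\<^sub>F z in nhds p2. z \<in> V \<inter> S" using p2 V(1) S(1) X by (intro eventually_nhds_in_open) auto
      then have "\<forall>\<^sub>F z in nhds p2. complex_of_real (\<rho> (H z)) = 0"
        by eventually_elim (use zero_iff V(3) in auto)
      then have "complex_of_real (\<rho> (H z)) = 0" if "z \<in> X" for z
        using complexified_zero_continuation[OF F X(4) e(2) X(3) _ _ that] p2 by blast
      then have "H ` X \<subseteq> M'" using zero_iff X(3) by auto
      then show ?thesis using inV[OF X(1,2)] X(3) S(3) by blast
    qed
    then show ?thesis using X(1,2) by blast
  qed
  then obtain X where X: "\<And>p. p \<in> M \<Longrightarrow> open (X p) \<and> p \<in> X p \<and> (M \<inter> V \<inter> X p \<noteq> {} \<longrightarrow> p \<in> V)"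
    by metis
  \<comment> \<open>On M the open sets V and V' are disjoint and cover; connectedness leaves one of
    them without points of M.\<close>
  define V' where "V' = (\<Union>p\<in>M - V. X p)"
  have "V \<inter> M = {} \<or> V' \<inter> M = {}"
  proof (rule connectedD[OF M(1) V(1)])
    show "open V'" using X by (auto simp: V'_def)
    show "V \<inter> V' \<inter> M = {}" using X unfolding V'_def by blast
    show "M \<subseteq> V \<union> V'" using X unfolding V'_def by blast
  qed
  moreover have "q \<in> V"
  proof -
    obtain Y where Y: "open Y" "q \<in> Y" "\<forall>z\<in>Y. H z \<in> M'" using ev unfolding eventually_nhds by blast
    then show ?thesis using inV[of "Y \<inter> U" q] M q by auto
  qed
  moreover have "V' \<inter> M \<noteq> {}"
  proof -
    obtain p where "p \<in> M" "p \<notin> V" using no V by blast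
    then show ?thesis using X unfolding V'_def by blast
  qed
  ultimately show False using q by blast
qed

text \<open>The number e stands for the maximal index and is attained by definite subspaces P and Q
  at q itself. Injectivity of dH preserves their dimensions, so the images can be measured against
  the indices of M' at H q.\<close>

lemma pullback_bound:
  fixes M :: "(complex ^ 'n) set" and H :: "complex ^ 'n \<Rightarrow> complex ^ 'm"
  assumes chart: "hypersurface_chart M W \<rho> R T" and chart': "hypersurface_chart M' W' \<rho>' R' T'"
    and M': "real_analytic_hypersurface M'"
    and N: "open N" "N \<subseteq> W" "q \<in> M \<inter> N"
    and H: "H holomorphic_map_on N" "H ` N \<subseteq> W'" "H ` (M \<inter> N) \<subseteq> M'"
    and inj: "\<And>u. dir_deriv u H q = 0 \<Longrightarrow> u = 0"
    and P: "vec.subspace P" "P \<subseteq> holomorphic_tangent_space \<rho> q" "vec.dim P \<ge> e"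
      "\<And>u. u \<in> P \<Longrightarrow> u \<noteq> 0 \<Longrightarrow> Re (levi_form \<rho> q u u) > 0"
    and Q: "vec.subspace Q" "Q \<subseteq> holomorphic_tangent_space \<rho> q" "vec.dim Q \<ge> e"
      "\<And>u. u \<in> Q \<Longrightarrow> u \<noteq> 0 \<Longrightarrow> Re (levi_form \<rho> q u u) < 0"
  shows "e \<le> levi_e M' (H q) + levi_e0 M' (H q)"
proof -
  interpret c: hypersurface_chart M W \<rho> R T by (rule chart)
  interpret c': hypersurface_chart M' W' \<rho>' R' T' by (rule chart')
  have q: "q \<in> N" "q \<in> W" "q \<in> M" using N by auto
  have Hq: "H q \<in> M'" "H q \<in> W'" using H q by auto
  have van: "\<rho>' (H z) = 0" if "z \<in> M \<inter> N" for z
    using that H(2,3) c'.zero_set by blast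
  obtain F TT where F: "complexifies F TT (\<lambda>z. cx \<rho>' (H z)) N"
    and Fj: "\<And>y u. y \<in> TT \<Longrightarrow> inl y \<in> N \<and> dir_deriv (join u 0) F y = dir_deriv (join (dir_deriv u H (inl y)) 0) R' (cx_map H y)"
    and FL: "\<And>z u v. z \<in> N \<Longrightarrow> dir_deriv (join 0 (cnjv v)) (dir_deriv (join u 0) F) (dg z) =
       dir_deriv (join 0 (cnjv (dir_deriv v H z))) (dir_deriv (join (dir_deriv u H z) 0) R') (dg (H z))"
    by (rule complexifies_compose[OF H(1) N(1) c'.complexified H(2)]) blast
  obtain c :: real where cj: "\<And>w. dir_deriv (join w 0) F (dg q) = c * dir_deriv (join w 0) R (dg q)"
    and cl: "\<And>u v. u \<in> holomorphic_tangent_space \<rho> q \<Longrightarrow> v \<in> holomorphic_tangent_space \<rho> q \<Longrightarrow>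
      levi_form (\<lambda>z. \<rho>' (H z)) q u v = c * levi_form \<rho> q u v"
    using c.levi_form_proportional[OF F N(2) van N(3)] by metis
  define D where "D u = dir_deriv u H q" for u
  have lev1: "levi_form \<rho>' (H q) (D u) (D v) = c * levi_form \<rho> q u v"
    if "u \<in> holomorphic_tangent_space \<rho> q" "v \<in> holomorphic_tangent_space \<rho> q" for u v
    using cl[OF that] levi_form_complexified[OF F q(1)] levi_form_complexified[OF c'.complexified Hq(2)] FL[OF q(1)]
    by (simp add: D_def)
  have tan1: "D u \<in> holomorphic_tangent_space \<rho>' (H q)" if u: "u \<in> holomorphic_tangent_space \<rho> q" for u
  proof -
    have "dir_deriv (join u 0) R (dg q) = 0"
      using holomorphic_tangent_space_complexified[OF c.complexified q(2)] u by blast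
    then have "dir_deriv (join (D u) 0) R' (dg (H q)) = 0"
      using cj[of u] Fj[OF complexifiesD(4)[OF F q(1)], of u] by (simp add: cx_map_dg D_def)
    then show ?thesis
      using holomorphic_tangent_space_complexified[OF c'.complexified Hq(2)] by blast
  qed
  \<comment> \<open>\<open>levi_e\<close> and \<open>levi_e0\<close> refer to the defining function
    selected at H q, whereas \<rho>' belongs to the given chart; a further real factor k relates
    their Levi forms.\<close>
  define \<tau> where "\<tau> = some_defining_function M' (H q)"
  obtain W2 where "local_defining_function M' (H q) W2 \<tau>"
    using some_defining_function[OF M' Hq(1)] unfolding \<tau>_def by blast
  then obtain s R2 T2 where s: "s > 0" and chart2: "hypersurface_chart M' (ball (H q) s) \<tau> R2 T2"
    by (rule local_defining_function_chart)
  interpret c2: hypersurface_chart M' "ball (H q) s" \<tau> R2 T2 by (rule chart2)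
  have Hq2: "H q \<in> ball (H q) s" using s by simp
  have C2: "complexifies R2 T2 (cx \<tau>) (ball (H q) s \<inter> W')"
    using c'.chart(1) by (intro complexifies_subset[OF c2.complexified]) auto
  have van2: "\<tau> z = 0" if "z \<in> M' \<inter> (ball (H q) s \<inter> W')" for z
    using that c2.zero_set by blast
  obtain k :: real where kd: "\<And>w. dir_deriv (dg w) R2 (dg (H q)) = k * dir_deriv (dg w) R' (dg (H q))"
    and kj: "\<And>w. dir_deriv (join w 0) R2 (dg (H q)) = k * dir_deriv (join w 0) R' (dg (H q))"
    and kl: "\<And>u v. u \<in> holomorphic_tangent_space \<rho>' (H q) \<Longrightarrow> v \<in> holomorphic_tangent_space \<rho>' (H q) \<Longrightarrow>
      levi_form \<tau> (H q) u v = k * levi_form \<rho>' (H q) u v"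
    using c'.levi_form_proportional[OF C2 _ van2, of "H q"] Hq Hq2 by (metis IntI inf_le2)
  have tan2: "D u \<in> holomorphic_tangent_space \<tau> (H q)" if "u \<in> holomorphic_tangent_space \<rho> q" for u
    using tan1[OF that] kj[of "D u"] holomorphic_tangent_space_complexified[OF c'.complexified Hq(2)]
      holomorphic_tangent_space_complexified[OF c2.complexified Hq2] by simp
  have lev2: "levi_form \<tau> (H q) (D u) (D u) = of_real (k * c) * levi_form \<rho> q u u"
    if "u \<in> holomorphic_tangent_space \<rho> q" for u
    using kl[OF tan1[OF that] tan1[OF that]] lev1[OF that that] by simp
  have linD: "Vector_Spaces.linear (*s) (*s) D"
    unfolding D_def by (rule linear_dir_deriv[OF H(1) q(1)])
  have injD: "inj_on D A" for A
  proof (rule inj_onI)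
    fix x y assume "D x = D y"
    then have "D (x - y) = 0" by (simp add: vec.linear_diff[OF linD])
    then show "x = y" using inj[of "x - y"] by (simp add: D_def)
  qed
  have img: "vec.subspace (D ` A)" "D ` A \<subseteq> holomorphic_tangent_space \<tau> (H q)" "e \<le> vec.dim (D ` A)"
    if "vec.subspace A" "A \<subseteq> holomorphic_tangent_space \<rho> q" "vec.dim A \<ge> e" for A
    using vec.linear_subspace_image[OF linD that(1)] tan2 that(2,3) vec.dim_image_eq[OF linD injD, of A] by auto
  note imP = img[OF P(1-3)] and imQ = img[OF Q(1-3)]
  have le: "levi_e M' (H q) = min (levi_pos \<tau> (H q)) (levi_neg \<tau> (H q))" "levi_e0 M' (H q) = levi_zero \<tau> (H q)"
    by (simp_all add: levi_e_def levi_e0_def \<tau>_def)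
  have reD: "Re (levi_form \<tau> (H q) (D u) (D u)) = k * c * Re (levi_form \<rho> q u u)"
    if "u \<in> holomorphic_tangent_space \<rho> q" for u
    using lev2[OF that] by simp
  have D0: "D 0 = 0" by (rule vec.linear_0[OF linD])
  note dims = levi_dim_le_pos[OF c2.complexified Hq2] levi_dim_le_neg[OF c2.complexified Hq2]
    levi_dim_le_isotropic[OF c2.complexified Hq2]
  \<comment> \<open>Only the product of the two factors matters: its sign decides whether P and Q
    keep or exchange their roles, and if it is 0 the image of P is isotropic.\<close>
  consider "k * c = 0" | "k * c > 0" | "k * c < 0" by linarith
  then show ?thesis
  proof cases
    case 1
    have "levi_form \<tau> (H q) y y = 0" if y: "y \<in> D ` P" for y
    proof -
      obtain u where u: "u \<in> P" "y = D u" using y by blast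
      then have "u \<in> holomorphic_tangent_space \<rho> q" using P(2) by blast
      from lev2[OF this] show ?thesis unfolding u(2) 1 by simp
    qed
    then have "vec.dim (D ` P) \<le> min (levi_pos \<tau> (H q)) (levi_neg \<tau> (H q)) + levi_zero \<tau> (H q)"
      by (rule dims(3)[OF imP(1,2)])
    then show ?thesis using imP(3) unfolding le by linarith
  next
    case 2
    have "vec.dim (D ` P) \<le> levi_pos \<tau> (H q)"
    proof (rule dims(1)[OF imP(1,2)])
      fix y assume "y \<in> D ` P" "y \<noteq> 0"
      then obtain u where u: "u \<in> P" "y = D u" "u \<noteq> 0" using D0 by blast
      then have "u \<in> holomorphic_tangent_space \<rho> q" using P(2) by blast
      from reD[OF this] show "0 < Re (levi_form \<tau> (H q) y y)" using P(4)[OF u(1,3)] 2 u(2) by simp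
    qed
    moreover have "vec.dim (D ` Q) \<le> levi_neg \<tau> (H q)"
    proof (rule dims(2)[OF imQ(1,2)])
      fix y assume "y \<in> D ` Q" "y \<noteq> 0"
      then obtain u where u: "u \<in> Q" "y = D u" "u \<noteq> 0" using D0 by blast
      then have "u \<in> holomorphic_tangent_space \<rho> q" using Q(2) by blast
      from reD[OF this] show "Re (levi_form \<tau> (H q) y y) < 0"
        using Q(4)[OF u(1,3)] 2 u(2) by (simp add: mult_pos_neg)
    qed
    ultimately show ?thesis using imP(3) imQ(3) unfolding le by linarith
  next
    case 3
    have "vec.dim (D ` P) \<le> levi_neg \<tau> (H q)"
    proof (rule dims(2)[OF imP(1,2)])
      fix y assume "y \<in> D ` P" "y \<noteq> 0"
      then obtain u where u: "u \<in> P" "y = D u" "u \<noteq> 0" using D0 by blast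
      then have "u \<in> holomorphic_tangent_space \<rho> q" using P(2) by blast
      from reD[OF this] show "Re (levi_form \<tau> (H q) y y) < 0"
        using P(4)[OF u(1,3)] 3 u(2) by (simp add: mult_neg_pos)
    qed
    moreover have "vec.dim (D ` Q) \<le> levi_pos \<tau> (H q)"
    proof (rule dims(1)[OF imQ(1,2)])
      fix y assume "y \<in> D ` Q" "y \<noteq> 0"
      then obtain u where u: "u \<in> Q" "y = D u" "u \<noteq> 0" using D0 by blast
      then have "u \<in> holomorphic_tangent_space \<rho> q" using Q(2) by blast
      from reD[OF this] show "0 < Re (levi_form \<tau> (H q) y y)"
        using Q(4)[OF u(1,3)] 3 u(2) by (simp add: mult_neg_neg)
    qed
    ultimately show ?thesis using imP(3) imQ(3) unfolding le by linarith
  qed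
qed

theorem theorem5p7:
  fixes M U :: "(complex ^ 'n) set"
    and M' :: "(complex ^ 'm) set"
    and H :: "complex ^ 'n \<Rightarrow> complex ^ 'm"
  assumes "real_analytic_hypersurface M" and "connected M"
    and "real_analytic_hypersurface M'" and "connected M'"
    and "open U" and "M \<subseteq> U"
    and "holomorphically_nondegenerate M"
    and "\<forall>p'\<in>M'. levi_e M' p' + levi_e0 M' p' < (SUP q\<in>M. levi_e M q)"
    and "H holomorphic_map_on U"
    and "H ` M \<subseteq> M'"
  shows "\<exists>V. open V \<and> V \<subseteq> U \<and> M \<subseteq> V \<and> H ` V \<subseteq> M'"
proof (cases "M = {}")
  case True
  then show ?thesis by (intro exI[of _ "{}"]) auto
next
  case False
  show ?thesis
  proof (rule ccontr)
    assume no: "\<not> ?thesis"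
    have never: "\<not> (\<forall>\<^sub>F z in nhds q. H z \<in> M')" if "q \<in> M" for q
      by (rule mapping_dichotomy[OF assms(3,2,6,5,9,10) no that])
    \<comment> \<open>A nonempty bounded set of natural numbers contains its supremum, which
      provides the maximum point q0.\<close>
    have "finite (levi_e M ` M)"
      using levi_e_le[OF assms(1)] unfolding finite_nat_set_iff_bounded_le by blast
    then have "(SUP q\<in>M. levi_e M q) \<in> levi_e M ` M"
      using cSup_eq_Max[of "levi_e M ` M"] Max_in[of "levi_e M ` M"] False by simp
    then obtain q0 where q0: "q0 \<in> M" "(SUP q\<in>M. levi_e M q) = levi_e M q0" by blast
    define \<rho> where "\<rho> = some_defining_function M q0"
    obtain W0 where "local_defining_function M q0 W0 \<rho>"
      using some_defining_function[OF assms(1) q0(1)] unfolding \<rho>_def by blast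
    then obtain s R T where s: "s > 0" and chart: "hypersurface_chart M (ball q0 s) \<rho> R T"
        and ra: "\<rho> real_analytic_on ball q0 s"
      by (rule local_defining_function_chart)
    interpret c: hypersurface_chart M "ball q0 s" \<rho> R T by (rule chart)
    have Hq0: "H q0 \<in> M'" using assms(10) q0 by auto
    obtain W' where "local_defining_function M' (H q0) W' (some_defining_function M' (H q0))"
      by (rule some_defining_function[OF assms(3) Hq0])
    then obtain s' R' T' where s': "s' > 0"
        and chart': "hypersurface_chart M' (ball (H q0) s') (some_defining_function M' (H q0)) R' T'"
      by (rule local_defining_function_chart)
    define \<rho>' where "\<rho>' = some_defining_function M' (H q0)"
    interpret c': hypersurface_chart M' "ball (H q0) s'" \<rho>' R' T' using chart' unfolding \<rho>'_def .
    have q0B: "q0 \<in> ball q0 s" using s by simp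
    obtain P0 where P0: "vec.subspace P0" "P0 \<subseteq> holomorphic_tangent_space \<rho> q0" "vec.dim P0 = levi_pos \<rho> q0"
        "\<And>u. u \<in> P0 \<Longrightarrow> u \<noteq> 0 \<Longrightarrow> Re (levi_form \<rho> q0 u u) > 0"
      by (rule levi_exists_positive[OF c.complexified q0B]) blast
    obtain Q0 where Q0: "vec.subspace Q0" "Q0 \<subseteq> holomorphic_tangent_space \<rho> q0" "vec.dim Q0 = levi_neg \<rho> q0"
        "\<And>u. u \<in> Q0 \<Longrightarrow> u \<noteq> 0 \<Longrightarrow> Re (levi_form \<rho> q0 u u) < 0"
      by (rule levi_exists_negative[OF c.complexified q0B]) blast
    have "\<forall>\<^sub>F q in nhds q0. \<exists>S'. vec.subspace S' \<and> S' \<subseteq> holomorphic_tangent_space \<rho> q \<and> vec.dim S' = vec.dim P0 \<and>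
       (\<forall>u\<in>S'. u \<noteq> 0 \<longrightarrow> 1 * Re (levi_form \<rho> q u u) > 0)"
      by (rule c.stable_definite[OF q0B P0(1,2)]) (use P0(4) in simp)
    moreover have "\<forall>\<^sub>F q in nhds q0. \<exists>S'. vec.subspace S' \<and> S' \<subseteq> holomorphic_tangent_space \<rho> q \<and> vec.dim S' = vec.dim Q0 \<and>
       (\<forall>u\<in>S'. u \<noteq> 0 \<longrightarrow> (-1) * Re (levi_form \<rho> q u u) > 0)"
      by (rule c.stable_definite[OF q0B Q0(1,2)]) (use Q0(4) in simp)
    moreover have "\<forall>\<^sub>F q in nhds q0. q \<in> ball q0 s \<inter> (U \<inter> H -` ball (H q0) s')"
      using continuous_open_preimage[OF continuous_on_holomorphic_map[OF assms(9)] assms(5), of "ball (H q0) s'"]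
        q0(1) assms(6) s s'
      by (intro eventually_nhds_in_open) auto
    ultimately have "\<forall>\<^sub>F q in nhds q0. q \<in> ball q0 s \<inter> (U \<inter> H -` ball (H q0) s') \<and>
       (\<exists>S'. vec.subspace S' \<and> S' \<subseteq> holomorphic_tangent_space \<rho> q \<and> vec.dim S' = levi_pos \<rho> q0 \<and>
         (\<forall>u\<in>S'. u \<noteq> 0 \<longrightarrow> Re (levi_form \<rho> q u u) > 0)) \<and>
       (\<exists>S'. vec.subspace S' \<and> S' \<subseteq> holomorphic_tangent_space \<rho> q \<and> vec.dim S' = levi_neg \<rho> q0 \<and>
         (\<forall>u\<in>S'. u \<noteq> 0 \<longrightarrow> Re (levi_form \<rho> q u u) < 0))"
      by eventually_elim (simp add: P0(3) Q0(3))
    \<comment> \<open>The injective point produced below lies somewhere in N, so on all of N the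
      definite subspaces of the dimensions at q0 must persist and H must land in the chart around H
      q0.\<close>
    then obtain N where N: "open N" "q0 \<in> N" and inN: "\<And>q. q \<in> N \<Longrightarrow> q \<in> ball q0 s \<inter> (U \<inter> H -` ball (H q0) s')"
      and posN: "\<And>q. q \<in> N \<Longrightarrow> \<exists>S'. vec.subspace S' \<and> S' \<subseteq> holomorphic_tangent_space \<rho> q \<and> vec.dim S' = levi_pos \<rho> q0 \<and>
         (\<forall>u\<in>S'. u \<noteq> 0 \<longrightarrow> Re (levi_form \<rho> q u u) > 0)"
      and negN: "\<And>q. q \<in> N \<Longrightarrow> \<exists>S'. vec.subspace S' \<and> S' \<subseteq> holomorphic_tangent_space \<rho> q \<and> vec.dim S' = levi_neg \<rho> q0 \<and>
         (\<forall>u\<in>S'. u \<noteq> 0 \<longrightarrow> Re (levi_form \<rho> q u u) < 0)"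
      unfolding eventually_nhds by blast
    have NB: "N \<subseteq> ball q0 s" "H ` N \<subseteq> ball (H q0) s'" "N \<subseteq> U" using inN by auto
    have HN: "H holomorphic_map_on N" by (rule holomorphic_map_on_subset[OF assms(9) NB(3)])
    have zero_iff: "H z \<in> M' \<longleftrightarrow> \<rho>' (H z) = 0" if "z \<in> N" for z
      using c'.zero_set NB(2) that by blast
    have "\<exists>q\<in>M \<inter> N. \<forall>u. dir_deriv u H q = 0 \<longrightarrow> u = 0"
    proof (rule c.exists_injective_point[OF ra assms(7) N(1) NB(1) _ HN NB(2) c'.complexified])
      show "complex_of_real (\<rho>' (H z)) = 0" if "z \<in> M \<inter> N" for z
        using that zero_iff assms(10) by auto
      show "\<not> (\<forall>\<^sub>F z in nhds q. complex_of_real (\<rho>' (H z)) = 0)" if q: "q \<in> M \<inter> N" for q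
      proof
        assume "\<forall>\<^sub>F z in nhds q. complex_of_real (\<rho>' (H z)) = 0"
        moreover have "\<forall>\<^sub>F z in nhds q. z \<in> N" using N q by (intro eventually_nhds_in_open) auto
        ultimately have "\<forall>\<^sub>F z in nhds q. H z \<in> M'" by eventually_elim (use zero_iff in auto)
        then show False using never q by blast
      qed
    qed (use q0 N in auto)
    then obtain q where q: "q \<in> M \<inter> N" "\<And>u. dir_deriv u H q = 0 \<Longrightarrow> u = 0" by blast
    have qN: "q \<in> N" using q by blast
    obtain P where P: "vec.subspace P" "P \<subseteq> holomorphic_tangent_space \<rho> q" "vec.dim P = levi_pos \<rho> q0"
        "\<forall>u\<in>P. u \<noteq> 0 \<longrightarrow> Re (levi_form \<rho> q u u) > 0"
      using posN[OF qN] by blast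
    obtain Q where Q: "vec.subspace Q" "Q \<subseteq> holomorphic_tangent_space \<rho> q" "vec.dim Q = levi_neg \<rho> q0"
        "\<forall>u\<in>Q. u \<noteq> 0 \<longrightarrow> Re (levi_form \<rho> q u u) < 0"
      using negN[OF qN] by blast
    have e: "levi_e M q0 = min (levi_pos \<rho> q0) (levi_neg \<rho> q0)" by (simp add: levi_e_def \<rho>_def)
    have "levi_e M q0 \<le> levi_e M' (H q) + levi_e0 M' (H q)"
    proof (rule pullback_bound[OF chart c'.hypersurface_chart_axioms assms(3) N(1) NB(1) q(1) HN NB(2) _ q(2) P(1,2) _ _ Q(1,2)])
      show "H ` (M \<inter> N) \<subseteq> M'" using assms(10) by auto
    qed (use P Q e in auto)
    moreover have "H q \<in> M'" using q assms(10) by auto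
    ultimately show False using assms(8) q0(2) by fastforce
  qed
qed

end
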